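(* Let $m\ge 4$ with $m\neq 6$, let $\Gamma=\mathrm{Sym}(m)$, and let $\rho:\Gamma\to\mathrm{O}(n)$ be a faithful irreducible representation of dimension $n=n(\rho)$ whose character $\chi$ satisfies $$\chi(x)\equiv n \pmod 8,\qquad \chi(xy)\equiv n\pmod 8$$ for any disjoint transpositions $x,y\in\Gamma$, and $$\frac1l\sum_{k=0}^{l-1}(-1)^k\chi(z^k)>0$$ for every odd permutation $z\in\Gamma$, where $l=l(z)=\mathrm{ord}(z)$ is the order of $z$. Let $\pi:\mathrm{Pin}(n)\to\mathrm{O}(n)$ be the standard covering homomorphism. Then: (a) if $n$ is odd, there is an admissible quadruple $(\mathrm{Spin}(n),\phi_1,\phi_2,\Gamma)$ with $\pi(\phi_i(\Gamma))=\rho(\Gamma)$ for $i=1,2$; (b) there is an admissible quadruple $(\mathrm{Pin}(n),\phi_1,\phi_2,\Gamma)$ with $\pi(\phi_i(\Gamma))=\rho(\Gamma)$ for $i=1,2$.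
   Context: $\mathrm{Pin}(n)$ is the group generated by unit vectors in the Clifford algebra of Euclidean $\mathbb{R}^n$ (convention $v\cdot v=-|v|^2$), $\pi:\mathrm{Pin}(n)\to\mathrm{O}(n)$ the standard two-fold covering, and $\mathrm{Spin}(n)=\pi^{-1}(\mathrm{SO}(n))$. Let $G$ be a Lie group and $\Gamma$ a finite group. Two homomorphisms $\phi_1,\phi_2:\Gamma\to G$ are element-wise (or almost) conjugate if for every $\gamma\in\Gamma$ there is $x(\gamma)\in G$ with $\phi_1(\gamma)=x(\gamma)\phi_2(\gamma)x(\gamma)^{-1}$. The quadruple $(G,\phi_1,\phi_2,\Gamma)$ is called admissible if $\phi_1,\phi_2:\Gamma\to G$ are element-wise conjugate and the subgroups $\phi_1(\Gamma),\phi_2(\Gamma)\subset G$ are not related by any inner automorphism of $G$. *)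

theory Defs
  imports
    "HOL-Analysis.Analysis"
    "HOL-Algebra.Sym_Groups"
    "HOL-Algebra.Multiplicative_Group"
    "HOL-Library.Real_Mod"
begin

section \<open>The Clifford algebra of Euclidean space\<close>

text \<open>
  The Clifford algebra of \<^typ>\<open>real^'n\<close> (with \<open>v \<cdot> v = - |v|\<^sup>2\<close>) on its standard basis
  \<open>e\<^sub>A\<close>, where \<open>A\<close> ranges over the subsets of the index type and \<open>e\<^sub>A\<close> stands for the product of
  the basis vectors \<open>e\<^sub>a\<close>, \<open>a \<in> A\<close>, in increasing order.  The index type carries no canonical
  order; we use the one induced by the injection \<^const>\<open>to_nat\<close>.  The lemmas
  \<open>clifford_vec_sq\<close>, \<open>blade_insert\<close> and \<open>clifford_expand\<close> identify the result as the algebra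
  generated by \<^typ>\<open>real^'n\<close> subject to the Clifford relation, of dimension \<open>2\<^sup>n\<close>, and
  \<open>clifford_universal\<close> is its universal property.
\<close>

typedef (overloaded) 'n clifford = "UNIV :: ('n::finite set \<Rightarrow> real) set"
  morphisms clifford_coeff Clifford ..

setup_lifting type_definition_clifford

lemma clifford_eqI: "(\<And>A. clifford_coeff x A = clifford_coeff y A) \<Longrightarrow> x = y"
  by transfer auto

text \<open>
  \<open>e\<^sub>A e\<^sub>B = blade_sign A B \<cdot> e\<^sub>C\<close> with \<open>C\<close> the symmetric difference of \<open>A\<close> and \<open>B\<close>: each pair
  \<open>a > b\<close> contributes a transposition \<open>e\<^sub>a e\<^sub>b = - e\<^sub>b e\<^sub>a\<close>, each pair \<open>a = b\<close> a square \<open>e\<^sub>a\<^sup>2 = -1\<close>.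
\<close>

definition blade_sign :: "'n::finite set \<Rightarrow> 'n set \<Rightarrow> real" where
  "blade_sign A B = (\<Prod>a\<in>A. \<Prod>b\<in>B. if to_nat b \<le> to_nat a then -1 else 1)"

lemma prod_sym_diff:
  fixes f :: "'a::finite \<Rightarrow> real"
  assumes "\<And>a. f a * f a = 1"
  shows "prod f (sym_diff A B) = prod f A * prod f B"
proof -
  have sq: "prod f X * prod f X = 1" for X
    by (simp add: prod.distrib[symmetric] assms)
  have "prod f (sym_diff A B) = prod f (A - B) * prod f (B - A)"
    by (rule prod.union_disjoint) auto
  moreover have "prod f A = prod f (A - B) * prod f (A \<inter> B)"
    by (subst prod.union_disjoint[symmetric]) (auto intro: prod.cong)
  moreover have "prod f B = prod f (B - A) * prod f (A \<inter> B)"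
    by (subst prod.union_disjoint[symmetric]) (auto intro: prod.cong)
  ultimately show ?thesis
    using sq[of "A \<inter> B"] by (simp add: algebra_simps)
qed

lemma blade_sign_sym_diff_left:
  "blade_sign (sym_diff A B) C = blade_sign A C * blade_sign B C"
  unfolding blade_sign_def
  by (rule prod_sym_diff) (auto simp: prod.distrib[symmetric] intro!: prod.neutral)

lemma blade_sign_sym_diff_right:
  "blade_sign A (sym_diff B C) = blade_sign A B * blade_sign A C"
  unfolding blade_sign_def
  by (subst prod_sym_diff) (simp_all add: prod.distrib)

lemma blade_sign_empty [simp]: "blade_sign {} B = 1" "blade_sign A {} = 1"
  by (simp_all add: blade_sign_def)

lemma sym_diff_cancel [simp]: "sym_diff A (sym_diff A B) = B"
  by auto

lemma sum_sym_diff_reindex: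
  fixes f :: "'n::finite set \<Rightarrow> 'b::comm_monoid_add"
  shows "(\<Sum>B\<in>UNIV. f (sym_diff A B)) = (\<Sum>B\<in>UNIV. f B)"
  by (rule sum.reindex_bij_witness[where i = "sym_diff A" and j = "sym_diff A"]) auto

instantiation clifford :: (finite) real_algebra_1
begin

lift_definition zero_clifford :: "'a clifford" is "\<lambda>_. 0" .
lift_definition one_clifford :: "'a clifford" is "\<lambda>A. if A = {} then 1 else 0" .
lift_definition plus_clifford :: "'a clifford \<Rightarrow> 'a clifford \<Rightarrow> 'a clifford"
  is "\<lambda>x y A. x A + y A" .
lift_definition minus_clifford :: "'a clifford \<Rightarrow> 'a clifford \<Rightarrow> 'a clifford"
  is "\<lambda>x y A. x A - y A" .
lift_definition uminus_clifford :: "'a clifford \<Rightarrow> 'a clifford"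
  is "\<lambda>x A. - x A" .
lift_definition scaleR_clifford :: "real \<Rightarrow> 'a clifford \<Rightarrow> 'a clifford"
  is "\<lambda>r x A. r * x A" .
lift_definition times_clifford :: "'a clifford \<Rightarrow> 'a clifford \<Rightarrow> 'a clifford"
  is "\<lambda>x y C. \<Sum>A\<in>UNIV. blade_sign A (sym_diff A C) * x A * y (sym_diff A C)" .

instance
proof
  fix x y z :: "'a clifford" and r s :: real
  show "x + y + z = x + (y + z)" "x + y = y + x" "0 + x = x" "- x + x = 0" "x - y = x + - y"
    by (transfer; auto)+
  show "r *\<^sub>R (x + y) = r *\<^sub>R x + r *\<^sub>R y" "(r + s) *\<^sub>R x = r *\<^sub>R x + s *\<^sub>R x"
    "r *\<^sub>R s *\<^sub>R x = (r * s) *\<^sub>R x" "1 *\<^sub>R x = x"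
    by (transfer; auto simp: algebra_simps)+
  show "(x + y) * z = x * z + y * z" "x * (y + z) = x * y + x * z"
    by (transfer; auto simp: algebra_simps sum.distrib)+
  show "r *\<^sub>R x * y = r *\<^sub>R (x * y)" "x * r *\<^sub>R y = r *\<^sub>R (x * y)"
    by (transfer; auto simp: algebra_simps sum_distrib_left intro!: sum.cong)+
  show "(0::'a clifford) \<noteq> 1"
    by transfer (auto simp: fun_eq_iff)
  show "1 * x = x"
  proof transfer
    fix x :: "'a set \<Rightarrow> real"
    show "(\<lambda>C. \<Sum>A\<in>UNIV. blade_sign A (sym_diff A C) * (if A = {} then 1 else 0) * x (sym_diff A C)) = x"
    proof
      fix C
      have "(\<Sum>A\<in>UNIV. blade_sign A (sym_diff A C) * (if A = {} then 1 else 0) * x (sym_diff A C))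
          = (\<Sum>A\<in>(UNIV :: 'a set set). if A = {} then x C else 0)"
        by (rule sum.cong) simp_all
      then show "(\<Sum>A\<in>UNIV. blade_sign A (sym_diff A C) * (if A = {} then 1 else 0) * x (sym_diff A C)) = x C"
        by simp
    qed
  qed
  show "x * 1 = x"
  proof transfer
    fix x :: "'a set \<Rightarrow> real"
    show "(\<lambda>C. \<Sum>A\<in>UNIV. blade_sign A (sym_diff A C) * x A * (if sym_diff A C = {} then 1 else 0)) = x"
    proof
      fix C
      have "(\<Sum>A\<in>UNIV. blade_sign A (sym_diff A C) * x A * (if sym_diff A C = {} then 1 else 0))
          = (\<Sum>A\<in>UNIV. if A = C then x C else 0)"
        by (rule sum.cong) auto
      then show "(\<Sum>A\<in>UNIV. blade_sign A (sym_diff A C) * x A * (if sym_diff A C = {} then 1 else 0)) = x C"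
        by simp
    qed
  qed
  show "x * y * z = x * (y * z)"
  proof transfer
    fix x y z :: "'a set \<Rightarrow> real"
    let ?s = blade_sign
    show "(\<lambda>C. \<Sum>D\<in>UNIV. ?s D (sym_diff D C) *
             (\<Sum>A\<in>UNIV. ?s A (sym_diff A D) * x A * y (sym_diff A D)) * z (sym_diff D C))
        = (\<lambda>C. \<Sum>A\<in>UNIV. ?s A (sym_diff A C) * x A *
             (\<Sum>B\<in>UNIV. ?s B (sym_diff B (sym_diff A C)) * y B * z (sym_diff B (sym_diff A C))))"
    proof
      fix C
      have eq: "?s D (sym_diff D C) * (?s A (sym_diff A D) * x A * y (sym_diff A D)) * z (sym_diff D C)
          = ?s A (sym_diff A C) * x A *
             (?s (sym_diff A D) (sym_diff D C) * y (sym_diff A D) * z (sym_diff D C))" for A D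
      proof -
        have "?s D (sym_diff D C) = ?s (sym_diff A (sym_diff A D)) (sym_diff D C)"
          by simp
        also have "\<dots> = ?s A (sym_diff D C) * ?s (sym_diff A D) (sym_diff D C)"
          by (rule blade_sign_sym_diff_left)
        finally have 1: "?s D (sym_diff D C) = \<dots>" .
        have "sym_diff A C = sym_diff (sym_diff A D) (sym_diff D C)"
          by auto
        then have 2: "?s A (sym_diff A C) = ?s A (sym_diff A D) * ?s A (sym_diff D C)"
          using blade_sign_sym_diff_right[of A "sym_diff A D" "sym_diff D C"] by simp
        show ?thesis unfolding 1 2 by (simp only: mult_ac)
      qed
      have "(\<Sum>D\<in>UNIV. ?s D (sym_diff D C) *
             (\<Sum>A\<in>UNIV. ?s A (sym_diff A D) * x A * y (sym_diff A D)) * z (sym_diff D C))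
         = (\<Sum>D\<in>UNIV. \<Sum>A\<in>UNIV. ?s D (sym_diff D C) *
             (?s A (sym_diff A D) * x A * y (sym_diff A D)) * z (sym_diff D C))"
        by (simp only: sum_distrib_left sum_distrib_right)
      also have "\<dots> = (\<Sum>A\<in>UNIV. \<Sum>D\<in>UNIV. ?s A (sym_diff A C) * x A *
             (?s (sym_diff A D) (sym_diff D C) * y (sym_diff A D) * z (sym_diff D C)))"
        by (subst sum.swap) (simp only: eq)
      also have "\<dots> = (\<Sum>A\<in>UNIV. \<Sum>D\<in>UNIV. ?s A (sym_diff A C) * x A *
             (?s (sym_diff A D) (sym_diff (sym_diff A D) (sym_diff A C)) * y (sym_diff A D)
               * z (sym_diff (sym_diff A D) (sym_diff A C))))"
      proof -
        have "sym_diff (sym_diff A D) (sym_diff A C) = sym_diff D C" for A D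
          by auto
        then show ?thesis by simp
      qed
      also have "\<dots> = (\<Sum>A\<in>UNIV. \<Sum>B\<in>UNIV. ?s A (sym_diff A C) * x A *
             (?s B (sym_diff B (sym_diff A C)) * y B * z (sym_diff B (sym_diff A C))))"
        (is "(\<Sum>A\<in>UNIV. \<Sum>D\<in>UNIV. ?f A (sym_diff A D)) = (\<Sum>A\<in>UNIV. \<Sum>B\<in>UNIV. ?f A B)")
        by (rule sum.cong[OF refl], rule sum_sym_diff_reindex)
      finally show "(\<Sum>D\<in>UNIV. ?s D (sym_diff D C) *
             (\<Sum>A\<in>UNIV. ?s A (sym_diff A D) * x A * y (sym_diff A D)) * z (sym_diff D C))
        = (\<Sum>A\<in>UNIV. ?s A (sym_diff A C) * x A *
             (\<Sum>B\<in>UNIV. ?s B (sym_diff B (sym_diff A C)) * y B * z (sym_diff B (sym_diff A C))))"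
        by (simp only: sum_distrib_left)
    qed
  qed
qed

end

lemma clifford_coeff_sum: "clifford_coeff (\<Sum>i\<in>I. f i) A = (\<Sum>i\<in>I. clifford_coeff (f i) A)"
  by (induction I rule: infinite_finite_induct)
     (simp_all add: zero_clifford.rep_eq plus_clifford.rep_eq)

lift_definition blade :: "'n::finite set \<Rightarrow> 'n clifford" is "\<lambda>A B. if B = A then 1 else 0" .

lemma blade_empty: "blade {} = 1"
  by transfer auto

lemma clifford_expand: "x = (\<Sum>A\<in>UNIV. clifford_coeff x A *\<^sub>R blade A)"
proof (rule clifford_eqI)
  fix A
  have "(\<Sum>B\<in>UNIV. clifford_coeff x B * (if A = B then 1 else 0)) = clifford_coeff x A"
    by (simp add: if_distrib cong: if_cong)
  then show "clifford_coeff x A = clifford_coeff (\<Sum>A\<in>UNIV. clifford_coeff x A *\<^sub>R blade A) A"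
    by (simp add: clifford_coeff_sum scaleR_clifford.rep_eq blade.rep_eq)
qed

lemma blade_mult: "blade A * blade B = blade_sign A B *\<^sub>R blade (sym_diff A B)"
proof transfer
  fix A B :: "'n::finite set"
  show "(\<lambda>C. \<Sum>A'\<in>UNIV. blade_sign A' (sym_diff A' C) * (if A' = A then 1 else 0)
             * (if sym_diff A' C = B then 1 else 0))
      = (\<lambda>C. blade_sign A B * (if C = sym_diff A B then 1 else 0))"
  proof
    fix C
    have "sym_diff A C = B \<longleftrightarrow> C = sym_diff A B" by auto
    then have "(\<Sum>A'\<in>UNIV. blade_sign A' (sym_diff A' C) * (if A' = A then 1 else 0)
             * (if sym_diff A' C = B then 1 else 0))
       = (\<Sum>A'\<in>UNIV. if A' = A then blade_sign A B * (if C = sym_diff A B then 1 else 0) else 0)"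
      by (intro sum.cong refl) auto
    then show "(\<Sum>A'\<in>UNIV. blade_sign A' (sym_diff A' C) * (if A' = A then 1 else 0)
             * (if sym_diff A' C = B then 1 else 0))
       = blade_sign A B * (if C = sym_diff A B then 1 else 0)"
      by simp
  qed
qed

lemma blade_insert:
  assumes "\<And>b. b \<in> A \<Longrightarrow> to_nat a < to_nat b"
  shows "blade (insert a A) = blade {a} * blade A"
proof -
  have "a \<notin> A" using assms by auto
  then have "sym_diff {a} A = insert a A" by auto
  moreover have "blade_sign {a} A = 1"
    unfolding blade_sign_def using assms by (auto intro!: prod.neutral simp: not_le)
  ultimately show ?thesis
    by (simp add: blade_mult)
qed

definition clifford_vec :: "real^'n::finite \<Rightarrow> 'n clifford" where
  "clifford_vec v = (\<Sum>i\<in>UNIV. (v $ i) *\<^sub>R blade {i})"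

lemma linear_clifford_vec: "linear clifford_vec"
  by (rule linearI)
     (simp_all add: clifford_vec_def scaleR_left_distrib sum.distrib scaleR_sum_right)

lemma blade_singleton_anticommute:
  "blade {i} * blade {j} + blade {j} * blade {i} = (if i = j then -2 else 0)"
proof (cases "i = j")
  case True
  have "blade {i} * blade {i} = - 1"
    by (simp add: blade_mult blade_sign_def blade_empty)
  with True show ?thesis by simp
next
  case False
  then have ne: "to_nat i \<noteq> to_nat j" by simp
  have "sym_diff {i} {j} = {i, j}" "sym_diff {j} {i} = {i, j}" using False by auto
  then have "blade {i} * blade {j} + blade {j} * blade {i}
      = (blade_sign {i} {j} + blade_sign {j} {i}) *\<^sub>R blade {i, j}"
    by (simp add: blade_mult scaleR_left_distrib)
  also have "blade_sign {i} {j} + blade_sign {j} {i} = 0"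
    using ne by (auto simp: blade_sign_def)
  finally show ?thesis using False by simp
qed

lemma clifford_vec_anticommute:
  "clifford_vec v * clifford_vec w + clifford_vec w * clifford_vec v = (-2 * (v \<bullet> w)) *\<^sub>R 1"
proof -
  have 1: "clifford_vec v * clifford_vec w
      = (\<Sum>i\<in>UNIV. \<Sum>j\<in>UNIV. (v $ i * w $ j) *\<^sub>R (blade {i} * blade {j}))"
    by (simp add: clifford_vec_def sum_product mult.commute)
  have 2: "clifford_vec w * clifford_vec v
      = (\<Sum>i\<in>UNIV. \<Sum>j\<in>UNIV. (v $ i * w $ j) *\<^sub>R (blade {j} * blade {i}))"
    by (simp add: clifford_vec_def sum_product) (rule sum.swap)
  have "clifford_vec v * clifford_vec w + clifford_vec w * clifford_vec v
      = (\<Sum>i\<in>UNIV. \<Sum>j\<in>UNIV. (v $ i * w $ j) *\<^sub>R (blade {i} * blade {j} + blade {j} * blade {i}))"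
    by (simp add: 1 2 sum.distrib scaleR_right_distrib)
  also have "\<dots> = (\<Sum>i\<in>UNIV. \<Sum>j\<in>UNIV. if i = j then (-2 * (v $ i * w $ i)) *\<^sub>R 1 else 0)"
    by (intro sum.cong refl) (auto simp: blade_singleton_anticommute scaleR_conv_of_real algebra_simps)
  also have "\<dots> = (-2 * (v \<bullet> w)) *\<^sub>R 1"
    by (simp add: inner_vec_def scaleR_sum_left[symmetric] sum_distrib_left sum_negf)
  finally show ?thesis .
qed

lemma clifford_vec_sq: "clifford_vec v * clifford_vec v = (- (norm v)\<^sup>2) *\<^sub>R 1"
proof -
  have "2 *\<^sub>R (clifford_vec v * clifford_vec v) = 2 *\<^sub>R ((- (norm v)\<^sup>2) *\<^sub>R 1)"
    using clifford_vec_anticommute[of v v]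
    by (simp add: scaleR_2 power2_norm_eq_inner)
  then show ?thesis
    by (simp only: scaleR_cancel_left) auto
qed



lemma clifford_vec_axis: "clifford_vec (axis a 1) = blade {a}"
proof -
  have "clifford_vec (axis a 1) = (\<Sum>i\<in>UNIV. if i = a then blade {i} else 0)"
    unfolding clifford_vec_def by (intro sum.cong refl) (simp add: axis_def)
  then show ?thesis by simp
qed

lemma to_nat_min_induct [case_names empty insert]:
  fixes A :: "'n::finite set"
  assumes "P {}"
    and step: "\<And>a A. (\<And>b. b \<in> A \<Longrightarrow> to_nat a < to_nat b) \<Longrightarrow> P A \<Longrightarrow> P (insert a A)"
  shows "P A"
proof (induction "card A" arbitrary: A)
  case 0
  then show ?case using assms(1) by simp
next
  case (Suc k)
  then have "A \<noteq> {}" by auto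
  then obtain a where a: "a \<in> A" "\<And>b. b \<in> A \<Longrightarrow> to_nat a \<le> to_nat b"
    using Min_in[of "to_nat ` A"] Min_le[of "to_nat ` A"] by fastforce
  have "P (insert a (A - {a}))"
  proof (rule step)
    show "to_nat a < to_nat b" if "b \<in> A - {a}" for b
      using a(2)[of b] that by (metis DiffE injD inj_to_nat insertCI le_neq_implies_less)
    show "P (A - {a})"
      using Suc.hyps(2) a(1) by (intro Suc.hyps(1)) simp
  qed
  then show ?case using a(1) by (simp add: insert_absorb)
qed

text \<open>The ordered product of \<open>F a\<close>, \<open>a \<in> A\<close>.\<close>

definition ordered_prod :: "('n::finite \<Rightarrow> 'b::monoid_mult) \<Rightarrow> 'n set \<Rightarrow> 'b" where
  "ordered_prod F A = prod_list (map (\<lambda>k. F (from_nat k)) (sorted_list_of_set (to_nat ` A)))"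

lemma ordered_prod_empty [simp]: "ordered_prod F {} = 1"
  by (simp add: ordered_prod_def)

lemma ordered_prod_insert:
  assumes "\<And>b. b \<in> A \<Longrightarrow> to_nat a < to_nat b"
  shows "ordered_prod F (insert a A) = F a * ordered_prod F A"
proof -
  have 1: "Min (to_nat ` insert a A) = to_nat a"
    using assms by (intro Min_eqI) (auto simp: less_imp_le)
  have "a \<notin> A" using assms by auto
  then have 2: "to_nat ` insert a A - {to_nat a} = to_nat ` A"
    by auto
  have "sorted_list_of_set (to_nat ` insert a A) = to_nat a # sorted_list_of_set (to_nat ` A)"
    using sorted_list_of_set_nonempty[of "to_nat ` insert a A"] unfolding 1 2 by simp
  then show ?thesis by (simp add: ordered_prod_def)
qed

lemma ordered_prod_singleton_mult:
  fixes F :: "'n::finite \<Rightarrow> 'b::real_algebra_1"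
  assumes F: "\<And>i j. F i * F j + F j * F i = (if i = j then -2 else 0)"
  shows "F i * ordered_prod F A = blade_sign {i} A *\<^sub>R ordered_prod F (sym_diff {i} A)"
proof (induction A rule: to_nat_min_induct)
  case empty
  then show ?case using ordered_prod_insert[of "{}" i F] by simp
next
  case (insert a A)
  have notin: "a \<notin> A" using insert.hyps by auto
  have sgn: "blade_sign {i} (insert a A) = (if to_nat a \<le> to_nat i then -1 else 1) * blade_sign {i} A"
    using notin by (simp add: blade_sign_def)
  consider "to_nat i < to_nat a" | "i = a" | "to_nat a < to_nat i"
    by (metis linorder_neqE_nat injD inj_to_nat)
  then show ?case
  proof cases
    case 1
    then have lt: "\<And>b. b \<in> insert a A \<Longrightarrow> to_nat i < to_nat b"
      using insert.hyps by (auto intro: less_trans)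
    then have "i \<notin> insert a A" by auto
    then have "sym_diff {i} (insert a A) = insert i (insert a A)" by auto
    moreover have "blade_sign {i} (insert a A) = 1"
      using lt unfolding blade_sign_def by (auto intro!: prod.neutral simp: not_le)
    ultimately show ?thesis
      using ordered_prod_insert[of "insert a A" i F, OF lt] by simp
  next
    case 2
    have "blade_sign {i} A = 1"
      using insert.hyps 2 unfolding blade_sign_def by (auto intro!: prod.neutral simp: not_le)
    then have "blade_sign {i} (insert a A) = -1" using sgn 2 by simp
    moreover have "sym_diff {i} (insert a A) = A" using 2 notin by auto
    moreover have "F i * F i = -1"
    proof -
      have "2 *\<^sub>R (F i * F i) = 2 *\<^sub>R (-1)"
        using F[of i i] by (simp add: scaleR_2)
      then show ?thesis by (simp only: scaleR_cancel_left) auto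
    qed
    ultimately show ?thesis
      using ordered_prod_insert[of A a F, OF insert.hyps] 2 by (simp add: mult.assoc[symmetric])
  next
    case 3
    then have ne: "i \<noteq> a" by auto
    have anti: "F i * F a = - (F a * F i)"
      using F[of i a] ne by (simp add: eq_neg_iff_add_eq_0)
    have eq: "sym_diff {i} (insert a A) = insert a (sym_diff {i} A)" using ne notin by auto
    have lt: "\<And>b. b \<in> sym_diff {i} A \<Longrightarrow> to_nat a < to_nat b"
      using insert.hyps 3 by auto
    have "F i * ordered_prod F (insert a A) = - (F a * (F i * ordered_prod F A))"
      using ordered_prod_insert[of A a F, OF insert.hyps] anti
      by (simp add: mult.assoc[symmetric])
    also have "\<dots> = - blade_sign {i} A *\<^sub>R (F a * ordered_prod F (sym_diff {i} A))"
      by (simp add: insert.IH)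
    also have "F a * ordered_prod F (sym_diff {i} A) = ordered_prod F (insert a (sym_diff {i} A))"
      by (rule ordered_prod_insert[symmetric]) (rule lt)
    finally show ?thesis
      unfolding eq sgn using 3 by simp
  qed
qed

lemma clifford_universal:
  fixes f :: "real^'n::finite \<Rightarrow> 'b::real_algebra_1"
  assumes lin: "linear f" and sq: "\<And>v. f v * f v = (- (norm v)\<^sup>2) *\<^sub>R 1"
  shows "\<exists>!F. linear F \<and> F 1 = 1 \<and> (\<forall>x y. F (x * y) = F x * F y) \<and> (\<forall>v. F (clifford_vec v) = f v)"
proof -
  define \<epsilon> where "\<epsilon> i = f (axis i 1)" for i
  define E where "E x = (\<Sum>A\<in>UNIV. clifford_coeff x A *\<^sub>R ordered_prod \<epsilon> A)" for x
  have rel: "\<epsilon> i * \<epsilon> j + \<epsilon> j * \<epsilon> i = (if i = j then -2 else 0)" for i j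
  proof -
    have "f (v + w) * f (v + w) = f v * f v + (f v * f w + f w * f v) + f w * f w" for v w
      by (simp add: linear_add[OF lin] algebra_simps)
    then have "f v * f w + f w * f v = f (v + w) * f (v + w) - f v * f v - f w * f w" for v w
      by (simp add: algebra_simps)
    then have "f v * f w + f w * f v = (- (norm (v + w))\<^sup>2 + (norm v)\<^sup>2 + (norm w)\<^sup>2) *\<^sub>R 1" for v w
      by (simp add: sq scaleR_left_distrib scaleR_diff_left)
    then have "f v * f w + f w * f v = (-2 * (v \<bullet> w)) *\<^sub>R 1" for v w
      by (simp add: power2_norm_eq_inner inner_add inner_commute)
    then show ?thesis
      by (simp add: \<epsilon>_def inner_axis_axis scaleR_conv_of_real)
  qed
  have linE: "linear E"
    by (rule linearI)
       (simp_all add: E_def plus_clifford.rep_eq scaleR_clifford.rep_eq scaleR_left_distrib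
          sum.distrib scaleR_sum_right)
  have Eblade: "E (blade A) = ordered_prod \<epsilon> A" for A
  proof -
    have "E (blade A) = (\<Sum>B\<in>UNIV. if B = A then ordered_prod \<epsilon> B else 0)"
      unfolding E_def by (intro sum.cong refl) (simp add: blade.rep_eq)
    then show ?thesis by simp
  qed
  have single: "ordered_prod \<epsilon> {i} = \<epsilon> i" for i
    using ordered_prod_insert[of "{}" i \<epsilon>] by simp
  have E1: "E (blade {i} * y) = \<epsilon> i * E y" for i y
  proof -
    have "E (blade {i} * y) = E (\<Sum>A\<in>UNIV. clifford_coeff y A *\<^sub>R (blade {i} * blade A))"
      by (subst clifford_expand[of y]) (simp add: sum_distrib_left)
    also have "\<dots> = (\<Sum>A\<in>UNIV. clifford_coeff y A *\<^sub>R (\<epsilon> i * ordered_prod \<epsilon> A))"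
      by (simp add: linear_sum[OF linE] linear_scale[OF linE] blade_mult Eblade
            ordered_prod_singleton_mult[of \<epsilon>, OF rel])
    also have "\<dots> = \<epsilon> i * E y"
      by (simp add: E_def sum_distrib_left)
    finally show ?thesis .
  qed
  have E2: "E (blade A * y) = E (blade A) * E y" for A y
  proof (induction A rule: to_nat_min_induct)
    case empty
    then show ?case by (simp add: Eblade blade_empty[symmetric]) (simp add: blade_empty)
  next
    case (insert a A)
    then show ?case
      by (simp add: blade_insert[OF insert.hyps] mult.assoc E1)
  qed
  have E3: "E (x * y) = E x * E y" for x y
  proof -
    have "E (x * y) = E (\<Sum>A\<in>UNIV. clifford_coeff x A *\<^sub>R (blade A * y))"
      by (subst clifford_expand[of x]) (simp add: sum_distrib_right)
    also have "\<dots> = (\<Sum>A\<in>UNIV. clifford_coeff x A *\<^sub>R E (blade A)) * E y"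
      by (simp add: linear_sum[OF linE] linear_scale[OF linE] E2 sum_distrib_right)
    also have "(\<Sum>A\<in>UNIV. clifford_coeff x A *\<^sub>R E (blade A)) = E x"
      by (simp only: E_def[of x] Eblade)
    finally show ?thesis .
  qed
  have E4: "E (clifford_vec v) = f v" for v
  proof -
    have "E (clifford_vec v) = (\<Sum>i\<in>UNIV. v $ i *\<^sub>R f (axis i 1))"
      by (simp add: clifford_vec_def linear_sum[OF linE] linear_scale[OF linE] Eblade single \<epsilon>_def)
    also have "\<dots> = f (\<Sum>i\<in>UNIV. v $ i *\<^sub>R axis i 1)"
      by (simp add: linear_sum[OF lin] linear_scale[OF lin])
    also have "(\<Sum>i\<in>UNIV. v $ i *\<^sub>R axis i 1) = v"
      using basis_expansion[of v] by (simp add: scalar_mult_eq_scaleR)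
    finally show ?thesis .
  qed
  show ?thesis
  proof (rule ex1I[of _ E])
    have "E 1 = 1" using Eblade[of "{}"] by (simp add: blade_empty)
    then show "linear E \<and> E 1 = 1 \<and> (\<forall>x y. E (x * y) = E x * E y) \<and> (\<forall>v. E (clifford_vec v) = f v)"
      using linE E3 E4 by blast
  next
    fix F
    assume F: "linear F \<and> F 1 = 1 \<and> (\<forall>x y. F (x * y) = F x * F y) \<and> (\<forall>v. F (clifford_vec v) = f v)"
    have blade: "F (blade A) = ordered_prod \<epsilon> A" for A
    proof (induction A rule: to_nat_min_induct)
      case empty
      then show ?case using F by (simp add: blade_empty)
    next
      case (insert a A)
      have "F (blade {a}) = \<epsilon> a" using F by (simp add: clifford_vec_axis[symmetric] \<epsilon>_def)
      then show ?case
        using F insert by (simp add: blade_insert[OF insert.hyps] ordered_prod_insert[OF insert.hyps])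
    qed
    show "F = E"
    proof
      fix x
      have "linear F" using F by simp
      have "F x = F (\<Sum>A\<in>UNIV. clifford_coeff x A *\<^sub>R blade A)"
        using clifford_expand[of x] by simp
      then show "F x = E x"
        by (simp add: linear_sum[OF \<open>linear F\<close>] linear_scale[OF \<open>linear F\<close>] blade E_def)
    qed
  qed
qed

text \<open>The automorphism of the Clifford algebra that extends \<open>v \<mapsto> - v\<close>.\<close>

lift_definition grade_involution :: "'n::finite clifford \<Rightarrow> 'n clifford"
  is "\<lambda>x A. (-1) ^ card A * x A" .

lemma grade_involution_one [simp]: "grade_involution 1 = 1"
  by transfer auto

lemma grade_involution_mult: "grade_involution (x * y) = grade_involution x * grade_involution y"
proof transfer
  fix x y :: "'n::finite set \<Rightarrow> real"
  have card: "(-1 :: real) ^ card C = (-1) ^ card A * (-1) ^ card (sym_diff A C)" for A C :: "'n set"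
  proof -
    have "(\<Prod>_\<in>sym_diff A (sym_diff A C). -1 :: real) = (\<Prod>_\<in>A. -1) * (\<Prod>_\<in>sym_diff A C. -1)"
      by (rule prod_sym_diff) simp
    then show ?thesis by (simp only: prod_constant sym_diff_cancel)
  qed
  show "(\<lambda>C. (-1) ^ card C * (\<Sum>A\<in>UNIV. blade_sign A (sym_diff A C) * x A * y (sym_diff A C)))
      = (\<lambda>C. \<Sum>A\<in>UNIV. blade_sign A (sym_diff A C) * ((-1) ^ card A * x A)
            * ((-1) ^ card (sym_diff A C) * y (sym_diff A C)))"
  proof
    fix C
    show "(-1) ^ card C * (\<Sum>A\<in>UNIV. blade_sign A (sym_diff A C) * x A * y (sym_diff A C))
      = (\<Sum>A\<in>UNIV. blade_sign A (sym_diff A C) * ((-1) ^ card A * x A)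
            * ((-1) ^ card (sym_diff A C) * y (sym_diff A C)))"
      unfolding sum_distrib_left by (intro sum.cong refl, subst card[of C]) (simp only: mult_ac)
  qed
qed

lemma clifford_coeff_vec: "clifford_coeff (clifford_vec v) A = (\<Sum>i\<in>UNIV. if A = {i} then v $ i else 0)"
  unfolding clifford_vec_def clifford_coeff_sum
  by (intro sum.cong refl) (simp add: scaleR_clifford.rep_eq blade.rep_eq)

lemma grade_involution_vec: "grade_involution (clifford_vec v) = - clifford_vec v"
  by (rule clifford_eqI)
     (auto simp: grade_involution.rep_eq uminus_clifford.rep_eq clifford_coeff_vec
        sum_distrib_left sum_negf[symmetric] intro!: sum.cong)

lemma inj_clifford_vec: "inj clifford_vec"
proof (rule injI)
  fix v w :: "real^'n::finite"
  assume eq: "clifford_vec v = clifford_vec w"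
  have "clifford_coeff (clifford_vec u) {i} = u $ i" for u :: "real^'n" and i
    by (simp add: clifford_coeff_vec)
  then show "v = w" by (metis eq vec_eq_iff)
qed


section \<open>The groups \<open>Pin(n)\<close> and \<open>Spin(n)\<close>\<close>

definition clifford_monoid :: "'n::finite clifford monoid" where
  "clifford_monoid = \<lparr>carrier = UNIV, mult = (*), one = 1\<rparr>"

definition pin_group :: "'n::finite clifford monoid" where
  "pin_group = (units_of clifford_monoid)
     \<lparr>carrier := generate (units_of clifford_monoid) (clifford_vec ` {v. norm v = 1})\<rparr>"

text \<open>
  The twisted adjoint representation, the standard two-fold covering of \<open>O(n)\<close> for every \<open>n\<close>:
  a unit vector is sent to the reflection in its orthogonal hyperplane.  The lemma
  \<open>pin_cover\<close> shows that the matrix described is unique and orthogonal.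
\<close>

definition pin_cover :: "'n::finite clifford \<Rightarrow> real^'n^'n" where
  "pin_cover g = (THE M. \<forall>v. clifford_vec (M *v v)
      = grade_involution g * clifford_vec v * inv\<^bsub>pin_group\<^esub> g)"

definition orthogonal_group :: "(real^'n::finite^'n) monoid" where
  "orthogonal_group = \<lparr>carrier = {M. orthogonal_matrix M}, mult = (**), one = mat 1\<rparr>"

definition special_orthogonal :: "(real^'n::finite^'n) set" where
  "special_orthogonal = {M. orthogonal_matrix M \<and> det M = 1}"

definition spin_group :: "'n::finite clifford monoid" where
  "spin_group = pin_group\<lparr>carrier := {g \<in> carrier pin_group. pin_cover g \<in> special_orthogonal}\<rparr>"

lemma monoid_clifford: "monoid clifford_monoid"
  by (rule monoidI) (auto simp: clifford_monoid_def mult.assoc)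

lemma group_units_clifford: "group (units_of clifford_monoid)"
  by (rule monoid.units_group[OF monoid_clifford])

lemma unit_vec_inverse:
  assumes "norm v = 1"
  shows "clifford_vec v * (- clifford_vec v) = 1" "(- clifford_vec v) * clifford_vec v = 1"
  using clifford_vec_sq[of v] assms by simp_all

lemma unit_vec_Units: "clifford_vec ` {v. norm v = 1} \<subseteq> carrier (units_of clifford_monoid)"
proof
  fix x :: "'n::finite clifford"
  assume "x \<in> clifford_vec ` {v. norm v = 1}"
  then obtain v where "x = clifford_vec v" "norm v = 1" by auto
  then have "x * (- x) = 1" "(- x) * x = 1" using unit_vec_inverse by blast+
  then show "x \<in> carrier (units_of clifford_monoid)"
    unfolding units_of_carrier Units_def clifford_monoid_def by (simp only: partial_object.simps monoid.simps) blast
qed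

lemma pin_subgroup:
  "subgroup (carrier pin_group :: 'n::finite clifford set) (units_of clifford_monoid)"
  unfolding pin_group_def
  using group.generate_is_subgroup[OF group_units_clifford unit_vec_Units] by simp

lemma group_pin: "group (pin_group :: 'n::finite clifford monoid)"
proof -
  have "pin_group = (units_of clifford_monoid)\<lparr>carrier := carrier (pin_group :: 'n clifford monoid)\<rparr>"
    by (simp add: pin_group_def)
  then show ?thesis
    using subgroup.subgroup_is_group[OF pin_subgroup group_units_clifford] by metis
qed

lemma pin_simps [simp]: "x \<otimes>\<^bsub>pin_group\<^esub> y = x * y" "\<one>\<^bsub>pin_group\<^esub> = 1"
  by (simp_all add: pin_group_def units_of_def clifford_monoid_def)

lemma pin_inv:
  assumes "g \<in> carrier pin_group"
  shows "g * inv\<^bsub>pin_group\<^esub> g = 1" "inv\<^bsub>pin_group\<^esub> g * g = 1"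
  using group.r_inv[OF group_pin assms] group.l_inv[OF group_pin assms] by simp_all

lemma pin_cover_aux:
  assumes "g \<in> carrier pin_group"
  shows "\<exists>M. orthogonal_matrix M \<and>
    (\<forall>v. clifford_vec (M *v v) * g = grade_involution g * clifford_vec v)"
proof -
  have vec: "\<exists>M. orthogonal_matrix M \<and>
    (\<forall>v. clifford_vec (M *v v) * clifford_vec u = grade_involution (clifford_vec u) * clifford_vec v)"
    if u: "norm u = 1" for u :: "real^'n"
  proof -
    define r where "r v = v - (2 * (u \<bullet> v)) *\<^sub>R u" for v
    have lin: "linear r"
      by (rule linearI) (simp_all add: r_def inner_add_right algebra_simps)
    have uu: "u \<bullet> u = 1" using u by (simp add: norm_eq_1)
    have "r v \<bullet> r v = v \<bullet> v" for v
      by (simp add: r_def inner_diff_left inner_diff_right uu inner_commute algebra_simps)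
    then have "orthogonal_transformation r"
      using lin by (simp add: orthogonal_transformation norm_eq_sqrt_inner)
    then have "orthogonal_matrix (matrix r)"
      by (simp add: orthogonal_transformation_matrix)
    moreover have "clifford_vec (matrix r *v v) * clifford_vec u
        = grade_involution (clifford_vec u) * clifford_vec v" for v
    proof -
      have "clifford_vec (matrix r *v v) * clifford_vec u
          = clifford_vec v * clifford_vec u - (2 * (u \<bullet> v)) *\<^sub>R (clifford_vec u * clifford_vec u)"
        by (simp add: fun_cong[OF matrix_vector_mul(2)[OF lin]] r_def linear_diff[OF linear_clifford_vec]
              linear_scale[OF linear_clifford_vec] algebra_simps)
      also have "\<dots> = clifford_vec v * clifford_vec u + (2 * (u \<bullet> v)) *\<^sub>R 1"
        by (simp add: clifford_vec_sq u)
      also have "\<dots> = - (clifford_vec u * clifford_vec v)"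
        using clifford_vec_anticommute[of u v] by (simp add: algebra_simps eq_neg_iff_add_eq_0)
      finally show ?thesis by (simp add: grade_involution_vec)
    qed
    ultimately show ?thesis by blast
  qed
  from assms have "g \<in> generate (units_of clifford_monoid) (clifford_vec ` {v. norm v = 1})"
    by (simp add: pin_group_def)
  then show ?thesis
  proof induction
    case one
    have "orthogonal_matrix (mat 1 :: real^'n^'n)" by (simp add: orthogonal_matrix_id)
    then show ?case
      by (intro exI[of _ "mat 1"]) (simp add: units_of_def clifford_monoid_def)
  next
    case (incl h)
    then show ?case using vec by auto
  next
    case (inv h)
    then obtain u where h: "h = clifford_vec u" "norm u = 1" by auto
    have "inv\<^bsub>units_of clifford_monoid\<^esub> h = - h"
    proof (rule group.inv_equality[OF group_units_clifford])
      show "- h \<otimes>\<^bsub>units_of clifford_monoid\<^esub> h = \<one>\<^bsub>units_of clifford_monoid\<^esub>"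
        using unit_vec_inverse[OF h(2)] by (simp add: h units_of_def clifford_monoid_def)
      show "h \<in> carrier (units_of clifford_monoid)" using inv unit_vec_Units by blast
      have "- h = clifford_vec (- u)" using linear_neg[OF linear_clifford_vec, of u] h by simp
      then have "- h \<in> clifford_vec ` {v. norm v = 1}" using h by auto
      then show "- h \<in> carrier (units_of clifford_monoid)" using unit_vec_Units by blast
    qed
    also have "- h = clifford_vec (- u)" using linear_neg[OF linear_clifford_vec, of u] h by simp
    finally show ?case using vec[of "- u"] h by simp
  next
    case (eng g h)
    then obtain M N where
      M: "orthogonal_matrix M" "\<And>v. clifford_vec (M *v v) * g = grade_involution g * clifford_vec v" and
      N: "orthogonal_matrix N" "\<And>v. clifford_vec (N *v v) * h = grade_involution h * clifford_vec v"
      by blast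
    have "clifford_vec ((M ** N) *v v) * (g * h) = grade_involution (g * h) * clifford_vec v" for v
    proof -
      have "clifford_vec ((M ** N) *v v) * (g * h) = (clifford_vec (M *v (N *v v)) * g) * h"
        by (simp add: matrix_vector_mul_assoc mult.assoc)
      also have "\<dots> = grade_involution g * (clifford_vec (N *v v) * h)"
        by (simp add: M mult.assoc)
      also have "\<dots> = grade_involution (g * h) * clifford_vec v"
        by (simp add: N grade_involution_mult mult.assoc)
      finally show ?thesis .
    qed
    then show ?case
      using orthogonal_matrix_mul[OF M(1) N(1)]
      by (intro exI[of _ "M ** N"]) (simp add: units_of_def clifford_monoid_def)
  qed
qed

lemma pin_cover_iff:
  assumes "g \<in> carrier pin_group"
  shows "clifford_vec w = grade_involution g * clifford_vec v * inv\<^bsub>pin_group\<^esub> g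
    \<longleftrightarrow> clifford_vec w * g = grade_involution g * clifford_vec v"
  using pin_inv[OF assms] by (metis mult.assoc mult.right_neutral)

lemma pin_cover:
  assumes g: "g \<in> carrier pin_group"
  shows "\<exists>!M. \<forall>v. clifford_vec (M *v v) = grade_involution g * clifford_vec v * inv\<^bsub>pin_group\<^esub> g"
    and "clifford_vec (pin_cover g *v v) = grade_involution g * clifford_vec v * inv\<^bsub>pin_group\<^esub> g"
    and "orthogonal_matrix (pin_cover g)"
proof -
  let ?P = "\<lambda>M. \<forall>v. clifford_vec (M *v v) = grade_involution g * clifford_vec v * inv\<^bsub>pin_group\<^esub> g"
  obtain M where M: "orthogonal_matrix M" "?P M"
    using pin_cover_aux[OF g] pin_cover_iff[OF g] by blast
  have uniq: "N = M" if "?P N" for N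
  proof -
    have "clifford_vec (N *v v) = clifford_vec (M *v v)" for v
      using M(2) that by simp
    then have "N *v v = M *v v" for v by (rule injD[OF inj_clifford_vec])
    then show ?thesis by (simp add: matrix_eq)
  qed
  show ex1: "\<exists>!M. ?P M" using M(2) uniq by blast
  have "pin_cover g = M"
    unfolding pin_cover_def using M(2) uniq by (rule the_equality)
  then show "orthogonal_matrix (pin_cover g)"
    "clifford_vec (pin_cover g *v v) = grade_involution g * clifford_vec v * inv\<^bsub>pin_group\<^esub> g"
    using M by auto
qed


lemma pin_cover_mult:
  assumes g: "g \<in> carrier pin_group" and h: "h \<in> carrier pin_group"
  shows "pin_cover (g * h) = pin_cover g ** pin_cover h"
proof -
  have gh: "g * h \<in> carrier pin_group"
    using group.subgroup_self[OF group_pin] subgroup.m_closed g h by fastforce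
  have "clifford_vec ((pin_cover g ** pin_cover h) *v v) * (g * h)
      = grade_involution (g * h) * clifford_vec v" for v
  proof -
    have 1: "clifford_vec (pin_cover g *v w) * g = grade_involution g * clifford_vec w" for w
      using pin_cover(2)[OF g] pin_cover_iff[OF g] by blast
    have 2: "clifford_vec (pin_cover h *v v) * h = grade_involution h * clifford_vec v"
      using pin_cover(2)[OF h] pin_cover_iff[OF h] by blast
    have "clifford_vec ((pin_cover g ** pin_cover h) *v v) * (g * h)
        = (clifford_vec (pin_cover g *v (pin_cover h *v v)) * g) * h"
      by (simp add: matrix_vector_mul_assoc mult.assoc)
    also have "\<dots> = grade_involution (g * h) * clifford_vec v"
      by (simp only: 1 mult.assoc 2 grade_involution_mult)
    finally show ?thesis .
  qed
  then show ?thesis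
    using pin_cover(1)[OF gh] pin_cover(2)[OF gh] pin_cover_iff[OF gh] by blast
qed

lemma group_orthogonal: "group (orthogonal_group :: (real^'n::finite^'n) monoid)"
proof (rule groupI)
  fix A :: "real^'n^'n"
  assume "A \<in> carrier orthogonal_group"
  then show "\<exists>B\<in>carrier orthogonal_group. B \<otimes>\<^bsub>orthogonal_group\<^esub> A = \<one>\<^bsub>orthogonal_group\<^esub>"
    by (intro bexI[of _ "Finite_Cartesian_Product.transpose A"])
       (simp_all add: orthogonal_group_def orthogonal_matrix_def)
qed (auto simp: orthogonal_group_def orthogonal_matrix_mul orthogonal_matrix_id matrix_mul_assoc)

lemma pin_cover_hom: "pin_cover \<in> hom pin_group orthogonal_group"
  by (auto simp: hom_def orthogonal_group_def pin_cover(3) pin_cover_mult)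

lemma group_spin: "group (spin_group :: 'n::finite clifford monoid)"
proof -
  interpret P: group "pin_group :: 'n clifford monoid" by (rule group_pin)
  have one: "pin_cover (1 :: 'n clifford) = mat 1"
  proof -
    have "pin_cover (\<one>\<^bsub>pin_group\<^esub> :: 'n clifford) = \<one>\<^bsub>orthogonal_group\<^esub>"
      by (rule hom_one[OF pin_cover_hom group_pin group_orthogonal])
    then show ?thesis by (simp add: orthogonal_group_def)
  qed
  let ?S = "{g \<in> carrier pin_group. pin_cover g \<in> special_orthogonal} :: 'n clifford set"
  have "subgroup ?S pin_group"
  proof (rule P.subgroupI)
    show "?S \<subseteq> carrier pin_group" by auto
    have "1 \<in> ?S"
      using P.one_closed by (simp add: one special_orthogonal_def orthogonal_matrix_id)
    then show "?S \<noteq> {}" by blast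
  next
    fix g assume g: "g \<in> ?S"
    then have gc: "g \<in> carrier pin_group" by simp
    then have ic: "inv\<^bsub>pin_group\<^esub> g \<in> carrier pin_group" by simp
    have "pin_cover (inv\<^bsub>pin_group\<^esub> g) ** pin_cover g = mat 1"
      using pin_cover_mult[OF ic gc] one pin_inv(2)[OF gc] by simp
    then have "det (pin_cover (inv\<^bsub>pin_group\<^esub> g)) * det (pin_cover g) = 1"
      by (metis det_I det_mul)
    then show "inv\<^bsub>pin_group\<^esub> g \<in> ?S"
      using g ic pin_cover(3)[OF ic] by (simp add: special_orthogonal_def)
  next
    fix g h assume gh: "g \<in> ?S" "h \<in> ?S"
    then have "g * h \<in> carrier pin_group"
      using P.m_closed[of g h] by simp
    then show "g \<otimes>\<^bsub>pin_group\<^esub> h \<in> ?S"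
      using gh by (simp add: special_orthogonal_def pin_cover_mult det_mul orthogonal_matrix_mul)
  qed
  then show ?thesis
    unfolding spin_group_def by (rule P.subgroup_imp_group)
qed


section \<open>Representations and almost conjugate homomorphisms\<close>

definition orthogonal_rep :: "('g, 'x) monoid_scheme \<Rightarrow> ('g \<Rightarrow> real^'n::finite^'n) \<Rightarrow> bool" where
  "orthogonal_rep G \<rho> \<longleftrightarrow> \<rho> \<in> hom G orthogonal_group"

text \<open>Irreducibility over the reals; the space \<^typ>\<open>real^'n\<close> is never zero.\<close>

definition irreducible_rep :: "('g, 'x) monoid_scheme \<Rightarrow> ('g \<Rightarrow> real^'n::finite^'n) \<Rightarrow> bool" where
  "irreducible_rep G \<rho> \<longleftrightarrow>
     (\<forall>V. subspace V \<and> (\<forall>g\<in>carrier G. \<forall>v\<in>V. \<rho> g *v v \<in> V) \<longrightarrow> V = {0} \<or> V = UNIV)"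

definition faithful_rep :: "('g, 'x) monoid_scheme \<Rightarrow> ('g \<Rightarrow> real^'n::finite^'n) \<Rightarrow> bool" where
  "faithful_rep G \<rho> \<longleftrightarrow> inj_on \<rho> (carrier G)"

definition character :: "('g \<Rightarrow> real^'n::finite^'n) \<Rightarrow> 'g \<Rightarrow> real" where
  "character \<rho> g = trace (\<rho> g)"

definition elementwise_conjugate ::
  "('a, 'x) monoid_scheme \<Rightarrow> ('g, 'y) monoid_scheme \<Rightarrow> ('g \<Rightarrow> 'a) \<Rightarrow> ('g \<Rightarrow> 'a) \<Rightarrow> bool" where
  "elementwise_conjugate G \<Gamma> \<phi>\<^sub>1 \<phi>\<^sub>2 \<longleftrightarrow>
     (\<forall>\<gamma>\<in>carrier \<Gamma>. \<exists>x\<in>carrier G. \<phi>\<^sub>1 \<gamma> = x \<otimes>\<^bsub>G\<^esub> \<phi>\<^sub>2 \<gamma> \<otimes>\<^bsub>G\<^esub> inv\<^bsub>G\<^esub> x)"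

text \<open>
  Only the group structure of the Lie group \<open>G\<close> enters: \<open>\<Gamma>\<close> is finite and the inner automorphisms
  are those of the abstract group.
\<close>

definition admissible ::
  "('a, 'x) monoid_scheme \<Rightarrow> ('g \<Rightarrow> 'a) \<Rightarrow> ('g \<Rightarrow> 'a) \<Rightarrow> ('g, 'y) monoid_scheme \<Rightarrow> bool" where
  "admissible G \<phi>\<^sub>1 \<phi>\<^sub>2 \<Gamma> \<longleftrightarrow>
     group G \<and> group \<Gamma> \<and> finite (carrier \<Gamma>) \<and>
     \<phi>\<^sub>1 \<in> hom \<Gamma> G \<and> \<phi>\<^sub>2 \<in> hom \<Gamma> G \<and> elementwise_conjugate G \<Gamma> \<phi>\<^sub>1 \<phi>\<^sub>2 \<and>
     \<not> (\<exists>x\<in>carrier G. \<phi>\<^sub>1 ` carrier \<Gamma> = (\<lambda>y. x \<otimes>\<^bsub>G\<^esub> y \<otimes>\<^bsub>G\<^esub> inv\<^bsub>G\<^esub> x) ` \<phi>\<^sub>2 ` carrier \<Gamma>)"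

end

theory Submission
  imports Defs
begin

text \<open>
  Lifts to \<open>Pin(n)\<close> are unique up to real scalars.  The congruences make the \<open>-1\<close>-eigenspaces of
  transpositions and of products of two disjoint transpositions have dimension divisible by four,
  so their lifts can be normalised to square to \<open>1\<close>; hence lifts of disjoint transpositions
  commute, and the conjugates of one lift of a transposition contain exactly one lift of every
  transposition and generate a copy of \<open>Sym(m)\<close>.  This gives \<open>\<phi>\<close>, and \<open>\<psi> = sign \<cdot> \<phi>\<close> is a second
  lift.  If \<open>\<rho>(z)\<close> has a unit eigenvector \<open>v\<close> for the eigenvalue \<open>-1\<close>, then \<open>v\<close> conjugates \<open>\<phi>(z)\<close> to
  \<open>-\<phi>(z)\<close>.  If some \<open>x\<close> conjugated one image onto the other, then, automorphisms of \<open>Sym(m)\<close> being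
  inner for \<open>m \<noteq> 6\<close>, some \<open>b\<close> would intertwine \<open>\<psi>\<close> and \<open>\<phi>\<close>, and its image \<open>B\<close> would commute with
  \<open>\<rho>\<close>.  If \<open>B = -1\<close>, then \<open>b\<close> commutes with the even elements \<open>\<phi>(z)\<close>; otherwise
  \<open>B\<close> has an orthogonal square root in the commutant, so conjugation by \<open>b\<close> multiplies \<open>\<phi>(z)\<close> by
  the square of a real number, which cannot be \<open>-1\<close>.
\<close>

section \<open>Homomorphisms out of the symmetric group\<close>

abbreviation tp :: "'a \<Rightarrow> 'a \<Rightarrow> 'a \<Rightarrow> 'a" where "tp \<equiv> Transposition.transpose"

lemma comp_tp_inj: "inj s \<Longrightarrow> s \<circ> tp a b = tp (s a) (s b) \<circ> s"
  by (auto simp: fun_eq_iff Transposition.transpose_def inj_eq)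

text \<open>\<open>T a b\<close> is the value intended for \<open>tp a b\<close>. The recursion
  peels off the largest point: \<open>p\<close> is \<open>tp (Suc k) (p (Suc k))\<close> times a
  permutation of \<open>{1..k}\<close>, which gives every permutation one fixed normal form in
  transpositions. A fixed top point contributes \<open>T (Suc k) (Suc k)\<close>, assumed to be
  \<open>1\<close> below.\<close>

primrec lift_perm :: "(nat \<Rightarrow> nat \<Rightarrow> 'b::monoid_mult) \<Rightarrow> nat \<Rightarrow> (nat \<Rightarrow> nat) \<Rightarrow> 'b" where
  "lift_perm T 0 p = 1"
| "lift_perm T (Suc k) p = T (Suc k) (p (Suc k)) * lift_perm T k (tp (Suc k) (p (Suc k)) \<circ> p)"

lemma permutes_reduce:
  assumes "p permutes {1..Suc k}"
  shows "tp (Suc k) (p (Suc k)) \<circ> p permutes {1..k}"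
proof -
  have "p permutes insert (Suc k) {1..k}" using assms by (simp add: atLeastAtMostSuc_conv)
  then show ?thesis by (rule permutes_insert_lemma)
qed

text \<open>Left multiplication by a transposition changes the normal form, and the relations on
  \<open>T\<close> absorb the change. The induction removes the top point \<open>N\<close>; the
  cases record whether \<open>tp a b\<close> moves \<open>N\<close> and how it acts on
  \<open>c = p N\<close>.\<close>

lemma lift_perm_tp_comp:
  fixes T :: "nat \<Rightarrow> nat \<Rightarrow> 'b::monoid_mult"
  assumes id: "\<And>a. T a a = 1" and sq: "\<And>a b. {a, b} \<subseteq> {1..m} \<Longrightarrow> T a b * T a b = 1"
    and sym: "\<And>a b. T a b = T b a"
    and conj: "\<And>a b c d. {a, b, c, d} \<subseteq> {1..m} \<Longrightarrow>
       T a b * T c d = T (tp a b c) (tp a b d) * T a b"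
    and "k \<le> m" "p permutes {1..k}" "{a, b} \<subseteq> {1..k}"
  shows "lift_perm T k (tp a b \<circ> p) = T a b * lift_perm T k p"
  using assms(5-7)
proof (induction k arbitrary: p a b)
  case 0
  then show ?case by simp
next
  case (Suc k)
  define N where "N = Suc k"
  define c where "c = p N"
  define q where "q = tp N c \<circ> p"
  have IH: "lift_perm T k (tp a b \<circ> q) = T a b * lift_perm T k q" if "{a, b} \<subseteq> {1..k}" for a b
  proof (rule Suc.IH)
    show "q permutes {1..k}" unfolding q_def c_def N_def by (rule permutes_reduce[OF Suc.prems(2)])
  qed (use Suc.prems that in auto)
  have c: "c \<in> {1..N}" using permutes_in_image[OF Suc.prems(2), of N] by (simp add: c_def N_def)
  have p: "p = tp N c \<circ> q" by (simp add: q_def flip: comp_assoc)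
  have Nm: "N \<le> m" using Suc.prems(1) N_def by simp
  have S: "lift_perm T (Suc k) p = T N c * lift_perm T k q"
    by (simp add: q_def c_def N_def)
  \<comment> \<open>By symmetry of \<open>T\<close>, the point \<open>N\<close> may be taken to be
    \<open>a\<close> if it occurs at all, so \<open>b\<close> is assumed different from it.\<close>
  have main: "lift_perm T (Suc k) (tp a b \<circ> p) = T a b * lift_perm T (Suc k) p"
    if ab: "{a, b} \<subseteq> {1..N}" "a \<noteq> b" "b \<noteq> N" for a b
  proof -
    define c' where "c' = tp a b c"
    have val: "(tp a b \<circ> p) N = c'" by (simp add: c'_def c_def)
    have L: "lift_perm T (Suc k) (tp a b \<circ> p) = T N c' * lift_perm T k (tp N c' \<circ> (tp a b \<circ> p))"
      using val by (simp add: N_def)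
    \<comment> \<open>The bracketed product sends \<open>N\<close> to \<open>c\<close>, then to
      \<open>c'\<close>, then back to \<open>N\<close>. In each case below it is the identity or a
      transposition of \<open>{1..k}\<close>, to which \<open>IH\<close> applies.\<close>
    have rew: "tp N c' \<circ> (tp a b \<circ> p) = (tp N c' \<circ> tp a b \<circ> tp N c) \<circ> q"
      by (simp add: p comp_assoc)
    have bnd: "a \<le> m" "b \<le> m" "c \<le> m" "1 \<le> a" "1 \<le> b" "1 \<le> c" "1 \<le> N"
      using ab c Nm by (auto simp: N_def)
    consider "a = N" "c = N" | "a = N" "c = b" | "a = N" "c \<noteq> N" "c \<noteq> b"
      | "a \<noteq> N" "c \<noteq> a" "c \<noteq> b" | "a \<noteq> N" "c = a" | "a \<noteq> N" "c = b" by blast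
    then show ?thesis
    proof cases
      case 1
      then have "tp N c' \<circ> tp a b \<circ> tp N c = id" "c' = b"
        by (simp_all add: c'_def)
      then show ?thesis unfolding L S rew using 1 id by (simp del: lift_perm.simps)
    next
      case 2
      then have "tp N c' \<circ> tp a b \<circ> tp N c = id" "c' = N"
        by (simp_all add: c'_def)
      then show ?thesis unfolding L S rew using 2 id sq[of N b] bnd Nm
        by (simp add: mult.assoc[symmetric] del: lift_perm.simps)
    next
      case 3
      then have e: "tp N c' \<circ> tp a b \<circ> tp N c = tp b c" "c' = c"
        using ab transpose_comp_triple[of c b N]
        by (simp_all add: c'_def transpose_commute[of N c] transpose_commute[of b c])
      moreover have "T N c * T b c = T b N * T N c"
        using conj[of N c b c] 3 ab bnd Nm by simp
      moreover have "lift_perm T k (tp b c \<circ> q) = T b c * lift_perm T k q"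
        using 3 ab c by (intro IH) (auto simp: N_def)
      ultimately show ?thesis unfolding L S rew unfolding e using 3 sym[of b N]
        by (simp add: mult.assoc[symmetric] del: lift_perm.simps)
    next
      case 4
      then have cc: "c' = c" by (simp add: c'_def)
      have e: "tp N c \<circ> tp a b \<circ> tp N c = tp a b"
        using comp_tp_inj[of "tp N c" a b] 4 ab by (simp add: comp_assoc)
      have "T N c * T a b = T a b * T N c"
        using conj[of N c a b] 4 ab bnd Nm by simp
      moreover have "lift_perm T k (tp a b \<circ> q) = T a b * lift_perm T k q"
        using 4 ab c by (intro IH) (auto simp: N_def)
      ultimately show ?thesis unfolding L S rew unfolding cc e
        by (simp add: mult.assoc[symmetric] del: lift_perm.simps)
    next
      case 5
      then have cc: "c' = b" by (simp add: c'_def)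
      have e: "tp N b \<circ> tp a b \<circ> tp N a = tp a b"
        using comp_tp_inj[of "tp a b" N a] 5 ab by (simp add: comp_assoc)
          (simp add: comp_assoc[symmetric])
      have "T a b * T N a = T N b * T a b"
        using conj[of a b N a] 5 ab bnd Nm by simp
      moreover have "lift_perm T k (tp a b \<circ> q) = T a b * lift_perm T k q"
        using 5 ab c by (intro IH) (auto simp: N_def)
      ultimately show ?thesis unfolding L S rew unfolding cc using 5 e
        by (simp add: mult.assoc[symmetric] del: lift_perm.simps)
    next
      case 6
      then have cc: "c' = a" by (simp add: c'_def)
      have e: "tp N a \<circ> tp a b \<circ> tp N b = tp a b"
        using comp_tp_inj[of "tp a b" N b] 6 ab by (simp add: comp_assoc)
          (simp add: comp_assoc[symmetric])
      moreover have "T a b * T N b = T N a * T a b"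
        using conj[of a b N b] 6 ab bnd Nm by simp
      moreover have "lift_perm T k (tp a b \<circ> q) = T a b * lift_perm T k q"
        using 6 ab c by (intro IH) (auto simp: N_def)
      ultimately show ?thesis unfolding L S rew unfolding cc using 6 e
        by (simp add: mult.assoc[symmetric] del: lift_perm.simps)
    qed
  qed
  show ?case
  proof (cases "a = b")
    case True
    then show ?thesis using id by simp
  next
    case False
    show ?thesis
    proof (cases "b = N")
      case True
      have "lift_perm T (Suc k) (tp b a \<circ> p) = T b a * lift_perm T (Suc k) p"
        by (rule main) (use True False Suc.prems in \<open>auto simp: N_def\<close>)
      then show ?thesis unfolding transpose_commute[of a b] sym[of a b] .
    next
      case F: False
      show ?thesis by (rule main) (use F False Suc.prems in \<open>auto simp: N_def\<close>)
    qed
  qed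
qed

text \<open>The relations present the symmetric group on its transpositions:
  \<open>lift_perm\<close> respects left multiplication by transpositions, and these generate the
  group.\<close>

lemma sym_group_hom_of_transpositions:
  fixes T :: "nat \<Rightarrow> nat \<Rightarrow> 'b::monoid_mult"
  assumes "\<And>a. T a a = 1" and "\<And>a b. {a, b} \<subseteq> {1..m} \<Longrightarrow> T a b * T a b = 1"
    and "\<And>a b. T a b = T b a"
    and "\<And>a b c d. {a, b, c, d} \<subseteq> {1..m} \<Longrightarrow>
       T a b * T c d = T (tp a b c) (tp a b d) * T a b"
  obtains \<phi> where "\<phi> id = 1"
    and "\<And>p q. p permutes {1..m} \<Longrightarrow> q permutes {1..m} \<Longrightarrow> \<phi> (p \<circ> q) = \<phi> p * \<phi> q"
    and "\<And>a b. {a, b} \<subseteq> {1..m} \<Longrightarrow> \<phi> (tp a b) = T a b"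
proof
  let ?\<phi> = "lift_perm T m"
  have tp: "?\<phi> (tp a b \<circ> p) = T a b * ?\<phi> p" if "p permutes {1..m}" "{a, b} \<subseteq> {1..m}" for p a b
    by (rule lift_perm_tp_comp[OF assms(1-4) order_refl that]; assumption)
  show one: "?\<phi> id = 1"
    by (induction m) (simp_all add: assms(1))
  show tp1: "?\<phi> (tp a b) = T a b" if "{a, b} \<subseteq> {1..m}" for a b
    using tp[of id a b] that one by (simp add: permutes_id)
  show "?\<phi> (p \<circ> q) = ?\<phi> p * ?\<phi> q" if p: "p permutes {1..m}" and q: "q permutes {1..m}" for p q
    using p finite_atLeastAtMost
  proof (induction p rule: permutes_induct)
    case id
    show ?case by (simp only: one id_o mult_1_left)
  next
    case (swap a b p)
    have "p \<circ> q permutes {1..m}" using permutes_compose[OF q swap(4)] .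
    from tp[OF this, of a b] tp[OF swap(4), of a b] swap(1,2,5) show ?case
      by (simp add: comp_assoc mult.assoc del: o_apply)
  qed
qed

section \<open>Automorphisms of the symmetric group\<close>

text \<open>Transpositions with a common point multiply to a 3-cycle, unless one of them is trivial
  or they coincide; disjoint ones commute, so that their product squares to
  \<open>id\<close>.\<close>

lemma tp_comp_tp_order:
  "w \<circ> w = id \<or> w \<circ> w \<circ> w = id" if "w = tp a b \<circ> tp c d" for a b c d :: 'a
proof -
  have 3: "tp a b \<circ> tp a d \<circ> (tp a b \<circ> tp a d) \<circ> (tp a b \<circ> tp a d) = id" if "b \<noteq> a" "d \<noteq> a" "b \<noteq> d"
    for a b d :: 'a
  proof
    fix x
    consider "x = a" | "x = b" | "x = d" | "x \<notin> {a, b, d}" by blast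
    then show "(tp a b \<circ> tp a d \<circ> (tp a b \<circ> tp a d) \<circ> (tp a b \<circ> tp a d)) x = id x"
      by cases (use that in auto)
  qed
  have share: "w \<circ> w = id \<or> w \<circ> w \<circ> w = id" if "w = tp a b \<circ> tp a d" for a b d :: 'a and w
    using that 3[of b a d] by (cases "b = a"; cases "d = a"; cases "b = d") auto
  have "tp a b \<circ> tp c d \<circ> (tp a b \<circ> tp c d) = id" if "a \<noteq> c" "a \<noteq> d" "b \<noteq> c" "b \<noteq> d"
  proof -
    have "tp c d \<circ> tp a b = tp a b \<circ> tp c d"
      using comp_tp_inj[of "tp c d" a b] that by simp
    then have "tp a b \<circ> tp c d \<circ> (tp a b \<circ> tp c d) = tp a b \<circ> (tp a b \<circ> tp c d) \<circ> tp c d"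
      by (simp only: comp_assoc) (simp only: comp_assoc[symmetric])
    then show ?thesis by (simp add: comp_assoc)
  qed
  then show ?thesis
    using that share[of w a b d] share[of w a b c] share[of w b a d] share[of w b a c]
    by (metis transpose_commute)
qed

text \<open>Double transitivity. \<open>tp x a\<close> moves \<open>x\<close> to \<open>a\<close>
  and \<open>y\<close> to \<open>z\<close>; the second swap then sends \<open>z\<close> to
  \<open>b\<close> and leaves \<open>a\<close> alone, as \<open>z\<close> and \<open>b\<close> both
  differ from it.\<close>

lemma permutes_ex_two_points:
  assumes "{a, b, x, y} \<subseteq> S" "a \<noteq> b" "x \<noteq> y"
  obtains s where "s permutes S" "s x = a" "s y = b"
proof
  define z where "z = tp x a y"
  have z: "z \<in> S" "z \<noteq> a" using assms by (auto simp: z_def Transposition.transpose_def)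
  show "tp z b \<circ> tp x a permutes S"
    using assms z by (intro permutes_compose permutes_swap_id) auto
  show "(tp z b \<circ> tp x a) x = a" using z assms by simp
  show "(tp z b \<circ> tp x a) y = b" by (simp add: z_def)
qed

text \<open>
  A product of two transpositions has order at most 3.  An involution \<open>t\<close> that moves at least four
  points violates this with its conjugate by a 5-cycle if it has a fixed point, by an 8-cycle if it
  moves at least eight points; the remaining cases are \<open>m = 4\<close>, where \<open>t\<close> is even, and \<open>m = 6\<close>.
\<close>

lemma involution_conj_product_order:
  fixes t :: "nat \<Rightarrow> nat"
  assumes t: "t permutes {1..m}" "t \<circ> t = id" "t \<noteq> id"
    and nt: "\<And>a b. {a, b} \<subseteq> {1..m} \<Longrightarrow> t \<noteq> tp a b" and m: "m \<noteq> 6"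
    and ord: "\<And>s u. s permutes {1..m} \<Longrightarrow> u = t \<circ> (s \<circ> t \<circ> inv' s) \<Longrightarrow> u \<circ> u = id \<or> u \<circ> u \<circ> u = id"
  shows "evenperm t"
proof -
  have tt: "t (t x) = x" for x using t(2) by (simp add: fun_eq_iff)
  have mem: "t x \<in> {1..m} \<longleftrightarrow> x \<in> {1..m}" for x using permutes_in_image[OF t(1)] by blast
  have moved: "x \<in> {1..m}" if "t x \<noteq> x" for x using permutes_not_in[OF t(1)] that by blast
  have tne: "t x \<noteq> y" if "x \<noteq> t y" for x y using that tt by metis
  obtain a where a: "t a \<noteq> a" using t(3) by (metis eq_id_iff)
  define b where "b = t a"
  have "t \<noteq> tp a b" using nt moved[OF a] mem[of a] by (simp add: b_def)
  then obtain c where "t c \<noteq> tp a b c" by blast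
  then have c: "c \<noteq> a" "c \<noteq> b" "t c \<noteq> c"
    using tt[of a] by (auto simp: b_def Transposition.transpose_def split: if_splits)
  define d where "d = t c"
  have 1: "a \<noteq> b" "c \<noteq> a" "c \<noteq> b" "d \<noteq> c" "d \<noteq> a" "d \<noteq> b"
    "t a = b" "t b = a" "t c = d" "t d = c"
    using a c tt by (auto simp: b_def d_def) (metis tt)+
  have in1: "{a, b, c, d} \<subseteq> {1..m}"
    using moved[of a] moved[of b] moved[of c] moved[of d] 1 by auto
  have contra: False
    if s: "s permutes {1..m}" "u = t \<circ> (s \<circ> t \<circ> inv' s)" and "u (u a) \<noteq> a" "u (u (u a)) \<noteq> a" for s u
    using ord[OF s] that(3,4) by (auto simp: fun_eq_iff)
  have nofix: "t e \<noteq> e" if e: "e \<in> {1..m}" for e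
  proof
    assume te: "t e = e"
    then have ne: "e \<noteq> a" "e \<noteq> b" "e \<noteq> c" "e \<noteq> d" using 1 by auto
    \<comment> \<open>This is the 5-cycle through \<open>a, b, c, d, e\<close>. The conjugate of
      \<open>t\<close> swaps \<open>b\<close> with \<open>c\<close> and \<open>d\<close> with
      \<open>e\<close> and fixes \<open>a\<close>, so \<open>u\<close> carries \<open>a\<close> to
      \<open>b\<close>, \<open>d\<close>, \<open>e\<close> in turn.\<close>
    define s where "s = tp a b \<circ> tp b c \<circ> tp c d \<circ> tp d e"
    have s: "s permutes {1..m}" unfolding s_def
      using in1 e by (intro permutes_compose permutes_swap_id) auto
    have v: "s a = b" "s b = c" "s c = d" "s d = e" "s e = a"
      using 1 ne by (simp_all add: s_def)
    then have i: "inv' s b = a" "inv' s c = b" "inv' s d = c" "inv' s e = d" "inv' s a = e"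
      using s by (simp_all add: permutes_inv_eq)
    show False by (rule contra[OF s refl]) (use 1 ne te v i in simp_all)
  qed
  show ?thesis
  proof (cases "{1..m} = {a, b, c, d}")
    case True
    have "t = tp a b \<circ> tp c d"
    proof
      fix x
      show "t x = (tp a b \<circ> tp c d) x"
      proof (cases "x \<in> {a, b, c, d}")
        case True
        then show ?thesis using 1 by auto
      next
        case False
        then show ?thesis using True permutes_not_in[OF t(1), of x] by auto
      qed
    qed
    then show ?thesis using 1 by (simp add: evenperm_comp permutation_swap_id evenperm_swap)
  next
    case False
    then obtain e where e: "e \<in> {1..m}" "e \<notin> {a, b, c, d}" using in1 by blast
    define f where "f = t e"
    have 2: "f \<noteq> e" "f \<noteq> a" "f \<noteq> b" "f \<noteq> c" "f \<noteq> d" "t e = f" "t f = e" "f \<in> {1..m}"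
      using e nofix[of e] tt 1 mem[of e] by (auto simp: f_def) (metis tt)+
    have "card {a, b, c, d, e, f} = 6"
      using 1(1-6) 2(1-5) e(2) by (auto simp: card_insert_if)
    then have "{1..m} \<noteq> {a, b, c, d, e, f}" using m by (metis card_atLeastAtMost diff_Suc_1)
    then obtain g where g: "g \<in> {1..m}" "g \<notin> {a, b, c, d, e, f}" using in1 e 2 by blast
    define h where "h = t g"
    have 3: "h \<noteq> g" "h \<noteq> a" "h \<noteq> b" "h \<noteq> c" "h \<noteq> d" "h \<noteq> e" "h \<noteq> f" "t g = h" "t h = g" "h \<in> {1..m}"
      using g nofix[of g] tt 1 2 mem[of g] by (auto simp: h_def) (metis tt)+
    \<comment> \<open>The 8-cycle through \<open>a\<close> to \<open>h\<close>. The conjugate of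
      \<open>t\<close> swaps \<open>b\<close> with \<open>c\<close>, \<open>d\<close> with
      \<open>e\<close>, \<open>f\<close> with \<open>g\<close> and \<open>h\<close> with
      \<open>a\<close>, so \<open>u\<close> carries \<open>a\<close> to \<open>g\<close>,
      \<open>e\<close>, \<open>c\<close> in turn.\<close>
    define s where "s = tp a b \<circ> tp b c \<circ> tp c d \<circ> tp d e \<circ> tp e f \<circ> tp f g \<circ> tp g h"
    have s: "s permutes {1..m}" unfolding s_def
      using in1 e g 2 3 by (intro permutes_compose permutes_swap_id) auto
    have ne: "e \<noteq> a" "e \<noteq> b" "e \<noteq> c" "e \<noteq> d"
      "g \<noteq> a" "g \<noteq> b" "g \<noteq> c" "g \<noteq> d" "g \<noteq> e" "g \<noteq> f" using e g by auto
    have v: "s a = b" "s b = c" "s c = d" "s d = e" "s e = f" "s f = g" "s g = h" "s h = a"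
      using 1 2 3 ne by (simp_all add: s_def)
    then have i: "inv' s b = a" "inv' s c = b" "inv' s d = c" "inv' s e = d" "inv' s f = e"
       "inv' s g = f" "inv' s h = g" "inv' s a = h"
      using s by (simp_all add: permutes_inv_eq)
    have False by (rule contra[OF s refl]) (use 1 2 3 ne v i in simp_all)
    then show ?thesis ..
  qed
qed

text \<open>If the image \<open>t\<close> were not a transposition,
  \<open>involution_conj_product_order\<close> would make it even. All transpositions are conjugate,
  so \<open>\<alpha>\<close> would take only even values, against surjectivity.\<close>

lemma sym_automorphism_transposition:
  fixes \<alpha> :: "(nat \<Rightarrow> nat) \<Rightarrow> (nat \<Rightarrow> nat)"
  assumes m: "2 \<le> m" "m \<noteq> 6"
    and bij: "bij_betw \<alpha> {p. p permutes {1..m}} {p. p permutes {1..m}}"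
    and hom: "\<And>p q. p permutes {1..m} \<Longrightarrow> q permutes {1..m} \<Longrightarrow> \<alpha> (p \<circ> q) = \<alpha> p \<circ> \<alpha> q"
    and xy: "{x, y} \<subseteq> {1..m}" "x \<noteq> y"
  obtains a b where "{a, b} \<subseteq> {1..m}" "a \<noteq> b" "\<alpha> (tp x y) = tp a b"
proof -
  have perm: "\<alpha> p permutes {1..m}" if "p permutes {1..m}" for p
    using bij_betwE[OF bij] that by blast
  have surj: "\<exists>r. r permutes {1..m} \<and> q = \<alpha> r" if "q permutes {1..m}" for q
  proof -
    have "q \<in> \<alpha> ` {p. p permutes {1..m}}"
      unfolding bij_betw_imp_surj_on[OF bij] using that by simp
    then show ?thesis by blast
  qed
  have alpha_id: "\<alpha> id = id"
  proof -
    have "\<alpha> id \<circ> \<alpha> id = \<alpha> id" using hom[of id id] by (simp add: permutes_id)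
    then have "\<alpha> id (\<alpha> id x) = \<alpha> id x" for x by (metis o_apply)
    moreover have "inj (\<alpha> id)" using permutes_inj[OF perm[OF permutes_id]] .
    ultimately show ?thesis by (intro ext) (simp add: inj_eq)
  qed
  have inj: "p = q" if "\<alpha> p = \<alpha> q" "p permutes {1..m}" "q permutes {1..m}" for p q
    using bij that by (auto simp: bij_betw_def inj_on_def)
  have tpp: "tp a b permutes {1..m}" if "{a, b} \<subseteq> {1..m}" for a b
    using that by (simp add: permutes_swap_id)
  define t where "t = \<alpha> (tp x y)"
  have t: "t permutes {1..m}" "t \<circ> t = id"
    using perm[OF tpp[OF xy(1)]] hom[OF tpp[OF xy(1)] tpp[OF xy(1)]] alpha_id
    by (simp_all only: t_def transpose_comp_involutory)
  have tne: "t \<noteq> id"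
  proof
    assume "t = id"
    then have "\<alpha> (tp x y) = \<alpha> id" by (simp only: t_def alpha_id)
    from inj[OF this tpp[OF xy(1)] permutes_id] show False
      using xy(2) by (simp add: transpose_eq_id_iff)
  qed
  have conj: "\<alpha> s \<circ> t = \<alpha> (tp (s x) (s y)) \<circ> \<alpha> s" if s: "s permutes {1..m}" for s
  proof -
    have sxy: "{s x, s y} \<subseteq> {1..m}" using permutes_in_image[OF s] xy by simp
    have "s \<circ> tp x y = tp (s x) (s y) \<circ> s" by (rule comp_tp_inj[OF permutes_inj[OF s]])
    then have "\<alpha> (s \<circ> tp x y) = \<alpha> (tp (s x) (s y) \<circ> s)" by simp
    then show ?thesis unfolding hom[OF s tpp[OF xy(1)]] hom[OF tpp[OF sxy] s] by (simp only: t_def)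
  qed
  have "\<exists>a b. {a, b} \<subseteq> {1..m} \<and> t = tp a b"
  proof (rule ccontr)
    assume nt: "\<not> ?thesis"
    have "evenperm t"
    proof (rule involution_conj_product_order[OF t tne _ m(2)])
      show "t \<noteq> tp a b" if "{a, b} \<subseteq> {1..m}" for a b using nt that by blast
    next
      fix s u assume s: "s permutes {1..m}" and u: "u = t \<circ> (s \<circ> t \<circ> inv' s)"
      \<comment> \<open>Writing \<open>s\<close> as an image turns \<open>u\<close> into the image
        of a product of two transpositions, whose order is known.\<close>
      obtain r where r: "r permutes {1..m}" "s = \<alpha> r"
        using surj[OF s] by metis
      have "{r x, r y} \<subseteq> {1..m}" using permutes_in_image[OF r(1)] xy by simp
      note rp = tpp[OF this]
      have "s \<circ> t \<circ> inv' s = \<alpha> (tp (r x) (r y)) \<circ> (s \<circ> inv' s)"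
        unfolding r(2) conj[OF r(1)] by (simp only: comp_assoc)
      also have "s \<circ> inv' s = id" using permutes_inv_o(1)[OF s] .
      finally have ueq: "u = \<alpha> (tp x y \<circ> tp (r x) (r y))"
        unfolding u hom[OF tpp[OF xy(1)] rp] by (simp only: t_def o_id)
      define w where "w = tp x y \<circ> tp (r x) (r y)"
      have w: "w permutes {1..m}" unfolding w_def by (intro permutes_compose rp tpp xy(1))
      have "w \<circ> w = id \<or> w \<circ> w \<circ> w = id" by (rule tp_comp_tp_order[OF w_def])
      moreover have "u \<circ> u = \<alpha> (w \<circ> w)" "u \<circ> u \<circ> u = \<alpha> (w \<circ> w \<circ> w)"
        unfolding ueq w_def[symmetric] hom[OF w w] hom[OF permutes_compose[OF w w] w] by (rule refl)+
      ultimately show "u \<circ> u = id \<or> u \<circ> u \<circ> u = id" by (metis alpha_id)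
    qed
    have even_tp: "evenperm (\<alpha> (tp a b))" if ab: "{a, b} \<subseteq> {1..m}" "a \<noteq> b" for a b
    proof -
      obtain s where s: "s permutes {1..m}" "s x = a" "s y = b"
        using permutes_ex_two_points[of a b x y "{1..m}"] ab xy by auto
      have P: "permutation (\<alpha> s)" "permutation t" "permutation (\<alpha> (tp a b))"
        using perm[OF s(1)] t(1) perm[OF tpp[OF ab(1)]] permutation_permutes by blast+
      show ?thesis
        using conj[OF s(1)] \<open>evenperm t\<close> s(2,3) evenperm_comp[OF P(1,2)] evenperm_comp[OF P(3,1)] by auto
    qed
    have "evenperm (\<alpha> p)" if "p permutes {1..m}" for p
      using that finite_atLeastAtMost
    proof (induction p rule: permutes_induct)
      case id
      show ?case by (simp only: alpha_id evenperm_id)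
    next
      case (swap a b p)
      have ab: "{a, b} \<subseteq> {1..m}" using swap by simp
      have P: "permutation (\<alpha> (tp a b))" "permutation (\<alpha> p)"
        using perm[OF tpp[OF ab]] perm[OF swap(4)] permutation_permutes by blast+
      show ?case
        unfolding hom[OF tpp[OF ab] swap(4)] evenperm_comp[OF P] using even_tp[OF ab swap(3)] swap(5) by simp
    qed
    moreover obtain p where "p permutes {1..m}" "\<alpha> p = tp x y"
      using surj[OF tpp[OF xy(1)]] by metis
    ultimately show False using xy(2) by (metis evenperm_swap)
  qed
  then obtain a b where ab: "{a, b} \<subseteq> {1..m}" "t = tp a b" by blast
  moreover have "a \<noteq> b" using ab(2) tne by auto
  ultimately show ?thesis using that by (simp add: t_def)
qed

lemma tp_eq_tp_iff: "tp a b = tp c d \<longleftrightarrow> a = b \<and> c = d \<or> {a, b} = {c, d}"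
proof
  assume eq: "tp a b = tp c d"
  then have "tp c d a = b" "tp c d b = a" "tp a b c = d" by (metis transpose_apply_first transpose_apply_second)+
  then show "a = b \<and> c = d \<or> {a, b} = {c, d}"
    by (auto simp: Transposition.transpose_def split: if_splits)
qed (auto simp: doubleton_eq_iff transpose_commute)

lemma tp_comp_commute:
  assumes "{a, b} \<inter> {c, d} = {}" shows "tp a b \<circ> tp c d = tp c d \<circ> tp a b"
  using comp_tp_inj[of "tp a b" c d] assms by simp

text \<open>The transpositions \<open>tp 1 i\<close> are distinct and do not commute, so their
  images pairwise share exactly one point. They all turn out to share the same point
  \<open>a\<close>; sending \<open>1\<close> to \<open>a\<close> and \<open>i\<close> to the other
  point of the image of \<open>tp 1 i\<close> gives the conjugating permutation.\<close>

lemma sym_automorphism_inner: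
  fixes \<alpha> :: "(nat \<Rightarrow> nat) \<Rightarrow> (nat \<Rightarrow> nat)"
  assumes m: "3 \<le> m" "m \<noteq> 6"
    and bij: "bij_betw \<alpha> {p. p permutes {1..m}} {p. p permutes {1..m}}"
    and hom: "\<And>p q. p permutes {1..m} \<Longrightarrow> q permutes {1..m} \<Longrightarrow> \<alpha> (p \<circ> q) = \<alpha> p \<circ> \<alpha> q"
  obtains s where "s permutes {1..m}" "\<And>p. p permutes {1..m} \<Longrightarrow> \<alpha> p \<circ> s = s \<circ> p"
proof -
  have inj: "p = q" if "\<alpha> p = \<alpha> q" "p permutes {1..m}" "q permutes {1..m}" for p q
    using bij that by (auto simp: bij_betw_def inj_on_def)
  have tpp: "tp a b permutes {1..m}" if "{a, b} \<subseteq> {1..m}" for a b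
    using that by (simp add: permutes_swap_id)
  have tr: "\<exists>a b. {a, b} \<subseteq> {1..m} \<and> a \<noteq> b \<and> \<alpha> (tp x y) = tp a b" if "{x, y} \<subseteq> {1..m}" "x \<noteq> y" for x y
    by (rule sym_automorphism_transposition[OF _ m(2) bij hom that]) (use m in auto)
  have share: "{a, b} \<inter> {c, d} \<noteq> {} \<and> {a, b} \<noteq> {c, d}"
    if "\<alpha> (tp 1 i) = tp a b" "\<alpha> (tp 1 j) = tp c d" "i \<in> {2..m}" "j \<in> {2..m}" "i \<noteq> j" for a b c d i j
  proof
    have ij: "tp 1 i permutes {1..m}" "tp 1 j permutes {1..m}" using that tpp by auto
    note ij2 = permutes_compose[OF ij(1) ij(2)] permutes_compose[OF ij(2) ij(1)]
    have "(tp 1 i \<circ> tp 1 j) 1 \<noteq> (tp 1 j \<circ> tp 1 i) 1" using that by simp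
    then have "tp 1 i \<circ> tp 1 j \<noteq> tp 1 j \<circ> tp 1 i" by metis
    then have "\<alpha> (tp 1 i \<circ> tp 1 j) \<noteq> \<alpha> (tp 1 j \<circ> tp 1 i)" using inj ij2 by blast
    then show "{a, b} \<inter> {c, d} \<noteq> {}" using tp_comp_commute[of a b c d] that hom ij by auto
    have "tp 1 i \<noteq> tp 1 j" using that by (simp add: tp_eq_tp_iff doubleton_eq_iff)
    then show "{a, b} \<noteq> {c, d}"
      using inj[OF _ ij] that tp_eq_tp_iff by metis
  qed
  obtain a b c where abc: "a \<noteq> b" "a \<noteq> c" "b \<noteq> c" "\<alpha> (tp 1 2) = tp a b" "\<alpha> (tp 1 3) = tp a c"
    "{a, b, c} \<subseteq> {1..m}"
  proof -
    obtain a b where 1: "{a, b} \<subseteq> {1..m}" "a \<noteq> b" "\<alpha> (tp 1 2) = tp a b" using tr[of 1 2] m by auto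
    obtain c d where 2: "{c, d} \<subseteq> {1..m}" "c \<noteq> d" "\<alpha> (tp 1 3) = tp c d" using tr[of 1 3] m by auto
    have "{a, b} \<inter> {c, d} \<noteq> {} \<and> {a, b} \<noteq> {c, d}"
      by (rule share[OF 1(3) 2(3)]) (use m in auto)
    then consider "a = c" "b \<noteq> d" | "a = d" "b \<noteq> c" | "b = c" "a \<noteq> d" | "b = d" "a \<noteq> c" by auto
    then show ?thesis
      by cases (use that[of a b d] that[of a b c] that[of b a d] that[of b a c] 1 2 in
          \<open>auto simp: transpose_commute\<close>)
  qed
  have "\<exists>y. y \<in> {1..m} \<and> y \<noteq> a \<and> \<alpha> (tp 1 i) = tp a y" if i: "i \<in> {2..m}" for i
  proof -
    consider "i = 2" | "i = 3" | "i \<ge> 4" using i by force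
    then show ?thesis
    proof cases
      case 3
      obtain x y where xy: "{x, y} \<subseteq> {1..m}" "x \<noteq> y" "\<alpha> (tp 1 i) = tp x y" using tr[of 1 i] i by auto
      have s2: "{x, y} \<inter> {a, b} \<noteq> {}" and s3: "{x, y} \<inter> {a, c} \<noteq> {}"
        using share[OF xy(3) abc(4)] share[OF xy(3) abc(5)] i 3 by auto
      \<comment> \<open>A pair that meets \<open>{a, b}\<close> and \<open>{a, c}\<close> but avoids
        \<open>a\<close> can only be \<open>{b, c}\<close>. That triangle is excluded by
        injectivity, since \<open>tp b c\<close> is already the image of
        \<open>tp 2 3\<close>.\<close>
      have "{x, y} \<noteq> {b, c}"
      proof
        assume bc: "{x, y} = {b, c}"
        have p: "tp 1 2 permutes {1..m}" "tp 1 3 permutes {1..m}" "tp 1 i permutes {1..m}"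
          "tp 2 3 permutes {1..m}"
          using m i tpp by auto
        have "tp 2 1 \<circ> tp 1 3 \<circ> tp 2 (1::nat) = tp 2 3" by (rule transpose_comp_triple) auto
        then have "\<alpha> (tp 2 3) = \<alpha> (tp 1 2) \<circ> \<alpha> (tp 1 3) \<circ> \<alpha> (tp 1 2)"
          using hom[OF p(1,2)] hom[OF permutes_compose[OF p(2,1)] p(1)]
          by (simp add: transpose_commute)
        also have "\<dots> = tp b a \<circ> tp a c \<circ> tp b a" using abc by (simp add: transpose_commute)
        also have "\<dots> = tp b c" using abc by (intro transpose_comp_triple) auto
        also have "\<dots> = \<alpha> (tp 1 i)" using bc xy(3) tp_eq_tp_iff[of b c x y] by simp
        finally have "tp 2 3 = tp 1 i" using inj p by blast
        then show False using 3 by (auto simp: tp_eq_tp_iff doubleton_eq_iff)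
      qed
      then have "a \<in> {x, y}" using s2 s3 abc(1-3) by auto
      then show ?thesis using xy by (auto simp: transpose_commute)
    qed (use abc in auto)
  qed
  then obtain f where f: "\<And>i. i \<in> {2..m} \<Longrightarrow> f i \<in> {1..m} \<and> f i \<noteq> a \<and> \<alpha> (tp 1 i) = tp a (f i)"
    by metis
  define s where "s i = (if i = 1 then a else if i \<in> {2..m} then f i else i)" for i
  have img: "s i \<in> {1..m}" if "i \<in> {1..m}" for i using f[of i] abc that by (auto simp: s_def)
  have "inj_on s {1..m}"
  proof (rule inj_onI)
    fix i j assume ij: "i \<in> {1..m}" "j \<in> {1..m}" "s i = s j"
    have "i = j" if "i \<in> {2..m}" "j \<in> {2..m}" "f i = f j"
    proof -
      have "\<alpha> (tp 1 i) = \<alpha> (tp 1 j)" using f that by metis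
      then have "tp 1 i = tp 1 j" using inj tpp[of 1 i] tpp[of 1 j] that by auto
      then show ?thesis using that by (auto simp: tp_eq_tp_iff doubleton_eq_iff)
    qed
    then show "i = j" using ij f[of i] f[of j] by (auto simp: s_def split: if_splits)
  qed
  moreover from this have "s ` {1..m} = {1..m}"
    by (intro endo_inj_surj image_subsetI img finite_atLeastAtMost)
  ultimately have "bij_betw s {1..m} {1..m}" by (rule bij_betw_imageI)
  then have s: "s permutes {1..m}"
    by (rule bij_imp_permutes) (use m in \<open>auto simp: s_def\<close>)
  have star: "\<alpha> (tp 1 i) \<circ> s = s \<circ> tp 1 i" if "i \<in> {2..m}" for i
    using comp_tp_inj[OF permutes_inj[OF s], of 1 i] f[OF that] that by (simp add: s_def)
  have tps: "\<alpha> (tp i j) \<circ> s = s \<circ> tp i j" if ij: "i \<in> {1..m}" "j \<in> {1..m}" "i \<noteq> j" for i j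
  proof -
    consider "i = 1" | "j = 1" | "i \<noteq> 1" "j \<noteq> 1" by blast
    then show ?thesis
    proof cases
      case 1 then show ?thesis using star[of j] ij by simp
    next
      case 2 then show ?thesis using star[of i] ij by (simp add: transpose_commute)
    next
      case 3
      have p: "tp 1 i permutes {1..m}" "tp 1 j permutes {1..m}" using ij tpp[of 1 i] tpp[of 1 j] by auto
      \<comment> \<open>Every transposition is a product of three of the form \<open>tp 1 i\<close>,
        for which the intertwining relation is known.\<close>
      have "tp i 1 \<circ> tp 1 j \<circ> tp i 1 = tp i j" by (rule transpose_comp_triple) (use ij 3 in auto)
      then have e: "tp i j = tp 1 i \<circ> (tp 1 j \<circ> tp 1 i)" by (simp add: transpose_commute comp_assoc)
      have "\<alpha> (tp i j) = \<alpha> (tp 1 i) \<circ> (\<alpha> (tp 1 j) \<circ> \<alpha> (tp 1 i))"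
        unfolding e hom[OF p(1) permutes_compose[OF p]] hom[OF p(2,1)] ..
      have "\<alpha> (tp 1 i) (s x) = s (tp 1 i x)" "\<alpha> (tp 1 j) (s x) = s (tp 1 j x)" for x
        using star[of i, THEN fun_cong, of x] star[of j, THEN fun_cong, of x] ij 3 by simp_all
      with \<open>\<alpha> (tp i j) = _\<close> have "(\<alpha> (tp i j) \<circ> s) x = (s \<circ> tp i j) x" for x
        by (simp only: e o_apply)
      then show ?thesis by (rule ext)
    qed
  qed
  have "\<alpha> p \<circ> s = s \<circ> p" if "p permutes {1..m}" for p
    using that finite_atLeastAtMost
  proof (induction p rule: permutes_induct)
    case id
    have p: "tp 1 2 permutes {1..m}" using m by (intro tpp) auto
    have "\<alpha> (tp 1 2 \<circ> tp 1 2) = \<alpha> (tp 1 2) \<circ> \<alpha> (tp 1 2)" by (rule hom[OF p p])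
    then have "\<alpha> id = id" unfolding abc(4) by (simp only: transpose_comp_involutory)
    then show ?case by (simp only: id_o o_id)
  next
    case (swap x y p)
    then have xy: "{x, y} \<subseteq> {1..m}" by simp
    have "\<alpha> (tp x y \<circ> p) = \<alpha> (tp x y) \<circ> \<alpha> p" by (rule hom[OF tpp[OF xy] swap(4)])
    then have "\<alpha> (tp x y \<circ> p) \<circ> s = \<alpha> (tp x y) \<circ> s \<circ> p"
      using swap(5) by (simp only: comp_assoc)
    then show ?case unfolding tps[OF swap(1-3)] by (simp only: comp_assoc)
  qed
  then show ?thesis using s that by blast
qed

section \<open>Splitting central extensions of the symmetric group by scalars\<close>

text \<open>\<open>L p g\<close> reads: \<open>g\<close> is a lift of \<open>p\<close>. The locale
  abstracts the covering restricted to the image of the symmetric group, with lifts known to be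
  unique only up to a real factor. The last two assumptions provide the normalised lifts from which
  the splitting is built.\<close>

locale scalar_lifting =
  fixes m :: nat and L :: "(nat \<Rightarrow> nat) \<Rightarrow> 'b::real_algebra_1 \<Rightarrow> bool"
  assumes m_ge: "2 \<le> m"
    and L_one: "L id 1"
    and L_mult: "\<And>p q g h. p permutes {1..m} \<Longrightarrow> q permutes {1..m} \<Longrightarrow> L p g \<Longrightarrow> L q h \<Longrightarrow> L (p \<circ> q) (g * h)"
    and L_inverse: "\<And>p g. p permutes {1..m} \<Longrightarrow> L p g \<Longrightarrow> \<exists>h. L (inv' p) h \<and> g * h = 1 \<and> h * g = 1"
    and L_unique: "\<And>p g h. p permutes {1..m} \<Longrightarrow> L p g \<Longrightarrow> L p h \<Longrightarrow> \<exists>r. h = r *\<^sub>R g"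
    and L_transp: "\<And>a b. {a, b} \<subseteq> {1..m} \<Longrightarrow> a \<noteq> b \<Longrightarrow> \<exists>g. L (tp a b) g \<and> g * g = 1"
    and L_disjoint: "\<And>a b c d. {a, b, c, d} \<subseteq> {1..m} \<Longrightarrow> card {a, b, c, d} = 4 \<Longrightarrow>
       \<exists>g. L (tp a b \<circ> tp c d) g \<and> g * g = 1"
begin

lemma perm_tp: "{a, b} \<subseteq> {1..m} \<Longrightarrow> tp a b permutes {1..m}"
  by (simp add: permutes_swap_id)

lemma L_exists: "p permutes {1..m} \<Longrightarrow> \<exists>g. L p g"
proof (induction p rule: permutes_induct[OF _ finite_atLeastAtMost[of 1 m], consumes 1, case_names id swap])
  case id
  show ?case using L_one by blast
next
  case (swap a b p)
  have ab: "{a, b} \<subseteq> {1..m}" using swap(1,2) by simp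
  from L_transp[OF ab swap(3)] swap(5) L_mult[OF perm_tp[OF ab] swap(4)] show ?case by metis
qed

text \<open>For normalised lifts, \<open>h1 * g1\<close> is \<open>u\<close> times
  \<open>g1 * h1\<close>. The normalised lift of the product forces
  \<open>u * t\<^sup>2 = 1\<close>, hence \<open>u > 0\<close>, while commuting past
  \<open>g1\<close> twice gives \<open>u\<^sup>2 = 1\<close>. Other lifts differ only by
  scalars.\<close>

lemma disjoint_commute:
  assumes abcd: "{a, b, c, d} \<subseteq> {1..m}" "card {a, b, c, d} = 4"
    and g: "L (tp a b) g" and h: "L (tp c d) h"
  shows "g * h = h * g"
proof -
  have ne: "a \<noteq> b" "c \<noteq> d" "{a, b} \<inter> {c, d} = {}"
    using abcd(2) by (auto simp: card_insert_if split: if_splits)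
  have ab: "{a, b} \<subseteq> {1..m}" and cd: "{c, d} \<subseteq> {1..m}" using abcd(1) by auto
  note p = perm_tp[OF ab] and q = perm_tp[OF cd]
  obtain g1 where g1: "L (tp a b) g1" "g1 * g1 = 1" using L_transp[OF ab ne(1)] by blast
  obtain h1 where h1: "L (tp c d) h1" "h1 * h1 = 1" using L_transp[OF cd ne(2)] by blast
  obtain k where k: "L (tp a b \<circ> tp c d) k" "k * k = 1" using L_disjoint[OF abcd] by blast
  obtain t where t: "g1 * h1 = t *\<^sub>R k"
    using L_unique[OF permutes_compose[OF q p] k(1) L_mult[OF p q g1(1) h1(1)]] by blast
  have "L (tp a b \<circ> tp c d) (h1 * g1)"
    using L_mult[OF q p h1(1) g1(1)] unfolding tp_comp_commute[OF ne(3)] .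
  then obtain u where u: "h1 * g1 = u *\<^sub>R (g1 * h1)"
    using L_unique[OF permutes_compose[OF q p] L_mult[OF p q g1(1) h1(1)]] by blast
  have "1 = h1 * (g1 * g1) * h1" using g1 h1 by simp
  also have "\<dots> = (h1 * g1) * (g1 * h1)" by (simp only: mult.assoc)
  also have "\<dots> = (u * t\<^sup>2) *\<^sub>R (k * k)" unfolding u unfolding t by (simp add: power2_eq_square)
  finally have "(u * t\<^sup>2) *\<^sub>R (1::'b) = 1 *\<^sub>R 1" using k by simp
  then have "u * t\<^sup>2 = 1" by (simp only: scaleR_cancel_right) simp
  then have upos: "u > 0"
    by (metis mult_nonpos_nonneg not_le not_one_le_zero zero_le_power2)
  have "g1 * h1 = g1 * (h1 * g1) * g1" using g1 by (simp add: mult.assoc)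
  also have "\<dots> = g1 * (u *\<^sub>R (g1 * h1)) * g1" by (simp only: u)
  also have "\<dots> = u *\<^sub>R (g1 * g1 * (h1 * g1))" by (simp add: mult.assoc)
  also have "\<dots> = u\<^sup>2 *\<^sub>R (g1 * h1)" using g1 u by (simp add: power2_eq_square)
  finally have eq: "1 *\<^sub>R (g1 * h1) = u\<^sup>2 *\<^sub>R (g1 * h1)" by simp
  have "g1 * h1 \<noteq> 0"
  proof
    assume 0: "g1 * h1 = 0"
    have "(1::'b) = g1 * (g1 * h1) * h1" using g1(2) h1(2) by (simp add: mult.assoc[symmetric])
    then show False unfolding 0 by simp
  qed
  with eq have "u\<^sup>2 = 1" by (simp only: scaleR_cancel_right) simp
  then have "u = 1" using upos by (simp add: power2_eq_1_iff)
  then have comm: "h1 * g1 = g1 * h1" using u by simp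
  obtain r s where "g = r *\<^sub>R g1" "h = s *\<^sub>R h1"
    using L_unique[OF p g1(1) g] L_unique[OF q h1(1) h] by blast
  then show ?thesis using comm by (simp add: mult.commute)
qed

text \<open>The stabiliser of \<open>{1, 2}\<close> is generated by \<open>tp 1 2\<close> and the
  transpositions of \<open>{3..m}\<close>. Lifts of the latter commute with \<open>g\<close> by
  \<open>disjoint_commute\<close>.\<close>

lemma centralizer_commute:
  assumes s: "s permutes {1..m}" "{s 1, s 2} = {1, 2}" "L s z" and g: "L (tp 1 2) g"
  shows "z * g = g * z"
proof -
  have p12: "tp 1 2 permutes {1..m}" using m_ge by (intro perm_tp) auto
  have fixed: "z * g = g * z" if s: "s permutes {3..m}" and z: "L s z" for s z
  proof -
    have "\<exists>z. L s z \<and> z * g = g * z"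
      using s
    proof (induction s rule: permutes_induct[OF _ finite_atLeastAtMost[of 3 m], consumes 1, case_names id swap])
      case id
      show ?case using L_one by (metis mult_1_left mult_1_right)
    next
      case (swap a b p)
      then obtain z where z: "L p z" "z * g = g * z" by blast
      have ab: "{a, b} \<subseteq> {1..m}" using swap(1,2) by simp
      obtain h where h: "L (tp a b) h" using L_transp[OF ab swap(3)] by blast
      have "h * g = g * h"
      proof (rule disjoint_commute[OF _ _ h g])
        show "{a, b, 1, 2} \<subseteq> {1..m}" using ab m_ge by auto
        show "card {a, b, 1, 2} = 4" using swap(1,2,3) by (auto simp: card_insert_if)
      qed
      then have "h * z * g = g * (h * z)" using z(2) by (metis mult.assoc)
      moreover have "L (tp a b \<circ> p) (h * z)"
        by (rule L_mult[OF perm_tp[OF ab] _ h z(1)]) (rule permutes_subset[OF swap(4)], auto)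
      ultimately show ?case by blast
    qed
    then obtain z' where z': "L s z'" "z' * g = g * z'" by blast
    have "s permutes {1..m}" using s by (rule permutes_subset) auto
    then obtain r where "z = r *\<^sub>R z'" using L_unique[OF _ z'(1) z] by blast
    then show ?thesis using z'(2) by simp
  qed
  have sub: "{1..m} - {3..m} \<subseteq> {1, 2}" by auto
  show ?thesis
  proof (cases "s 1 = 1")
    case True
    then have "s 2 = 2" using s(2) by (auto simp: doubleton_eq_iff)
    then have "s permutes {3..m}"
      using True sub by (intro permutes_superset[OF s(1)]) auto
    then show ?thesis using fixed s(3) by blast
  next
    case False
    then have v: "s 1 = 2" "s 2 = 1" using s(2) by (auto simp: doubleton_eq_iff)
    \<comment> \<open>If \<open>s\<close> exchanges \<open>1\<close> and \<open>2\<close>, splitting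
      off \<open>tp 1 2\<close> leaves a permutation of \<open>{3..m}\<close>; then \<open>z\<close>
      is a multiple of \<open>g * y\<close>, and both factors commute with \<open>g\<close>.\<close>
    have p: "tp 1 2 \<circ> s permutes {1..m}" using permutes_compose[OF s(1) p12] .
    then have "tp 1 2 \<circ> s permutes {3..m}"
      by (rule permutes_superset) (use v sub in auto)
    moreover obtain y where y: "L (tp 1 2 \<circ> s) y" using L_exists[OF p] by blast
    ultimately have c: "y * g = g * y" using fixed by blast
    have "L (tp 1 2 \<circ> (tp 1 2 \<circ> s)) (g * y)" by (rule L_mult[OF p12 p g y])
    moreover have "tp 1 2 \<circ> (tp 1 2 \<circ> s) = s" by (simp flip: comp_assoc)
    ultimately obtain r where "z = r *\<^sub>R (g * y)" using L_unique[OF s(1) _ s(3)] by metis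
    then show ?thesis using c by (simp add: mult.assoc)
  qed
qed

text \<open>Fixing one lift \<open>g\<close> of \<open>tp 1 2\<close> removes the scalar ambiguity
  over all transpositions at once: its conjugates give one well-defined lift of each, and this
  family is closed under conjugation by its own members. That is the input for
  \<open>sym_group_hom_of_transpositions\<close>.\<close>

theorem splitting:
  obtains \<phi> where "\<phi> id = 1"
    and "\<And>p q. p permutes {1..m} \<Longrightarrow> q permutes {1..m} \<Longrightarrow> \<phi> (p \<circ> q) = \<phi> p * \<phi> q"
    and "\<And>p. p permutes {1..m} \<Longrightarrow> L p (\<phi> p)"
proof -
  have m12: "{1, 2} \<subseteq> {1..m}" using m_ge by auto
  note p12 = perm_tp[OF m12]
  obtain g where g: "L (tp 1 2) g" "g * g = 1" using L_transp[OF m12] by auto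
  \<comment> \<open>\<open>t\<close> is the conjugate of \<open>g\<close> by a lift \<open>h\<close>
    of a permutation carrying \<open>{1, 2}\<close> to \<open>{a, b}\<close>. A scalar factor in
    \<open>h\<close> cancels against \<open>h'\<close>.\<close>
  define Q where "Q a b t \<longleftrightarrow> (\<exists>s h h'. s permutes {1..m} \<and> {s 1, s 2} = {a, b} \<and>
    L s h \<and> L (inv' s) h' \<and> h * h' = 1 \<and> h' * h = 1 \<and> t = h * g * h')" for a b t
  have Q_sym: "Q a b t \<longleftrightarrow> Q b a t" for a b t
    unfolding Q_def insert_commute[of a b "{}"] ..
  have Q_ex: "\<exists>t. Q a b t" if ab: "{a, b} \<subseteq> {1..m}" "a \<noteq> b" for a b
  proof -
    obtain s where s: "s permutes {1..m}" "s 1 = a" "s 2 = b"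
      using permutes_ex_two_points[of a b 1 2 "{1..m}"] ab m12 by auto
    obtain h where h: "L s h" using L_exists[OF s(1)] by blast
    then obtain h' where "L (inv' s) h'" "h * h' = 1" "h' * h = 1"
      using L_inverse[OF s(1)] by blast
    with s h show ?thesis unfolding Q_def by blast
  qed
  have Q_unique: "t = t'" if "Q a b t" "Q a b t'" for a b t t'
  proof -
    obtain s h h' where s: "s permutes {1..m}" "{s 1, s 2} = {a, b}" "L (inv' s) h'"
      "h * h' = 1" "h' * h = 1" "t = h * g * h'"
      using \<open>Q a b t\<close> unfolding Q_def by blast
    obtain r k k' where r: "r permutes {1..m}" "{r 1, r 2} = {a, b}" "L r k"
      "k * k' = 1" "k' * k = 1" "t' = k * g * k'"
      using \<open>Q a b t'\<close> unfolding Q_def by blast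
    \<comment> \<open>Two choices of conjugator differ by \<open>h' * k\<close>, a lift of an
      element that stabilises \<open>{1, 2}\<close>, and this commutes with
      \<open>g\<close>.\<close>
    note si = permutes_inv[OF s(1)]
    have "{(inv' s \<circ> r) 1, (inv' s \<circ> r) 2} = inv' s ` {r 1, r 2}" by simp
    also have "\<dots> = inv' s ` {s 1, s 2}" by (simp only: s(2) r(2))
    also have "\<dots> = {1, 2}" using permutes_inverses(2)[OF s(1)] by simp
    finally have "h' * k * g = g * (h' * k)"
      by (rule centralizer_commute[OF permutes_compose[OF r(1) si] _ L_mult[OF si r(1) s(3) r(3)] g(1)])
    then have "h * (h' * k * g) * k' = h * (g * (h' * k)) * k'" by simp
    then have "(h * h') * (k * g * k') = h * g * h' * (k * k')" by (simp only: mult.assoc)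
    then show ?thesis using s r by simp
  qed
  have Q_L: "L (tp a b) t \<and> t * t = 1" if "Q a b t" for a b t
  proof -
    obtain s h h' where s: "s permutes {1..m}" "{s 1, s 2} = {a, b}" "L s h" "L (inv' s) h'"
      "h * h' = 1" "h' * h = 1" "t = h * g * h'"
      using \<open>Q a b t\<close> unfolding Q_def by blast
    note si = permutes_inv[OF s(1)]
    have "s \<circ> tp 1 2 \<circ> inv' s = tp (s 1) (s 2) \<circ> (s \<circ> inv' s)"
      unfolding comp_tp_inj[OF permutes_inj[OF s(1)]] by (simp only: comp_assoc)
    also have "\<dots> = tp (s 1) (s 2)" unfolding permutes_inv_o(1)[OF s(1)] by (rule o_id)
    also have "\<dots> = tp a b" unfolding tp_eq_tp_iff using s(2) by (rule disjI2)
    finally have e: "s \<circ> tp 1 2 \<circ> inv' s = tp a b" .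
    have "L (s \<circ> tp 1 2 \<circ> inv' s) t"
      unfolding s(7) by (rule L_mult[OF permutes_compose[OF p12 s(1)] si L_mult[OF s(1) p12 s(3) g(1)] s(4)])
    then have "L (tp a b) t" unfolding e .
    moreover have "t * t = h * g * (h' * h) * g * h'" by (simp only: s(7) mult.assoc)
    then have "t * t = h * (g * g) * h'" by (simp only: s(6) mult_1_right mult.assoc)
    then have "t * t = 1" using g(2) s(5) by simp
    ultimately show ?thesis by blast
  qed
  have Q_conj: "Q (tp a b c) (tp a b d) (t * u * t)" if ab: "{a, b} \<subseteq> {1..m}" and t: "Q a b t" and u: "Q c d u"
    for a b c d t u
  proof -
    obtain s h h' where s: "s permutes {1..m}" "{s 1, s 2} = {c, d}" "L s h" "L (inv' s) h'"
      "h * h' = 1" "h' * h = 1" "u = h * g * h'"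
      using u unfolding Q_def by blast
    note P = perm_tp[OF ab]
    have 1: "tp a b \<circ> s permutes {1..m}" by (rule permutes_compose[OF s(1) P])
    have "{(tp a b \<circ> s) 1, (tp a b \<circ> s) 2} = tp a b ` {s 1, s 2}" by simp
    also have "\<dots> = {tp a b c, tp a b d}" unfolding s(2) by simp
    finally have 2: "{(tp a b \<circ> s) 1, (tp a b \<circ> s) 2} = {tp a b c, tp a b d}" .
    have 3: "L (tp a b \<circ> s) (t * h)" using L_mult[OF P s(1) _ s(3)] Q_L[OF t] by blast
    have "inv' (tp a b \<circ> s) = inv' s \<circ> tp a b"
      using o_inv_distrib[OF permutes_bij[OF P] permutes_bij[OF s(1)]] by simp
    then have 4: "L (inv' (tp a b \<circ> s)) (h' * t)"
      using L_mult[OF permutes_inv[OF s(1)] P s(4)] Q_L[OF t] by simp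
    have 5: "(t * h) * (h' * t) = 1" "(h' * t) * (t * h) = 1"
  proof -
      have "(t * h) * (h' * t) = t * (h * h') * t" "(h' * t) * (t * h) = h' * (t * t) * h"
        by (simp_all only: mult.assoc)
      then show "(t * h) * (h' * t) = 1" "(h' * t) * (t * h) = 1"
        using s(5,6) Q_L[OF t] by simp_all
    qed
    have "t * u * t = (t * h) * g * (h' * t)" by (simp only: s(7) mult.assoc)
    then show ?thesis unfolding Q_def using 1 2 3 4 5 by blast
  qed
  \<comment> \<open>The default \<open>1\<close> matches \<open>tp a a = id\<close> and makes
    \<open>T_id\<close> and \<open>T_sym\<close> hold for all arguments, also outside
    \<open>{1..m}\<close>.\<close>
  define T where "T a b = (if {a, b} \<subseteq> {1..m} \<and> a \<noteq> b then THE t. Q a b t else 1)" for a b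
  have QT: "Q a b (T a b)" if "{a, b} \<subseteq> {1..m}" "a \<noteq> b" for a b
  proof -
    have "\<exists>!t. Q a b t" using Q_ex[OF that] Q_unique by blast
    from theI'[OF this] show ?thesis using that unfolding T_def by simp
  qed
  have T_id: "T a a = 1" for a by (simp add: T_def)
  have T_sq: "T a b * T a b = 1" if "{a, b} \<subseteq> {1..m}" for a b
    using Q_L[OF QT[OF that]] T_id by (cases "a = b") auto
  have T_sym: "T a b = T b a" for a b
    unfolding T_def Q_sym[of a b] insert_commute[of a b "{}"] by (cases "a = b") simp_all
  have T_conj: "T a b * T c d = T (tp a b c) (tp a b d) * T a b" if abcd: "{a, b, c, d} \<subseteq> {1..m}" for a b c d
  proof (cases "a = b \<or> c = d")
    case True
    then show ?thesis using T_id by auto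
  next
    case False
    then have ab: "{a, b} \<subseteq> {1..m}" "a \<noteq> b" and cd: "{c, d} \<subseteq> {1..m}" "c \<noteq> d" using abcd by auto
    have 1: "{tp a b c, tp a b d} \<subseteq> {1..m}"
      using permutes_in_image[OF perm_tp[OF ab(1)]] cd by simp
    have 2: "tp a b c \<noteq> tp a b d" using cd(2) by (metis transpose_involutory)
    have "T (tp a b c) (tp a b d) = T a b * T c d * T a b"
      by (rule Q_unique[OF QT[OF 1 2] Q_conj[OF ab(1) QT[OF ab] QT[OF cd]]])
    then have "T (tp a b c) (tp a b d) * T a b = T a b * T c d * (T a b * T a b)"
      by (simp only: mult.assoc)
    then show ?thesis using T_sq[OF ab(1)] by simp
  qed
  obtain \<phi> where \<phi>: "\<phi> id = 1"
    "\<And>p q. p permutes {1..m} \<Longrightarrow> q permutes {1..m} \<Longrightarrow> \<phi> (p \<circ> q) = \<phi> p * \<phi> q"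
    "\<And>a b. {a, b} \<subseteq> {1..m} \<Longrightarrow> \<phi> (tp a b) = T a b"
    by (rule sym_group_hom_of_transpositions[of T m, OF T_id T_sq T_sym T_conj]) blast+
  have "L p (\<phi> p)" if "p permutes {1..m}" for p
    using that
  proof (induction p rule: permutes_induct[OF _ finite_atLeastAtMost[of 1 m], consumes 1, case_names id swap])
    case id
    show ?case unfolding \<phi>(1) by (rule L_one)
  next
    case (swap a b p)
    have ab: "{a, b} \<subseteq> {1..m}" using swap(1,2) by simp
    have "L (tp a b) (T a b)" using Q_L[OF QT[OF ab swap(3)]] by blast
    then show ?case
      unfolding \<phi>(2)[OF perm_tp[OF ab] swap(4)] \<phi>(3)[OF ab]
      by (rule L_mult[OF perm_tp[OF ab] swap(4) _ swap(5)])
  qed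
  with \<phi>(1,2) show ?thesis by (rule that)
qed

end

section \<open>The covering of the orthogonal group\<close>

lemma clifford_vec_minus: "clifford_vec (- v) = - clifford_vec v"
  by (rule linear_neg[OF linear_clifford_vec])

lemma unit_vec_in_pin: "norm v = 1 \<Longrightarrow> clifford_vec v \<in> carrier pin_group"
  by (auto simp: pin_group_def intro: generate.incl)

lemma pin_mult_closed: "g \<in> carrier pin_group \<Longrightarrow> h \<in> carrier pin_group \<Longrightarrow> g * h \<in> carrier pin_group"
  using monoid.m_closed[OF group.is_monoid[OF group_pin]] by fastforce

lemma pin_one_closed: "1 \<in> carrier pin_group"
  using monoid.one_closed[OF group.is_monoid[OF group_pin]] by fastforce

lemma pin_carrier: "carrier pin_group = generate (units_of clifford_monoid) (clifford_vec ` {v. norm v = 1})"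
  by (simp add: pin_group_def)

text \<open>The inverse of a unit vector \<open>u\<close> is the unit vector \<open>- u\<close>, so
  products of unit vectors already exhaust the group. Proving that left multiplication by
  \<open>g\<close> preserves \<open>P\<close> makes the product case of the generation induction go
  through.\<close>

lemma pin_induct [consumes 1, case_names one vec_mult]:
  assumes g: "g \<in> carrier pin_group" and one: "P 1"
    and step: "\<And>u h. norm u = 1 \<Longrightarrow> h \<in> carrier pin_group \<Longrightarrow> P h \<Longrightarrow> P (clifford_vec u * h)"
  shows "P g"
proof -
  have "\<forall>h \<in> carrier pin_group. P h \<longrightarrow> P (g * h)"
    using g[unfolded pin_carrier]
  proof (induction g rule: generate.induct)
    case one
    then show ?case by (simp add: units_of_def clifford_monoid_def)
  next
    case (incl x)
    then show ?case using step by auto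
  next
    case (inv x)
    then obtain u where u: "x = clifford_vec u" "norm u = 1" by auto
    have "inv\<^bsub>units_of clifford_monoid\<^esub> x = clifford_vec (- u)"
    proof (rule group.inv_equality[OF group_units_clifford])
      show "clifford_vec (- u) \<otimes>\<^bsub>units_of clifford_monoid\<^esub> x = \<one>\<^bsub>units_of clifford_monoid\<^esub>"
        using unit_vec_inverse[OF u(2)] by (simp add: u clifford_vec_minus units_of_def clifford_monoid_def)
      show "x \<in> carrier (units_of clifford_monoid)" "clifford_vec (- u) \<in> carrier (units_of clifford_monoid)"
        using unit_vec_Units u(2) unfolding u(1) by (auto simp del: units_of_carrier)
    qed
    then show ?case using step[of "- u"] u by simp
  next
    case (eng x y)
    show ?case
    proof (intro ballI impI)
      fix h assume h: "h \<in> carrier pin_group" "P h"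
      have "y * h \<in> carrier pin_group"
        using pin_mult_closed[of y h] eng h unfolding pin_carrier by blast
      then have "P (x * (y * h))" using eng h by blast
      then show "P (x \<otimes>\<^bsub>units_of clifford_monoid\<^esub> y * h)"
        by (simp add: units_of_def clifford_monoid_def mult.assoc)
    qed
  qed
  then show ?thesis using pin_one_closed one by force
qed

lemma pin_cover_eqI:
  assumes "g \<in> carrier pin_group" "\<And>v. clifford_vec (M *v v) * g = grade_involution g * clifford_vec v"
  shows "pin_cover g = M"
  using pin_cover(1,2)[OF assms(1)] assms(2) pin_cover_iff[OF assms(1)] by blast

lemma pin_cover_commute:
  assumes "g \<in> carrier pin_group"
  shows "clifford_vec (pin_cover g *v v) * g = grade_involution g * clifford_vec v"
  using pin_cover(2)[OF assms] pin_cover_iff[OF assms] by blast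

lemma pin_cover_one: "pin_cover 1 = mat 1"
  by (rule pin_cover_eqI[OF pin_one_closed]) simp

lemma grade_involution_uminus: "grade_involution (- x) = - grade_involution x"
  by transfer auto

lemma pin_uminus_closed:
  assumes "g \<in> carrier pin_group"
  shows "- g \<in> carrier pin_group"
proof -
  \<comment> \<open>Any unit vector serves here: its Clifford square is \<open>-1\<close>.\<close>
  have 1: "norm (axis undefined 1 :: real^'a) = 1" by simp
  have "clifford_vec (axis undefined 1) * (clifford_vec (axis undefined 1) * g) \<in> carrier pin_group"
    by (intro pin_mult_closed unit_vec_in_pin assms 1)
  then show ?thesis using clifford_vec_sq[of "axis undefined 1 :: real^'a"] by (simp flip: mult.assoc)
qed

lemma pin_cover_uminus:
  assumes "g \<in> carrier pin_group"
  shows "pin_cover (- g) = pin_cover g"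
  by (rule pin_cover_eqI[OF pin_uminus_closed[OF assms]])
     (simp add: pin_cover_commute[OF assms] grade_involution_uminus)

lemma pin_cover_inv:
  assumes "g \<in> carrier pin_group"
  shows "inv\<^bsub>pin_group\<^esub> g \<in> carrier pin_group" "pin_cover (inv\<^bsub>pin_group\<^esub> g) = Finite_Cartesian_Product.transpose (pin_cover g)"
proof -
  show i: "inv\<^bsub>pin_group\<^esub> g \<in> carrier pin_group"
    using group.inv_closed[OF group_pin assms] .
  have "pin_cover (inv\<^bsub>pin_group\<^esub> g) ** pin_cover g = mat 1"
    unfolding pin_cover_mult[OF i assms, symmetric] pin_inv(2)[OF assms] by (rule pin_cover_one)
  then have "pin_cover (inv\<^bsub>pin_group\<^esub> g) ** (pin_cover g ** Finite_Cartesian_Product.transpose (pin_cover g)) =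
      Finite_Cartesian_Product.transpose (pin_cover g)"
    by (simp add: matrix_mul_assoc)
  then show "pin_cover (inv\<^bsub>pin_group\<^esub> g) = Finite_Cartesian_Product.transpose (pin_cover g)"
    using pin_cover(3)[OF assms] by (simp add: orthogonal_matrix_def)
qed

lemma orthogonal_matrix_inner:
  fixes N :: "real^'n::finite^'n"
  assumes "orthogonal_matrix N"
  shows "(N *v v) \<bullet> (N *v w) = v \<bullet> w"
proof -
  have "orthogonal_transformation ((*v) N)"
    unfolding orthogonal_transformation_matrix using assms by simp
  then show ?thesis by (simp only: orthogonal_transformation_def)
qed

section \<open>Reflections, determinants and parity of degree\<close>

definition reflection :: "real^'n::finite \<Rightarrow> real^'n^'n" where
  "reflection u = matrix (\<lambda>v. v - (2 * (u \<bullet> v)) *\<^sub>R u)"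

lemma reflection_mult: "reflection u *v v = v - (2 * (u \<bullet> v)) *\<^sub>R u"
proof -
  have "linear (\<lambda>v. v - (2 * (u \<bullet> v)) *\<^sub>R u)"
    by (rule linearI) (simp_all add: inner_add_right algebra_simps)
  then show ?thesis unfolding reflection_def by (simp add: matrix_works)
qed

lemma pin_cover_vec:
  assumes "norm u = 1"
  shows "pin_cover (clifford_vec u) = reflection u"
proof (rule pin_cover_eqI[OF unit_vec_in_pin[OF assms]])
  fix v
  have "clifford_vec (reflection u *v v) * clifford_vec u
      = clifford_vec v * clifford_vec u - (2 * (u \<bullet> v)) *\<^sub>R (clifford_vec u * clifford_vec u)"
    by (simp add: reflection_mult linear_diff[OF linear_clifford_vec]
        linear_scale[OF linear_clifford_vec] algebra_simps)
  also have "\<dots> = clifford_vec v * clifford_vec u + (2 * (u \<bullet> v)) *\<^sub>R 1"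
    by (simp add: clifford_vec_sq assms)
  also have "\<dots> = - (clifford_vec u * clifford_vec v)"
    using clifford_vec_anticommute[of u v] by (simp add: algebra_simps eq_neg_iff_add_eq_0)
  finally show "clifford_vec (reflection u *v v) * clifford_vec u
      = grade_involution (clifford_vec u) * clifford_vec v"
    by (simp add: grade_involution_vec)
qed

text \<open>An orthogonal matrix \<open>A\<close> that carries a basis vector to \<open>u\<close>
  conjugates the reflection into a diagonal matrix with a single entry \<open>-1\<close>.\<close>

lemma det_reflection:
  fixes u :: "real^'n::finite"
  assumes "norm u = 1"
  shows "det (reflection u) = -1"
proof -
  fix k :: 'n
  obtain A where A: "orthogonal_matrix A" "A *v axis k 1 = u"
    using orthogonal_matrix_exists_basis[OF assms, of k] by blast
  define D :: "real^'n^'n" where "D = (\<chi> i j. if i = j then (if i = k then -1 else 1) else 0)"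
  have D: "D *v v = v - (2 * (v $ k)) *\<^sub>R axis k 1" for v
  proof (subst vec_eq_iff, intro allI)
    fix i
    have "(D *v v) $ i = (\<Sum>j\<in>UNIV. if j = i then (if i = k then -1 else 1) * v $ i else 0)"
      unfolding matrix_vector_mult_def D_def vec_lambda_beta by (intro sum.cong refl) simp
    then show "(D *v v) $ i = (v - (2 * (v $ k)) *\<^sub>R axis k 1) $ i"
      by (simp add: axis_def)
  qed
  have "reflection u ** A = A ** D"
  proof (subst matrix_eq, intro allI)
    fix v
    have "(A *v v) \<bullet> (A *v axis k 1) = v \<bullet> axis k 1" by (rule orthogonal_matrix_inner[OF A(1)])
    then have "u \<bullet> (A *v v) = v $ k" using A(2) by (simp add: inner_commute inner_axis)
    then show "(reflection u ** A) *v v = (A ** D) *v v"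
      using A(2) by (simp add: matrix_vector_mul_assoc[symmetric] reflection_mult D
          matrix_vector_mult_diff_distrib matrix_vector_mult_scaleR)
  qed
  then have "det (reflection u) * det A = det D * det A" using det_mul[of "reflection u" A] det_mul[of A D] by (auto simp: mult.commute)
  moreover have "det A \<noteq> 0" using det_orthogonal_matrix[OF A(1)] by auto
  moreover have "det D = (\<Prod>i\<in>UNIV. if i = k then -1 else 1)"
    by (subst det_diagonal) (simp_all add: D_def)
  ultimately have "det (reflection u) * det A = (-1) * det A" "det A \<noteq> 0" by simp_all
  then show ?thesis using mult_right_cancel by blast
qed

text \<open>Elements of \<open>Pin(n)\<close> are homogeneous: each unit vector factor changes the
  sign both of the grade involution and of the determinant.\<close>

lemma grade_involution_pin:
  assumes "g \<in> carrier pin_group"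
  shows "grade_involution g = det (pin_cover g) *\<^sub>R g"
  using assms
proof (induction rule: pin_induct)
  case one
  then show ?case by (simp add: pin_cover_one)
next
  case (vec_mult u h)
  then show ?case
    by (simp add: grade_involution_mult grade_involution_vec pin_cover_mult unit_vec_in_pin
        pin_cover_vec det_mul det_reflection)
qed

text \<open>
  Cartan--Dieudonne: reflections move the images of an orthonormal basis back to the basis one
  vector at a time, without disturbing the vectors that are already in place.
\<close>

lemma pin_cover_surj:
  fixes M :: "real^'n::finite^'n"
  assumes "orthogonal_matrix M"
  obtains g where "g \<in> carrier pin_group" "pin_cover g = M"
proof -
  have "\<exists>g \<in> carrier pin_group. \<forall>i\<in>S. (pin_cover g ** M) *v axis i 1 = axis i 1" for S :: "'n set"
    using finite[of S]
  proof (induction S rule: finite_induct)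
    case empty
    then show ?case using pin_one_closed by auto
  next
    case (insert k S)
    then obtain g where g: "g \<in> carrier pin_group"
      and fx: "\<And>i. i \<in> S \<Longrightarrow> (pin_cover g ** M) *v axis i 1 = axis i 1" by blast
    let ?N = "pin_cover g ** M"
    have N: "orthogonal_matrix ?N" by (intro orthogonal_matrix_mul pin_cover(3) g assms)
    define e :: "real^'n" where "e = axis k 1"
    \<comment> \<open>Both \<open>?N *v e\<close> and \<open>e\<close> have length one, so the
      reflection along their difference exchanges them.\<close>
    define w where "w = ?N *v e - e"
    show ?case
    proof (cases "w = 0")
      case True
      then show ?thesis using g fx by (auto simp: w_def e_def)
    next
      case False
      define u where "u = w /\<^sub>R norm w"
      have u: "norm u = 1" using False by (simp add: u_def)
      have ee: "e \<bullet> e = 1" by (simp add: e_def inner_axis)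
      have nn: "(?N *v e) \<bullet> (?N *v e) = 1" using orthogonal_matrix_inner[OF N] ee by simp
      have uN: "2 * (u \<bullet> (?N *v e)) * inverse (norm w) = 1"
      proof -
        have "w \<bullet> w = 2 * (w \<bullet> (?N *v e))"
          unfolding w_def using ee nn by (simp add: inner_diff_left inner_diff_right inner_commute)
        then have "(norm w)\<^sup>2 = 2 * (w \<bullet> (?N *v e))" by (simp add: power2_norm_eq_inner)
        moreover have "2 * (u \<bullet> (?N *v e)) * inverse (norm w) = 2 * (w \<bullet> (?N *v e)) * (inverse (norm w))\<^sup>2"
          by (simp add: u_def power2_eq_square)
        ultimately have "2 * (u \<bullet> (?N *v e)) * inverse (norm w) = (norm w)\<^sup>2 * (inverse (norm w))\<^sup>2" by simp
        then show ?thesis using False by (simp flip: power_mult_distrib)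
      qed
      have "reflection u *v (?N *v e) = e"
      proof -
        have "(2 * (u \<bullet> (?N *v e))) *\<^sub>R u = (2 * (u \<bullet> (?N *v e)) * inverse (norm w)) *\<^sub>R w"
          by (simp add: u_def)
        also have "\<dots> = w" unfolding uN by simp
        finally show ?thesis by (simp add: reflection_mult w_def)
      qed
      \<comment> \<open>A basis vector already in place is orthogonal to \<open>e\<close> and to
        \<open>?N *v e\<close>, hence to \<open>w\<close>.\<close>
      moreover have "reflection u *v axis i 1 = axis i 1" if "i \<in> S" for i
      proof -
        have "i \<noteq> k" using that insert by auto
        have "w \<bullet> axis i 1 = (?N *v e) \<bullet> (?N *v axis i 1) - e \<bullet> axis i 1"
          using fx[OF that] by (simp add: w_def inner_diff_left)
        also have "\<dots> = 0" using orthogonal_matrix_inner[OF N] by simp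
        finally have "u \<bullet> axis i 1 = 0" by (simp add: u_def)
        then show ?thesis by (simp add: reflection_mult)
      qed
      ultimately have "\<forall>i\<in>insert k S. (pin_cover (clifford_vec u * g) ** M) *v axis i 1 = axis i 1"
        using fx by (auto simp: pin_cover_mult unit_vec_in_pin u g pin_cover_vec e_def
            matrix_mul_assoc[symmetric] matrix_vector_mul_assoc[symmetric])
      then show ?thesis using pin_mult_closed[OF unit_vec_in_pin[OF u] g] by blast
    qed
  qed
  from this[of UNIV] obtain g where g: "g \<in> carrier pin_group"
    and fx: "\<And>i. (pin_cover g ** M) *v axis i 1 = axis i 1" by blast
  have inv: "pin_cover g ** M = mat 1"
  proof -
    have "(pin_cover g ** M) $ j $ i = (mat 1 :: real^'n^'n) $ j $ i" for i j
    proof -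
      have "((pin_cover g ** M) *v axis i 1) $ j = axis i 1 $ j" by (simp only: fx)
      then show ?thesis unfolding matrix_vector_mult_basis column_def by (simp add: mat_def axis_def)
    qed
    then show ?thesis unfolding vec_eq_iff by blast
  qed
  have "Finite_Cartesian_Product.transpose (pin_cover g) =
      Finite_Cartesian_Product.transpose (pin_cover g) ** (pin_cover g ** M)"
    unfolding inv by simp
  also have "\<dots> = M"
    using pin_cover(3)[OF g] by (simp add: matrix_mul_assoc orthogonal_matrix_def)
  finally show ?thesis using that pin_cover_inv[OF g] by simp
qed

text \<open>An element over the identity satisfies
  \<open>blade {i} * g = grade_involution g * blade {i}\<close>. For \<open>i\<close> in
  \<open>A\<close>, moving \<open>blade {i}\<close> past \<open>blade A\<close> produces the sign
  opposite to \<open>(-1) ^ card A\<close>, so the coefficient of every nonempty \<open>A\<close>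
  vanishes.\<close>

lemma pin_cover_kernel:
  fixes g :: "'n::finite clifford"
  assumes "g \<in> carrier pin_group" "pin_cover g = mat 1"
  obtains r where "g = r *\<^sub>R 1"
proof -
  have comm: "blade {i} * g = grade_involution g * blade {i}" for i
    using pin_cover_commute[OF assms(1), of "axis i 1"] assms(2) by (simp add: clifford_vec_axis)
  have coeff_left: "clifford_coeff (blade {i} * x) B = blade_sign {i} (sym_diff {i} B) * clifford_coeff x (sym_diff {i} B)"
    for i :: 'n and x B
  proof -
    have "(\<Sum>A\<in>UNIV. blade_sign A (sym_diff A B) * (if A = {i} then 1 else 0) * clifford_coeff x (sym_diff A B))
       = (\<Sum>A\<in>UNIV. if A = {i} then blade_sign {i} (sym_diff {i} B) * clifford_coeff x (sym_diff {i} B) else 0)"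
      by (intro sum.cong refl) auto
    then show ?thesis by (simp add: times_clifford.rep_eq blade.rep_eq)
  qed
  have coeff_right: "clifford_coeff (x * blade {i}) B = blade_sign (sym_diff {i} B) {i} * clifford_coeff x (sym_diff {i} B)"
    for i :: 'n and x B
  proof -
    have "(\<Sum>A\<in>UNIV. blade_sign A (sym_diff A B) * clifford_coeff x A * (if sym_diff A B = {i} then 1 else 0))
       = (\<Sum>A\<in>UNIV. if A = sym_diff {i} B then blade_sign (sym_diff {i} B) {i} * clifford_coeff x (sym_diff {i} B) else 0)"
    proof (intro sum.cong refl)
      fix A
      have "sym_diff A B = {i} \<longleftrightarrow> A = sym_diff {i} B" by auto
      moreover have "sym_diff (sym_diff {i} B) B = {i}" by auto
      ultimately show "blade_sign A (sym_diff A B) * clifford_coeff x A * (if sym_diff A B = {i} then 1 else 0)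
        = (if A = sym_diff {i} B then blade_sign (sym_diff {i} B) {i} * clifford_coeff x (sym_diff {i} B) else 0)"
        by auto
    qed
    then show ?thesis by (simp add: times_clifford.rep_eq blade.rep_eq)
  qed
  have zero: "clifford_coeff g A = 0" if "A \<noteq> {}" for A
  proof -
    obtain i where i: "i \<in> A" using \<open>A \<noteq> {}\<close> by blast
    have "sym_diff {i} (sym_diff {i} A) = A" by (rule sym_diff_cancel)
    \<comment> \<open>The two products are compared at the index obtained from \<open>A\<close> by
      removing \<open>i\<close>.\<close>
    then have eq: "blade_sign {i} A * clifford_coeff g A = blade_sign A {i} * ((-1) ^ card A * clifford_coeff g A)"
      using arg_cong[OF comm[of i], of "\<lambda>x. clifford_coeff x (sym_diff {i} A)"]
      by (simp only: coeff_left coeff_right grade_involution.rep_eq)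
    have "blade_sign {i} A * blade_sign A {i} = (\<Prod>b\<in>A. (if to_nat b \<le> to_nat i then -1 else 1) * (if to_nat i \<le> to_nat b then -1 else 1))"
      by (simp add: blade_sign_def prod.distrib)
    also have "\<dots> = (\<Prod>b\<in>A. if b = i then 1 else -1)"
      by (intro prod.cong refl) (auto simp: antisym_conv)
    also have "\<dots> = (\<Prod>b\<in>A - {i}. -1)"
      using i by (subst prod.remove[of A i]) (auto intro!: prod.cong)
    also have "\<dots> = - ((-1) ^ card A)"
      using i by (cases "card A") (auto simp: card_Diff_singleton)
    finally have s: "blade_sign {i} A * blade_sign A {i} = - ((-1) ^ card A)" .
    have sq: "blade_sign A {i} * blade_sign A {i} = 1"
      unfolding blade_sign_def by (simp flip: prod.distrib) (auto intro!: prod.neutral)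
    have "blade_sign A {i} * (blade_sign {i} A * clifford_coeff g A) =
        (blade_sign A {i} * blade_sign A {i}) * ((-1) ^ card A * clifford_coeff g A)"
      unfolding eq by (simp only: mult.assoc)
    then have "(blade_sign {i} A * blade_sign A {i}) * clifford_coeff g A = (-1) ^ card A * clifford_coeff g A"
      unfolding sq by (simp add: mult_ac)
    then have "(-1) ^ card A * clifford_coeff g A = 0" unfolding s by simp
    then show ?thesis by simp
  qed
  have "g = clifford_coeff g {} *\<^sub>R 1"
    by (rule clifford_eqI) (simp add: scaleR_clifford.rep_eq one_clifford.rep_eq zero)
  then show ?thesis by (rule that)
qed

text \<open>The quotient of the two lifts lies over the identity. This supplies
  \<open>L_unique\<close> for the covering.\<close>

lemma pin_cover_eq_scaleR:
  assumes g: "g \<in> carrier pin_group" and h: "h \<in> carrier pin_group" and eq: "pin_cover g = pin_cover h"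
  shows "\<exists>r. h = r *\<^sub>R g"
proof -
  note gi = pin_cover_inv[OF g]
  have "pin_cover (inv\<^bsub>pin_group\<^esub> g * h) = mat 1"
    using pin_cover(3)[OF h] by (simp add: pin_cover_mult gi h eq orthogonal_matrix_def)
  then obtain r where "inv\<^bsub>pin_group\<^esub> g * h = r *\<^sub>R 1"
    using pin_cover_kernel pin_mult_closed[OF gi(1) h] by blast
  then have "g * (inv\<^bsub>pin_group\<^esub> g * h) = r *\<^sub>R g" by simp
  then show ?thesis using pin_inv[OF g] by (auto simp flip: mult.assoc)
qed

section \<open>Lifting involutions\<close>

lemma vec_prod_anticommute:
  assumes "\<And>w. w \<in> set us \<Longrightarrow> orthogonal u w"
  shows "prod_list (map clifford_vec us) * clifford_vec u
    = (-1) ^ length us * (clifford_vec u * prod_list (map clifford_vec us))"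
  using assms
proof (induction us)
  case Nil
  then show ?case by simp
next
  case (Cons w us)
  let ?g = "prod_list (map clifford_vec us)"
  have anti: "clifford_vec w * clifford_vec u = - (clifford_vec u * clifford_vec w)"
    using clifford_vec_anticommute[of w u] Cons.prems[of w]
    by (simp add: orthogonal_def inner_commute eq_neg_iff_add_eq_0)
  have IH: "?g * clifford_vec u = (-1) ^ length us * (clifford_vec u * ?g)"
    using Cons by simp
  have "prod_list (map clifford_vec (w # us)) * clifford_vec u = clifford_vec w * (?g * clifford_vec u)"
    by (simp add: mult.assoc)
  also have "\<dots> = (-1) ^ length us * (clifford_vec w * clifford_vec u * ?g)"
    unfolding IH by (cases "even (length us)") (simp_all add: mult.assoc)
  finally show ?case unfolding anti by (simp add: mult.assoc)
qed

text \<open>Moving the front vector past the \<open>k\<close> others costs \<open>(-1) ^ k\<close>,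
  and its square costs one more sign, so the exponents add up to triangular numbers.\<close>

lemma vec_prod_square:
  assumes "distinct us" "pairwise orthogonal (set us)" "\<And>u. u \<in> set us \<Longrightarrow> norm u = 1"
  shows "prod_list (map clifford_vec us) * prod_list (map clifford_vec us)
    = (-1) ^ (length us * Suc (length us) div 2)"
  using assms
proof (induction us)
  case Nil
  then show ?case by simp
next
  case (Cons u us)
  let ?g = "prod_list (map clifford_vec us)"
  have 1: "?g * ?g = (-1) ^ (length us * Suc (length us) div 2)"
    using Cons by (simp add: pairwise_insert)
  have 2: "?g * clifford_vec u = (-1) ^ length us * (clifford_vec u * ?g)"
    using Cons.prems(1,2) by (intro vec_prod_anticommute) (auto simp: pairwise_insert)
  have 3: "clifford_vec u * clifford_vec u = -1" using Cons.prems(3)[of u] by (simp add: clifford_vec_sq)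
  have "Suc (length us) * Suc (Suc (length us)) = length us * Suc (length us) + 2 * Suc (length us)"
    by simp
  then have e: "Suc (length us) * Suc (Suc (length us)) div 2 = length us * Suc (length us) div 2 + Suc (length us)"
    by simp
  have "clifford_vec u * ?g * (clifford_vec u * ?g) = clifford_vec u * (?g * clifford_vec u) * ?g"
    by (simp only: mult.assoc)
  also have "\<dots> = (-1) ^ length us * (clifford_vec u * clifford_vec u * (?g * ?g))"
    unfolding 2 by (cases "even (length us)") (simp_all add: mult.assoc)
  also have "\<dots> = (-1) ^ Suc (length us) * (?g * ?g)" unfolding 3 by simp
  also have "\<dots> = (-1) ^ (length (u # us) * Suc (length (u # us)) div 2)"
    unfolding 1 power_add[symmetric] length_Cons e by (simp only: add.commute)
  finally show ?case by simp
qed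

lemma vec_prod_pin:
  assumes "\<And>u. u \<in> set us \<Longrightarrow> norm u = 1"
  shows "prod_list (map clifford_vec us) \<in> carrier pin_group"
    and "det (pin_cover (prod_list (map clifford_vec us))) = (-1) ^ length us"
proof -
  show 1: "prod_list (map clifford_vec us) \<in> carrier pin_group"
    using assms by (induction us) (auto intro: pin_one_closed pin_mult_closed unit_vec_in_pin)
  show "det (pin_cover (prod_list (map clifford_vec us))) = (-1) ^ length us"
    using assms
  proof (induction us)
    case Nil
    then show ?case by (simp add: pin_cover_one)
  next
    case (Cons u us)
    have "prod_list (map clifford_vec us) \<in> carrier pin_group"
      using Cons.prems by (induction us) (auto intro: pin_one_closed pin_mult_closed unit_vec_in_pin)
    then show ?case
      using Cons by (simp add: pin_cover_mult unit_vec_in_pin pin_cover_vec det_mul det_reflection)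
  qed
qed

text \<open>By orthogonality the corrections made by the single reflections add up: the product
  negates the span of the vectors and fixes its orthogonal complement.\<close>

lemma vec_prod_cover:
  assumes "distinct us" "pairwise orthogonal (set us)" "\<And>u. u \<in> set us \<Longrightarrow> norm u = 1"
  shows "pin_cover (prod_list (map clifford_vec us)) *v v = v - 2 *\<^sub>R (\<Sum>u\<in>set us. (v \<bullet> u) *\<^sub>R u)"
  using assms
proof (induction us)
  case Nil
  then show ?case by (simp add: pin_cover_one)
next
  case (Cons u us)
  let ?g = "prod_list (map clifford_vec us)"
  let ?s = "\<Sum>w\<in>set us. (v \<bullet> w) *\<^sub>R w"
  have g: "?g \<in> carrier pin_group" using Cons.prems by (intro vec_prod_pin) simp
  have u: "norm u = 1" "clifford_vec u \<in> carrier pin_group"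
    using Cons.prems by (auto intro: unit_vec_in_pin)
  have IH: "pin_cover ?g *v v = v - 2 *\<^sub>R ?s" using Cons by (simp add: pairwise_insert)
  have "u \<bullet> w = 0" if "w \<in> set us" for w
    using Cons.prems(1,2) that by (auto simp: pairwise_insert orthogonal_def)
  then have us: "u \<bullet> ?s = 0" by (simp add: inner_sum_right)
  have "pin_cover (clifford_vec u * ?g) *v v = reflection u *v (pin_cover ?g *v v)"
    by (simp add: pin_cover_mult u g pin_cover_vec matrix_vector_mul_assoc)
  also have "\<dots> = v - 2 *\<^sub>R ?s - (2 * (v \<bullet> u)) *\<^sub>R u"
    unfolding IH reflection_mult by (simp add: inner_diff_right us inner_commute[of u v])
  also have "\<dots> = v - 2 *\<^sub>R (\<Sum>w\<in>set (u # us). (v \<bullet> w) *\<^sub>R w)"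
    using Cons.prems(1) by (simp add: scaleR_right_distrib)
  finally show ?case by simp
qed

lemma trace_via_axis: "trace A = (\<Sum>i\<in>UNIV. (A *v axis i 1) $ i)" for A :: "real^'n::finite^'n"
  unfolding trace_def matrix_vector_mult_basis column_def by simp

text \<open>
  The product of an orthonormal basis of the \<open>-1\<close>-eigenspace lifts the involution, and
  \<open>k\<close> orthonormal vectors have a product with square \<open>(-1)\<^bsup>k(k+1)/2\<^esup>\<close>; the trace
  condition says that \<open>4\<close> divides \<open>k\<close>.
\<close>

lemma involution_lift:
  fixes P :: "real^'n::finite^'n"
  assumes P: "orthogonal_matrix P" "P ** P = mat 1" and tr: "[trace P = real CARD('n)] (rmod 8)"
  shows "\<exists>g\<in>carrier pin_group. pin_cover g = P \<and> g * g = 1" "det P = 1"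
proof -
  have PP: "P *v (P *v v) = v" for v using P(2) by (simp add: matrix_vector_mul_assoc)
  have sym: "(P *v v) \<bullet> w = v \<bullet> (P *v w)" for v w
    using orthogonal_matrix_inner[OF P(1), of "P *v v" w] PP by simp
  define V where "V = {v. P *v v = - v}"
  have "subspace V"
    unfolding V_def by (rule subspaceI)
      (simp_all add: matrix_vector_right_distrib matrix_vector_mult_scaleR)
  then obtain B where B: "B \<subseteq> V" "pairwise orthogonal B" "\<And>x. x \<in> B \<Longrightarrow> norm x = 1"
    "independent B" "span B = V"
    by (rule orthonormal_basis_subspace) blast
  have "finite B" using B(4) by (rule independent_imp_finite)
  then obtain us where us: "set us = B" "distinct us" using finite_distinct_list by blast
  let ?g = "prod_list (map clifford_vec us)"
  have g: "?g \<in> carrier pin_group" "det (pin_cover ?g) = (-1) ^ length us"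
    using vec_prod_pin[of us] us B(3) by auto
  have cov: "pin_cover ?g *v v = v - 2 *\<^sub>R (\<Sum>u\<in>B. (v \<bullet> u) *\<^sub>R u)" for v
    using vec_prod_cover[of us v] us B by simp
  \<comment> \<open>The difference \<open>v - P *v v\<close> lies in the eigenspace
    \<open>V\<close>; its expansion in \<open>B\<close> is the one produced by the
    reflections.\<close>
  have cov': "P *v v = pin_cover ?g *v v" for v
  proof -
    define w where "w = v - P *v v"
    have "w \<in> span B" unfolding B(5) V_def w_def by (simp add: matrix_vector_mult_diff_distrib PP)
    then have "(\<Sum>u\<in>B. (w \<bullet> u) *\<^sub>R u) = w"
      using orthonormal_basis_expand[OF B(2,3)] \<open>finite B\<close> by blast
    moreover have "w \<bullet> u = 2 * (v \<bullet> u)" if "u \<in> B" for u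
    proof -
      have "P *v u = - u" using that B(1) V_def by auto
      then show ?thesis using sym[of v u] by (simp add: w_def inner_diff_left)
    qed
    ultimately have "(\<Sum>u\<in>B. (2 * (v \<bullet> u)) *\<^sub>R u) = w" by simp
    then have "2 *\<^sub>R (\<Sum>u\<in>B. (v \<bullet> u) *\<^sub>R u) = w" by (simp add: scaleR_sum_right)
    then show ?thesis unfolding cov w_def by simp
  qed
  then have eq: "pin_cover ?g = P" by (simp add: matrix_eq)
  have "trace P = (\<Sum>i\<in>UNIV. (axis i 1 :: real^'n) $ i - 2 * (\<Sum>u\<in>B. u $ i * u $ i))"
    unfolding trace_via_axis cov' cov by (simp add: inner_axis')
  also have "\<dots> = real CARD('n) - 2 * (\<Sum>i\<in>UNIV. \<Sum>u\<in>B. u $ i * u $ i)"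
    by (simp add: sum_subtractf sum_distrib_left axis_def)
  also have "(\<Sum>i\<in>UNIV. \<Sum>u\<in>B. u $ i * u $ i) = (\<Sum>u\<in>B. u \<bullet> u)"
    by (subst sum.swap) (simp add: inner_vec_def)
  also have "\<dots> = (\<Sum>u\<in>B. 1)" using B(3) by (intro sum.cong refl) (simp add: norm_eq_1)
  also have "\<dots> = real (length us)" using us distinct_card[OF us(2)] by simp
  finally have "trace P = real CARD('n) - 2 * real (length us)" .
  \<comment> \<open>With \<open>length us\<close> the dimension of \<open>V\<close>, the congruence
    says that \<open>8\<close> divides twice that dimension.\<close>
  with tr obtain k :: int where "real CARD('n) = real CARD('n) - 2 * real (length us) + of_int k * 8"
    unfolding rcong_altdef by auto
  then have "real_of_int (int (length us)) = of_int (4 * k)" by simp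
  then have "int (length us) = 4 * k" by (simp only: of_int_eq_iff)
  then have "4 dvd length us" by presburger
  then obtain j where j: "length us = 4 * j" by blast
  show "det P = 1" using g(2) by (simp add: eq j)
  have "length us * Suc (length us) div 2 = 2 * (j * Suc (4 * j))" by (simp add: j)
  then have "?g * ?g = 1"
    using vec_prod_square[of us] us B by (simp add: power_mult)
  then show "\<exists>g\<in>carrier pin_group. pin_cover g = P \<and> g * g = 1" using g(1) eq by blast
qed

lemma minus_mat_one_mult: "(- mat 1) *v v = - v" for v :: "real^'n::finite"
  using scaleR_matrix_vector_assoc[of "-1" "mat 1" v] by simp

section \<open>The commutant of an irreducible orthogonal representation\<close>

text \<open>A maximiser \<open>x\<close> of the quadratic form on the unit sphere is an eigenvector
  for the maximal value \<open>c\<close>: the form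
  \<open>c * (v \<bullet> v) - v \<bullet> (S *v v)\<close> is nonnegative and vanishes at
  \<open>x\<close>, so its first variation there is zero.\<close>

lemma symmetric_matrix_eigenvector:
  fixes S :: "real^'n::finite^'n"
  assumes sym: "\<And>v w. (S *v v) \<bullet> w = v \<bullet> (S *v w)"
  obtains c x where "x \<noteq> 0" "S *v x = c *\<^sub>R x"
proof -
  have "continuous_on (sphere 0 1) (\<lambda>v. v \<bullet> (S *v v))"
    by (intro continuous_intros matrix_vector_mult_linear_continuous_on)
  moreover have "axis undefined 1 \<in> sphere (0::real^'n) 1" by simp
  then have "sphere (0::real^'n) 1 \<noteq> {}" by blast
  ultimately obtain x where x: "x \<in> sphere 0 1" and
    max: "\<And>y. y \<in> sphere 0 1 \<Longrightarrow> y \<bullet> (S *v y) \<le> x \<bullet> (S *v x)"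
    using continuous_attains_sup[OF compact_sphere] by blast
  define c where "c = x \<bullet> (S *v x)"
  have xx: "x \<bullet> x = 1" using x by (simp add: norm_eq_1)
  have pos: "0 \<le> c * (v \<bullet> v) - v \<bullet> (S *v v)" for v
  proof (cases "v = 0")
    case False
    define y where "y = v /\<^sub>R norm v"
    have v: "v = norm v *\<^sub>R y" using False by (simp add: y_def)
    have "y \<in> sphere 0 1" using False by (simp add: y_def)
    then have "y \<bullet> (S *v y) \<le> c" using max c_def by simp
    then have "(norm v)\<^sup>2 * (y \<bullet> (S *v y)) \<le> (norm v)\<^sup>2 * c" by (rule mult_left_mono) simp
    moreover have "v \<bullet> (S *v v) = (norm v)\<^sup>2 * (y \<bullet> (S *v y))"
      by (subst (1 2) v) (simp add: matrix_vector_mult_scaleR power2_eq_square)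
    ultimately show ?thesis by (simp add: power2_norm_eq_inner mult.commute)
  qed simp
  define w where "w = c *\<^sub>R x - S *v x"
  define q where "q = c * (w \<bullet> w) - w \<bullet> (S *v w)"
  \<comment> \<open>The nonnegative form is evaluated at \<open>x + t *\<^sub>R w\<close>; the
    linear term in \<open>t\<close> is \<open>2 * t * (w \<bullet> w)\<close>.\<close>
  have quad: "0 \<le> 2 * t * (w \<bullet> w) + t\<^sup>2 * q" for t
  proof -
    have "w \<bullet> w = w \<bullet> (c *\<^sub>R x - S *v x)" by (simp only: w_def)
    then have "w \<bullet> w = c * (x \<bullet> w) - w \<bullet> (S *v x)" by (simp add: inner_diff_right inner_commute[of w x])
    moreover have "x \<bullet> (S *v w) = w \<bullet> (S *v x)" using sym[of x w] by (simp add: inner_commute)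
    then have "c * ((x + t *\<^sub>R w) \<bullet> (x + t *\<^sub>R w)) - (x + t *\<^sub>R w) \<bullet> (S *v (x + t *\<^sub>R w))
       = 2 * t * (c * (x \<bullet> w) - w \<bullet> (S *v x)) + t\<^sup>2 * q"
      using xx unfolding q_def matrix_vector_right_distrib matrix_vector_mult_scaleR
      by (simp add: inner_add_left inner_add_right c_def[symmetric] inner_commute[of w x] algebra_simps power2_eq_square)
    ultimately show ?thesis using pos[of "x + t *\<^sub>R w"] by simp
  qed
  have "w \<bullet> w = 0"
  proof (rule ccontr)
    assume "w \<bullet> w \<noteq> 0"
    then have ww: "w \<bullet> w > 0" by simp
    \<comment> \<open>For \<open>t = - (w \<bullet> w) / d\<close> with \<open>d\<close> above
      \<open>q\<close>, the linear term outweighs the quadratic one and \<open>quad\<close>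
      fails.\<close>
    define d where "d = \<bar>q\<bar> + 1"
    have d: "d > 0" "q < d" unfolding d_def by auto
    have "(- (w \<bullet> w) / d)\<^sup>2 * q = (w \<bullet> w)\<^sup>2 / d\<^sup>2 * q"
      by (simp add: power_divide)
    moreover have "(w \<bullet> w)\<^sup>2 / d\<^sup>2 * q < (w \<bullet> w)\<^sup>2 / d\<^sup>2 * d"
      using ww d by (intro mult_strict_left_mono) auto
    moreover have "(w \<bullet> w)\<^sup>2 / d\<^sup>2 * d = (w \<bullet> w)\<^sup>2 / d" using d by (simp add: power2_eq_square)
    moreover have "2 * (- (w \<bullet> w) / d) * (w \<bullet> w) = - 2 * ((w \<bullet> w)\<^sup>2 / d)" by (simp add: power2_eq_square)
    moreover have "(w \<bullet> w)\<^sup>2 / d > 0" using ww d by simp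
    ultimately show False using quad[of "- (w \<bullet> w) / d"] by linarith
  qed
  then have "S *v x = c *\<^sub>R x" by (simp add: w_def)
  moreover have "x \<noteq> 0" using xx by auto
  ultimately show ?thesis using that by blast
qed

text \<open>Schur's lemma over the reals, for symmetric matrices: a real eigenvalue exists, and its
  eigenspace is a nonzero invariant subspace.\<close>

lemma symmetric_commutant_scalar:
  fixes S :: "real^'n::finite^'n"
  assumes irr: "irreducible_rep G \<rho>" and sym: "\<And>v w. (S *v v) \<bullet> w = v \<bullet> (S *v w)"
    and comm: "\<And>g. g \<in> carrier G \<Longrightarrow> S ** \<rho> g = \<rho> g ** S"
  shows "\<exists>c. \<forall>v. S *v v = c *\<^sub>R v"
proof -
  obtain c x where x: "x \<noteq> 0" "S *v x = c *\<^sub>R x" using symmetric_matrix_eigenvector[OF sym] by blast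
  let ?V = "{v. S *v v = c *\<^sub>R v}"
  have "subspace ?V"
    by (rule subspaceI) (simp_all add: matrix_vector_right_distrib matrix_vector_mult_scaleR scaleR_right_distrib)
  moreover have "\<rho> g *v v \<in> ?V" if "g \<in> carrier G" "v \<in> ?V" for g v
  proof -
    have "S *v (\<rho> g *v v) = \<rho> g *v (S *v v)"
      using comm[OF that(1)] by (simp add: matrix_vector_mul_assoc)
    then show ?thesis using that(2) by (simp add: matrix_vector_mult_scaleR)
  qed
  ultimately have "?V = {0} \<or> ?V = UNIV" using irr unfolding irreducible_rep_def by blast
  moreover have "x \<in> ?V" using x by simp
  ultimately have "?V = UNIV" using x(1) by auto
  then have "S *v v = c *\<^sub>R v" for v by auto
  then show ?thesis by blast
qed

text \<open>
  The square root of \<open>B\<close> is the normalised \<open>1 + B\<close>: by Schur's lemma for symmetric matrices,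
  \<open>(1 + B)\<^sup>T (1 + B) = 2 + B + B\<^sup>T\<close> is a scalar.
\<close>

lemma commutant_square_root:
  fixes B :: "real^'n::finite^'n"
  assumes irr: "irreducible_rep G \<rho>" and orth: "\<And>g. g \<in> carrier G \<Longrightarrow> orthogonal_matrix (\<rho> g)"
    and B: "orthogonal_matrix B" "\<And>g. g \<in> carrier G \<Longrightarrow> B ** \<rho> g = \<rho> g ** B" and ne: "B \<noteq> - mat 1"
  obtains C where "orthogonal_matrix C" "C ** C = B" "\<And>g. g \<in> carrier G \<Longrightarrow> C ** \<rho> g = \<rho> g ** C"
proof -
  let ?T = "Finite_Cartesian_Product.transpose"
  have BT: "?T B ** B = mat 1" "B ** ?T B = mat 1" using B(1) by (auto simp: orthogonal_matrix_def)
  have dot: "(?T A *v v) \<bullet> w = v \<bullet> (A *v w)" for A :: "real^'n^'n" and v w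
    by (simp add: dot_lmul_matrix vector_transpose_matrix)
  have dot': "(A *v v) \<bullet> w = v \<bullet> (?T A *v w)" for A :: "real^'n^'n" and v w
    using dot[of "?T A" v w] by simp
  have comm: "(B + ?T B) ** \<rho> g = \<rho> g ** (B + ?T B)" if "g \<in> carrier G" for g
  proof -
    have "?T B ** \<rho> g = ?T B ** \<rho> g ** (B ** ?T B)" unfolding BT by simp
    also have "\<dots> = ?T B ** (\<rho> g ** B) ** ?T B" by (simp add: matrix_mul_assoc)
    also have "\<dots> = ?T B ** (B ** \<rho> g) ** ?T B" using B(2)[OF that] by simp
    also have "\<dots> = (?T B ** B) ** \<rho> g ** ?T B" by (simp add: matrix_mul_assoc)
    also have "\<dots> = \<rho> g ** ?T B" unfolding BT by simp
    finally have T: "?T B ** \<rho> g = \<rho> g ** ?T B" .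
    have "B *v (\<rho> g *v v) = \<rho> g *v (B *v v)" "?T B *v (\<rho> g *v v) = \<rho> g *v (?T B *v v)" for v
      by (simp_all only: matrix_vector_mul_assoc B(2)[OF that] T)
    then show ?thesis
      by (simp add: matrix_eq matrix_vector_mul_assoc[symmetric] matrix_vector_mult_add_rdistrib
          matrix_vector_right_distrib)
  qed
  have sym: "((B + ?T B) *v v) \<bullet> w = v \<bullet> ((B + ?T B) *v w)" for v w
      by (simp add: matrix_vector_mult_add_rdistrib inner_add_left inner_add_right dot_lmul_matrix dot')
  obtain c where c: "\<And>v. (B + ?T B) *v v = c *\<^sub>R v"
    using symmetric_commutant_scalar[OF irr sym comm] by blast
  \<comment> \<open>As the transpose of \<open>B\<close> is its inverse, \<open>B\<close> satisfies
    the quadratic equation \<open>B\<^sup>2 = c B - 1\<close>.\<close>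
  have BB: "B *v (B *v v) = c *\<^sub>R (B *v v) - v" for v
  proof -
    have "c *\<^sub>R (B *v v) = B *v (B *v v) + ?T B *v (B *v v)"
      using c[of "B *v v"] by (simp add: matrix_vector_mult_add_rdistrib)
    also have "?T B *v (B *v v) = v" by (simp add: matrix_vector_mul_assoc BT)
    finally show ?thesis by simp
  qed
  have nrm: "(v + B *v v) \<bullet> (v + B *v v) = (2 + c) * (v \<bullet> v)" for v
  proof -
    have "v \<bullet> ((B + ?T B) *v v) = 2 * (v \<bullet> (B *v v))"
      using dot[of B v v]
      by (simp add: matrix_vector_mult_add_rdistrib inner_add_right inner_commute[of v "v v* B"])
    then have "2 * (v \<bullet> (B *v v)) = c * (v \<bullet> v)" unfolding c by simp
    then show ?thesis using orthogonal_matrix_inner[OF B(1), of v v]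
      by (simp add: inner_add_left inner_add_right inner_commute[of "B *v v" v] algebra_simps)
  qed
  \<comment> \<open>Since \<open>B\<close> is not \<open>-1\<close>, some \<open>v + B *v v\<close>
    is nonzero, and its squared length is \<open>2 + c\<close> times that of
    \<open>v\<close>.\<close>
  have s: "2 + c > 0"
  proof -
    obtain v where "B *v v \<noteq> (- mat 1) *v v" using ne matrix_eq by blast
    then have "B *v v \<noteq> - v" by (simp add: minus_mat_one_mult)
    then have "v + B *v v \<noteq> 0" by (metis add_eq_0_iff)
    then have 1: "0 < (2 + c) * (v \<bullet> v)" using nrm[of v] by (metis inner_gt_zero_iff)
    show ?thesis
    proof (rule ccontr)
      assume "\<not> ?thesis"
      then have "(2 + c) * (v \<bullet> v) \<le> 0" by (intro mult_nonpos_nonneg) simp_all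
      with 1 show False by simp
    qed
  qed
  define C where "C = (1 / sqrt (2 + c)) *\<^sub>R (mat 1 + B)"
  have C: "C *v v = (1 / sqrt (2 + c)) *\<^sub>R (v + B *v v)" for v
    by (simp add: C_def scaleR_matrix_vector_assoc[symmetric] matrix_vector_mult_add_rdistrib)
  have ss: "(1 / sqrt (2 + c)) * (1 / sqrt (2 + c)) = 1 / (2 + c)" using s by simp
  show ?thesis
  proof
    have "(C *v v) \<bullet> (C *v v) = (1 / sqrt (2 + c)) * (1 / sqrt (2 + c)) * ((2 + c) * (v \<bullet> v))" for v
      unfolding C by (simp add: nrm)
    then have "(C *v v) \<bullet> (C *v v) = v \<bullet> v" for v unfolding ss using s by simp
    then have "orthogonal_transformation ((*v) C)"
      by (simp add: orthogonal_transformation norm_eq_sqrt_inner)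
    then show "orthogonal_matrix C" by (simp add: orthogonal_transformation_matrix)
    have "C *v (C *v v) = B *v v" for v
    proof -
      have "C *v (C *v v) = ((1 / sqrt (2 + c)) * (1 / sqrt (2 + c))) *\<^sub>R (v + B *v v + B *v (v + B *v v))"
        unfolding C by (simp add: matrix_vector_mult_scaleR scaleR_right_distrib matrix_vector_right_distrib)
      also have "v + B *v v + B *v (v + B *v v) = (2 + c) *\<^sub>R (B *v v)"
        by (simp add: matrix_vector_right_distrib BB scaleR_left_distrib scaleR_2)
      finally show ?thesis unfolding ss using s by simp
    qed
    then show "C ** C = B" by (simp add: matrix_eq matrix_vector_mul_assoc[symmetric])
    show "C ** \<rho> g = \<rho> g ** C" if "g \<in> carrier G" for g
    proof -
      have "B *v (\<rho> g *v v) = \<rho> g *v (B *v v)" for v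
        using B(2)[OF that] by (simp add: matrix_vector_mul_assoc)
      then show ?thesis
        by (simp add: matrix_eq matrix_vector_mul_assoc[symmetric] C matrix_vector_mult_scaleR
            matrix_vector_right_distrib)
    qed
  qed
qed

section \<open>Conjugating a lift to its negative\<close>

text \<open>The alternating sum \<open>E\<close> of the powers of \<open>\<rho> z\<close> maps into
  the eigenspace for \<open>-1\<close>. The alternating character sum is its trace, so
  \<open>E\<close> is not zero.\<close>

lemma negative_eigenvector:
  fixes \<rho> :: "'g \<Rightarrow> real^'n::finite^'n"
  assumes G: "group G" and hom: "\<rho> \<in> hom G orthogonal_group" and z: "z \<in> carrier G"
    and l: "even l" "z [^]\<^bsub>G\<^esub> l = \<one>\<^bsub>G\<^esub>"
    and ne: "(\<Sum>k = 0..<l. (-1) ^ k * character \<rho> (z [^]\<^bsub>G\<^esub> k)) \<noteq> 0"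
  obtains v where "norm v = 1" "\<rho> z *v v = - v"
proof -
  interpret group G by (rule G)
  define a where "a w k = (-1) ^ k *\<^sub>R (\<rho> (z [^]\<^bsub>G\<^esub> k) *v w)" for w and k :: nat
  define E where "E w = (\<Sum>k<l. a w k)" for w
  have step: "\<rho> z *v a w k = - a w (Suc k)" for w k
  proof -
    have "\<rho> (z [^]\<^bsub>G\<^esub> Suc k) = \<rho> z ** \<rho> (z [^]\<^bsub>G\<^esub> k)"
      using hom_mult[OF hom z nat_pow_closed[OF z, of k]] nat_pow_Suc2[OF z, of k]
      by (simp add: orthogonal_group_def)
    then show ?thesis
      by (simp add: a_def matrix_vector_mult_scaleR matrix_vector_mul_assoc)
  qed
  have E: "\<rho> z *v E w = - E w" for w
  proof -
    have "\<rho> z *v E w = (\<Sum>k<l. - a w (Suc k))"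
      unfolding E_def by (simp add: step linear_sum[OF matrix_vector_mul_linear])
    also have "\<dots> = - (\<Sum>k<l. a w (Suc k))" by (rule sum_negf)
    \<comment> \<open>The shift by one is cyclic: \<open>a w l = a w 0\<close>, because
      \<open>l\<close> is even and annihilates \<open>z\<close>.\<close>
    also have "(\<Sum>k<l. a w (Suc k)) = E w"
    proof -
      have "a w 0 + (\<Sum>k<l. a w (Suc k)) = (\<Sum>k<l. a w k) + a w l"
        using sum.lessThan_Suc_shift[of "a w" l] sum.lessThan_Suc[of "a w" l] by simp
      moreover have "a w l = a w 0" using l by (simp add: a_def)
      ultimately show ?thesis by (simp add: E_def)
    qed
    finally show ?thesis .
  qed
  have "\<exists>w. E w \<noteq> 0"
  proof (rule ccontr)
    assume "\<not> ?thesis"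
    then have E0: "E w = 0" for w by blast
    have "(\<Sum>k = 0..<l. (-1) ^ k * character \<rho> (z [^]\<^bsub>G\<^esub> k)) = (\<Sum>k<l. \<Sum>i\<in>UNIV. a (axis i 1) k $ i)"
      by (simp add: character_def trace_via_axis a_def sum_distrib_left atLeast0LessThan)
    also have "\<dots> = (\<Sum>i\<in>UNIV. E (axis i 1) $ i)"
      unfolding E_def sum_component by (rule sum.swap)
    also have "\<dots> = 0" unfolding E0 by simp
    finally show False using ne by simp
  qed
  then obtain w where w: "E w \<noteq> 0" by blast
  show ?thesis
  proof
    show "norm (E w /\<^sub>R norm (E w)) = 1" using w by simp
    show "\<rho> z *v (E w /\<^sub>R norm (E w)) = - (E w /\<^sub>R norm (E w))"
      by (simp add: matrix_vector_mult_scaleR E)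
  qed
qed

text \<open>An element over \<open>-1\<close> anticommutes with all vectors if its determinant is
  \<open>1\<close> and commutes with them if it is \<open>-1\<close>; \<open>pin_induct\<close>
  carries this over to products of vectors.\<close>

lemma pin_cover_minus_one_commute:
  fixes b g :: "'n::finite clifford"
  assumes b: "b \<in> carrier pin_group" "pin_cover b = - mat 1" and g: "g \<in> carrier pin_group"
  shows "b * g = g * b \<or> b * g = grade_involution g * b"
    and "det (pin_cover b) = -1 \<Longrightarrow> b * g = g * b"
proof -
  have "- clifford_vec v * b = det (pin_cover b) *\<^sub>R b * clifford_vec v" for v
    using pin_cover_commute[OF b(1), of v] unfolding grade_involution_pin[OF b(1)] b(2)
    by (simp add: minus_mat_one_mult clifford_vec_minus)
  moreover have "det (pin_cover b) = 1 \<or> det (pin_cover b) = -1"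
    using det_orthogonal_matrix[OF pin_cover(3)[OF b(1)]] .
  ultimately have *: "(det (pin_cover b) = -1 \<and> (\<forall>v. b * clifford_vec v = clifford_vec v * b)) \<or>
      (det (pin_cover b) = 1 \<and> (\<forall>v. b * clifford_vec v = - clifford_vec v * b))"
    by auto
  have 1: "b * g = g * b" if "\<And>v. b * clifford_vec v = clifford_vec v * b"
    using g
  proof (induction rule: pin_induct)
    case (vec_mult u h)
    have "b * (clifford_vec u * h) = clifford_vec u * (b * h)"
      using that[of u] by (simp flip: mult.assoc)
    then show ?case unfolding vec_mult(3) by (simp only: mult.assoc)
  qed simp
  have 2: "b * g = grade_involution g * b" if "\<And>v. b * clifford_vec v = - clifford_vec v * b"
    using g
  proof (induction rule: pin_induct)
    case (vec_mult u h)
    have "b * (clifford_vec u * h) = - clifford_vec u * (b * h)"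
      using that[of u] by (simp flip: mult.assoc)
    then show ?case unfolding vec_mult(3) grade_involution_mult grade_involution_vec by (simp only: mult.assoc)
  qed simp
  show "b * g = g * b \<or> b * g = grade_involution g * b" using * 1 2 by blast
  show "b * g = g * b" if "det (pin_cover b) = -1" using * 1 that by auto
qed

section \<open>The two lifts\<close>

lemma sym_rep_mult:
  assumes "orthogonal_rep (sym_group m) \<rho>" "p permutes {1..m}" "q permutes {1..m}"
  shows "\<rho> (p \<circ> q) = \<rho> p ** \<rho> q"
  using hom_mult[of \<rho> "sym_group m" orthogonal_group p q] assms
  by (simp add: orthogonal_rep_def sym_group_def orthogonal_group_def)

lemma sym_rep_orthogonal:
  assumes "orthogonal_rep (sym_group m) \<rho>" "p permutes {1..m}"
  shows "orthogonal_matrix (\<rho> p)"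
  using hom_in_carrier[of \<rho> "sym_group m" orthogonal_group p] assms
  by (simp add: orthogonal_rep_def sym_group_def orthogonal_group_def)

lemma sym_rep_one:
  assumes "orthogonal_rep (sym_group m) \<rho>"
  shows "\<rho> id = mat 1"
  using hom_one[of \<rho> "sym_group m" orthogonal_group] assms sym_group_is_group group_orthogonal
  by (simp add: orthogonal_rep_def sym_group_def orthogonal_group_def)

lemma sym_rep_inv:
  assumes "orthogonal_rep (sym_group m) \<rho>" "p permutes {1..m}"
  shows "\<rho> (inv' p) = Finite_Cartesian_Product.transpose (\<rho> p)"
proof -
  have "\<rho> (inv' p) ** \<rho> p = mat 1"
    using sym_rep_mult[OF assms(1) permutes_inv[OF assms(2)] assms(2)] sym_rep_one[OF assms(1)]
    unfolding permutes_inv_o(2)[OF assms(2)] by simp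
  then have "\<rho> (inv' p) ** (\<rho> p ** Finite_Cartesian_Product.transpose (\<rho> p)) =
      Finite_Cartesian_Product.transpose (\<rho> p)"
    by (simp add: matrix_mul_assoc)
  then show ?thesis using sym_rep_orthogonal[OF assms] by (simp add: orthogonal_matrix_def)
qed

text \<open>\<open>involution_lift\<close> provides the normalised lifts that
  \<open>scalar_lifting\<close> asks for. It also gives transpositions determinant \<open>1\<close>,
  and therefore every permutation.\<close>

lemma pin_lift_exists:
  fixes \<rho> :: "(nat \<Rightarrow> nat) \<Rightarrow> real^'n::finite^'n"
  assumes m: "m \<ge> 4" and rep: "orthogonal_rep (sym_group m) \<rho>"
    and chr: "\<And>a b c d. {a, b, c, d} \<subseteq> {1..m} \<Longrightarrow> card {a, b, c, d} = 4 \<Longrightarrow>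
       [character \<rho> (tp a b) = real CARD('n)] (rmod 8) \<and>
       [character \<rho> (tp a b \<circ> tp c d) = real CARD('n)] (rmod 8)"
  obtains \<phi> where "\<phi> id = 1"
    and "\<And>p q. p permutes {1..m} \<Longrightarrow> q permutes {1..m} \<Longrightarrow> \<phi> (p \<circ> q) = \<phi> p * \<phi> q"
    and "\<And>p. p permutes {1..m} \<Longrightarrow> \<phi> p \<in> carrier pin_group \<and> pin_cover (\<phi> p) = \<rho> p"
    and "\<And>p. p permutes {1..m} \<Longrightarrow> det (\<rho> p) = 1"
proof -
  define L where "L p g \<longleftrightarrow> g \<in> carrier pin_group \<and> pin_cover g = \<rho> p" for p and g :: "'n clifford"
  have tpp: "tp a b permutes {1..m}" if "{a, b} \<subseteq> {1..m}" for a b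
    using that by (simp add: permutes_swap_id)
  have lift: "(\<exists>g. L p g \<and> g * g = 1) \<and> det (\<rho> p) = 1"
    if p: "p permutes {1..m}" "p \<circ> p = id" and c: "[character \<rho> p = real CARD('n)] (rmod 8)" for p
  proof -
    have "\<rho> p ** \<rho> p = mat 1"
      using sym_rep_mult[OF rep p(1) p(1)] sym_rep_one[OF rep] unfolding p(2) by simp
    then show ?thesis
      using involution_lift[OF sym_rep_orthogonal[OF rep p(1)] _ c[unfolded character_def]]
      unfolding L_def by blast
  qed
  \<comment> \<open>The character hypothesis speaks of four distinct points;
    \<open>m \<ge> 4\<close> supplies a disjoint partner for any transposition.\<close>
  have ext: "\<exists>c d. {a, b, c, d} \<subseteq> {1..m} \<and> card {a, b, c, d} = 4" if ab: "{a, b} \<subseteq> {1..m}" "a \<noteq> b" for a b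
  proof -
    have "card ({1..m} - {a, b}) \<ge> 2" using ab m by (simp add: card_Diff_subset)
    then obtain S where S: "S \<subseteq> {1..m} - {a, b}" "card S = 2" by (rule obtain_subset_with_card_n) blast
    then obtain c d where "S = {c, d}" "c \<noteq> d" by (auto simp: card_2_iff)
    then show ?thesis using S ab by (intro exI[of _ c] exI[of _ d]) auto
  qed
  have transp: "(\<exists>g. L (tp a b) g \<and> g * g = 1) \<and> det (\<rho> (tp a b)) = 1"
    if ab: "{a, b} \<subseteq> {1..m}" "a \<noteq> b" for a b
  proof -
    obtain c d where "{a, b, c, d} \<subseteq> {1..m}" "card {a, b, c, d} = 4" using ext[OF ab] by blast
    from chr[OF this] show ?thesis by (intro lift tpp[OF ab(1)] transpose_comp_involutory) blast
  qed
  have disj: "\<exists>g. L (tp a b \<circ> tp c d) g \<and> g * g = 1"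
    if abcd: "{a, b, c, d} \<subseteq> {1..m}" "card {a, b, c, d} = 4" for a b c d
  proof -
    have "{a, b} \<inter> {c, d} = {}" using abcd(2) by (auto simp: card_insert_if split: if_splits)
    then have swap: "tp c d \<circ> tp a b = tp a b \<circ> tp c d" by (rule tp_comp_commute[symmetric])
    have "tp a b \<circ> tp c d \<circ> (tp a b \<circ> tp c d) = tp a b \<circ> (tp c d \<circ> tp a b) \<circ> tp c d"
      by (simp only: comp_assoc)
    also have "\<dots> = tp a b \<circ> (tp a b \<circ> tp c d) \<circ> tp c d" unfolding swap ..
    also have "\<dots> = (tp a b \<circ> tp a b) \<circ> (tp c d \<circ> tp c d)" by (simp only: comp_assoc)
    also have "\<dots> = id" by (simp only: transpose_comp_involutory id_o)
    finally have sq: "tp a b \<circ> tp c d \<circ> (tp a b \<circ> tp c d) = id" .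
    have "tp a b \<circ> tp c d permutes {1..m}" using abcd(1) by (intro permutes_compose tpp) auto
    from lift[OF this sq] chr[OF abcd] show ?thesis by blast
  qed
  interpret scalar_lifting m L
  proof
    show "2 \<le> m" using m by simp
    show "L id 1" unfolding L_def using pin_one_closed pin_cover_one sym_rep_one[OF rep] by simp
    show "L (p \<circ> q) (g * h)" if "p permutes {1..m}" "q permutes {1..m}" "L p g" "L q h" for p q g h
      using that sym_rep_mult[OF rep that(1,2)] unfolding L_def
      by (simp add: pin_mult_closed pin_cover_mult)
    show "\<exists>h. L (inv' p) h \<and> g * h = 1 \<and> h * g = 1" if p: "p permutes {1..m}" "L p g" for p g
    proof -
      have g: "g \<in> carrier pin_group" "pin_cover g = \<rho> p" using p(2) by (auto simp: L_def)
      show ?thesis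
        by (rule exI[of _ "inv\<^bsub>pin_group\<^esub> g"])
          (simp add: L_def pin_cover_inv[OF g(1)] g(2) sym_rep_inv[OF rep p(1)] pin_inv[OF g(1)])
    qed
    show "\<exists>r. h = r *\<^sub>R g" if "p permutes {1..m}" "L p g" "L p h" for p g h
      using that(2,3) unfolding L_def by (intro pin_cover_eq_scaleR) auto
  qed (use transp disj in blast)+
  obtain \<phi> where \<phi>: "\<phi> id = 1"
    "\<And>p q. p permutes {1..m} \<Longrightarrow> q permutes {1..m} \<Longrightarrow> \<phi> (p \<circ> q) = \<phi> p * \<phi> q"
    "\<And>p. p permutes {1..m} \<Longrightarrow> L p (\<phi> p)"
    by (rule splitting) blast
  have "det (\<rho> p) = 1" if "p permutes {1..m}" for p
    using that
  proof (induction p rule: permutes_induct[OF _ finite_atLeastAtMost[of 1 m], consumes 1, case_names id swap])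
    case id
    show ?case unfolding sym_rep_one[OF rep] by simp
  next
    case (swap a b p)
    have ab: "{a, b} \<subseteq> {1..m}" using swap(1,2) by simp
    show ?case
      unfolding sym_rep_mult[OF rep tpp[OF ab] swap(4)] det_mul
      using transp[OF ab swap(3)] swap(5) by simp
  qed
  with \<phi> show ?thesis by (intro that[of \<phi>]) (auto simp: L_def)
qed

locale lifted_sym_rep =
  fixes m :: nat and \<rho> :: "(nat \<Rightarrow> nat) \<Rightarrow> real^'n::finite^'n" and \<phi> :: "(nat \<Rightarrow> nat) \<Rightarrow> 'n clifford"
  assumes m_ge: "3 \<le> m" and m_ne: "m \<noteq> 6"
    and rep: "orthogonal_rep (sym_group m) \<rho>"
    and faithful: "faithful_rep (sym_group m) \<rho>"
    and irr: "irreducible_rep (sym_group m) \<rho>"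
    and lift_mult: "\<And>p q. p permutes {1..m} \<Longrightarrow> q permutes {1..m} \<Longrightarrow> \<phi> (p \<circ> q) = \<phi> p * \<phi> q"
    and lift_pin: "\<And>p. p permutes {1..m} \<Longrightarrow> \<phi> p \<in> carrier pin_group"
    and lift_cover: "\<And>p. p permutes {1..m} \<Longrightarrow> pin_cover (\<phi> p) = \<rho> p"
    and det_one: "\<And>p. p permutes {1..m} \<Longrightarrow> det (\<rho> p) = 1"
begin

definition \<psi> :: "(nat \<Rightarrow> nat) \<Rightarrow> 'n clifford" where
  "\<psi> p = (if evenperm p then \<phi> p else - \<phi> p)"

lemma perm_permutation: "p permutes {1..m} \<Longrightarrow> permutation p"
  using permutation_permutes by blast

lemma twist_mult:
  assumes "p permutes {1..m}" "q permutes {1..m}"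
  shows "\<psi> (p \<circ> q) = \<psi> p * \<psi> q"
  unfolding \<psi>_def evenperm_comp[OF assms[THEN perm_permutation]] lift_mult[OF assms] by simp

lemma twist_pin: "p permutes {1..m} \<Longrightarrow> \<psi> p \<in> carrier pin_group"
  by (simp add: \<psi>_def lift_pin pin_uminus_closed)

lemma twist_cover: "p permutes {1..m} \<Longrightarrow> pin_cover (\<psi> p) = \<rho> p"
  by (simp add: \<psi>_def lift_pin lift_cover pin_cover_uminus)

lemma lift_even: "p permutes {1..m} \<Longrightarrow> grade_involution (\<phi> p) = \<phi> p"
  by (simp add: grade_involution_pin lift_pin lift_cover det_one)

lemma rho_inj: "p permutes {1..m} \<Longrightarrow> q permutes {1..m} \<Longrightarrow> \<rho> p = \<rho> q \<Longrightarrow> p = q"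
  using faithful by (simp add: faithful_rep_def inj_on_def sym_group_def)

lemma lift_inj: "p permutes {1..m} \<Longrightarrow> q permutes {1..m} \<Longrightarrow> \<phi> p = \<phi> q \<Longrightarrow> p = q"
  by (metis lift_cover rho_inj)

text \<open>At an odd \<open>t\<close> such a \<open>b\<close> would anticommute with
  \<open>\<phi> t\<close>, while its image commutes with \<open>\<rho>\<close>. Both possibilities
  for that image make the commutation factor positive.\<close>

lemma intertwiner_contradiction:
  assumes b: "b \<in> carrier pin_group" and inter: "\<And>p. p permutes {1..m} \<Longrightarrow> b * \<psi> p = \<phi> p * b"
  shows False
proof -
  define t where "t = tp 1 (2::nat)"
  have t: "t permutes {1..m}" using m_ge by (simp add: t_def permutes_swap_id)
  have "\<not> evenperm t" by (simp add: t_def evenperm_swap)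
  then have anti: "- (b * \<phi> t) = \<phi> t * b" using inter[OF t] by (simp add: \<psi>_def)
  have "\<phi> t * b \<in> carrier pin_group" using b lift_pin[OF t] by (rule pin_mult_closed[rotated])
  from pin_inv(1)[OF this] have ne: "\<phi> t * b \<noteq> 0" by auto
  have comm: "pin_cover b ** \<rho> p = \<rho> p ** pin_cover b" if p: "p permutes {1..m}" for p
    using arg_cong[OF inter[OF p], of pin_cover]
    by (simp add: pin_cover_mult b lift_pin[OF p] twist_pin[OF p] lift_cover[OF p] twist_cover[OF p])
  show False
  proof (cases "pin_cover b = - mat 1")
    case True
    then have "b * \<phi> t = \<phi> t * b"
      using pin_cover_minus_one_commute(1)[OF b True lift_pin[OF t]] lift_even[OF t] by auto
    then have "2 *\<^sub>R (\<phi> t * b) = 0" using anti by (simp add: scaleR_2) (metis add.left_inverse)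
    then show False using ne by simp
  next
    case False
    obtain C where C: "orthogonal_matrix C" "C ** C = pin_cover b"
      "\<And>p. p \<in> carrier (sym_group m) \<Longrightarrow> C ** \<rho> p = \<rho> p ** C"
    proof (rule commutant_square_root[OF irr _ pin_cover(3)[OF b] _ False])
      show "orthogonal_matrix (\<rho> p)" if "p \<in> carrier (sym_group m)" for p
        using sym_rep_orthogonal[OF rep] that by (simp add: sym_group_carrier)
      show "pin_cover b ** \<rho> p = \<rho> p ** pin_cover b" if "p \<in> carrier (sym_group m)" for p
        using comm that by (simp add: sym_group_carrier)
    qed blast
    \<comment> \<open>A lift \<open>c\<close> of the square root commutes with
      \<open>\<phi> t\<close> up to a real factor \<open>q\<close>. As \<open>b\<close> is a
      multiple of \<open>c * c\<close>, its own factor is \<open>q * q\<close>, which is not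
      \<open>-1\<close>.\<close>
    obtain c where c: "c \<in> carrier pin_group" "pin_cover c = C" by (rule pin_cover_surj[OF C(1)])
    have "pin_cover (c * c) = pin_cover b" using c C(2) by (simp add: pin_cover_mult)
    then obtain r where r: "b = r *\<^sub>R (c * c)"
      using pin_cover_eq_scaleR[OF pin_mult_closed[OF c(1) c(1)] b] by blast
    have "pin_cover (\<phi> t * c) = pin_cover (c * \<phi> t)"
      using C(3)[of t] t c lift_pin[OF t] by (simp add: pin_cover_mult lift_cover sym_group_carrier)
    then obtain q where q: "c * \<phi> t = q *\<^sub>R (\<phi> t * c)"
      using pin_cover_eq_scaleR[OF pin_mult_closed[OF lift_pin[OF t] c(1)] pin_mult_closed[OF c(1) lift_pin[OF t]]]
      by blast
    have "c * c * \<phi> t = c * (c * \<phi> t)" by (simp only: mult.assoc)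
    also have "\<dots> = c * (q *\<^sub>R (\<phi> t * c))" by (simp only: q)
    also have "\<dots> = q *\<^sub>R ((c * \<phi> t) * c)" by (simp add: mult.assoc)
    also have "\<dots> = q *\<^sub>R ((q *\<^sub>R (\<phi> t * c)) * c)" by (simp only: q)
    also have "\<dots> = (q * q) *\<^sub>R (\<phi> t * (c * c))" by (simp add: mult.assoc)
    finally have "b * \<phi> t = (q * q) *\<^sub>R (\<phi> t * b)" unfolding r by simp
    then have "(q * q + 1) *\<^sub>R (\<phi> t * b) = 0"
      using anti by (simp add: scaleR_left_distrib) (metis add.right_inverse)
    moreover have "q * q + 1 \<noteq> 0" by (metis add_nonneg_pos less_irrefl zero_le_square zero_less_one)
    ultimately show False using ne by simp
  qed
qed

text \<open>Conjugation by \<open>x\<close> would carry \<open>\<psi>\<close> to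
  \<open>\<phi>\<close> composed with an automorphism \<open>\<alpha>\<close>. If \<open>s\<close>
  realises \<open>\<alpha>\<close> as an inner automorphism, then the inverse of
  \<open>\<phi> s\<close> times \<open>x\<close> intertwines the two lifts.\<close>

lemma images_not_conjugate:
  assumes x: "x \<in> carrier pin_group"
  shows "\<phi> ` {p. p permutes {1..m}} \<noteq> (\<lambda>y. x * y * inv\<^bsub>pin_group\<^esub> x) ` \<psi> ` {p. p permutes {1..m}}"
proof
  let ?S = "{p. p permutes {1..m}}"
  let ?xi = "inv\<^bsub>pin_group\<^esub> x"
  assume eq: "\<phi> ` ?S = (\<lambda>y. x * y * ?xi) ` \<psi> ` ?S"
  have xx: "x * ?xi = 1" "?xi * x = 1" using pin_inv[OF x] by auto
  have "\<exists>q. q permutes {1..m} \<and> \<phi> q = x * \<psi> p * ?xi" if "p permutes {1..m}" for p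
  proof -
    have "x * \<psi> p * ?xi \<in> \<phi> ` ?S" unfolding eq using that by blast
    then show ?thesis by auto
  qed
  then obtain \<alpha> where \<alpha>: "\<And>p. p permutes {1..m} \<Longrightarrow> \<alpha> p permutes {1..m} \<and> \<phi> (\<alpha> p) = x * \<psi> p * ?xi"
    by metis
  have conj: "\<phi> (\<alpha> p) * x = x * \<psi> p" if "p permutes {1..m}" for p
    using \<alpha>[OF that] xx by (simp add: mult.assoc)
  have hom: "\<alpha> (p \<circ> q) = \<alpha> p \<circ> \<alpha> q" if p: "p permutes {1..m}" and q: "q permutes {1..m}" for p q
  proof (rule lift_inj)
    show "\<alpha> (p \<circ> q) permutes {1..m}" "\<alpha> p \<circ> \<alpha> q permutes {1..m}"
      using \<alpha> p q permutes_compose[OF q p] by (auto intro: permutes_compose)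
    have "\<phi> (\<alpha> p \<circ> \<alpha> q) = x * \<psi> p * (?xi * x) * \<psi> q * ?xi"
      using \<alpha> p q by (simp add: lift_mult mult.assoc)
    then show "\<phi> (\<alpha> (p \<circ> q)) = \<phi> (\<alpha> p \<circ> \<alpha> q)"
      using \<alpha>[OF permutes_compose[OF q p]] unfolding twist_mult[OF p q] xx by (simp add: mult.assoc)
  qed
  \<comment> \<open>Injectivity comes from faithfulness of \<open>\<rho>\<close>, seen through the
    covering; finiteness then gives surjectivity.\<close>
  have "inj_on \<alpha> ?S"
  proof (rule inj_onI)
    fix p q assume pq: "p \<in> ?S" "q \<in> ?S" "\<alpha> p = \<alpha> q"
    then have "x * \<psi> p = x * \<psi> q" using conj by (metis mem_Collect_eq)
    then have "(?xi * x) * \<psi> p = (?xi * x) * \<psi> q" by (simp only: mult.assoc)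
    then have "\<psi> p = \<psi> q" unfolding xx by simp
    then show "p = q" using pq rho_inj twist_cover by (metis mem_Collect_eq)
  qed
  moreover have "\<alpha> ` ?S = ?S"
    using \<alpha> by (intro endo_inj_surj \<open>inj_on \<alpha> ?S\<close> finite_permutations finite_atLeastAtMost) auto
  ultimately have bij: "bij_betw \<alpha> ?S ?S" by (rule bij_betw_imageI)
  obtain s where s: "s permutes {1..m}" "\<And>p. p permutes {1..m} \<Longrightarrow> \<alpha> p \<circ> s = s \<circ> p"
    by (rule sym_automorphism_inner[OF m_ge m_ne bij hom]) blast+
  let ?si = "inv\<^bsub>pin_group\<^esub> (\<phi> s)"
  have ss: "\<phi> s * ?si = 1" "?si * \<phi> s = 1" "?si \<in> carrier pin_group"
    using pin_inv[OF lift_pin[OF s(1)]] pin_cover_inv(1)[OF lift_pin[OF s(1)]] by auto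
  have "?si * x * \<psi> p = \<phi> p * (?si * x)" if p: "p permutes {1..m}" for p
  proof -
    have "\<phi> (\<alpha> p) * \<phi> s = \<phi> s * \<phi> p"
      using arg_cong[OF s(2)[OF p], of \<phi>] \<alpha>[OF p] s(1) p by (simp only: lift_mult)
    then have e: "?si * \<phi> (\<alpha> p) * (\<phi> s * ?si) = (?si * \<phi> s) * \<phi> p * ?si"
      by (metis mult.assoc)
    have "?si * x * \<psi> p = ?si * (\<phi> (\<alpha> p) * x)" unfolding conj[OF p] by (simp only: mult.assoc)
    also have "\<dots> = ?si * \<phi> (\<alpha> p) * x" by (simp only: mult.assoc)
    also have "\<dots> = \<phi> p * ?si * x" using e unfolding ss by simp
    finally show ?thesis by (simp only: mult.assoc)
  qed
  then show False by (rule intertwiner_contradiction[OF pin_mult_closed[OF ss(3) x]])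
qed

text \<open>
  Since \<open>\<phi> z\<close> has even degree, a unit vector \<open>v\<close> with \<open>\<rho> z v = - v\<close> anticommutes with it.  For odd
  \<open>n\<close> the vector is moved into \<open>Spin(n)\<close> by the central element above \<open>- 1\<close>.
\<close>

lemma conjugator:
  assumes z: "z permutes {1..m}" and v: "norm v = 1" "\<rho> z *v v = - v"
  shows "\<exists>x\<in>carrier pin_group. \<phi> z * x = - (x * \<phi> z) \<and> (odd CARD('n) \<longrightarrow> det (pin_cover x) = 1)"
proof -
  let ?v = "clifford_vec v"
  have pv: "?v \<in> carrier pin_group" by (rule unit_vec_in_pin[OF v(1)])
  have vz: "- ?v * \<phi> z = \<phi> z * ?v"
    using pin_cover_commute[OF lift_pin[OF z], of v] unfolding lift_cover[OF z] v(2) lift_even[OF z]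
    by (simp add: clifford_vec_minus)
  show ?thesis
  proof (cases "odd CARD('n)")
    case False
    then show ?thesis using pv vz by (intro bexI[of _ ?v]) auto
  next
    case True
    have "(*v) (- mat 1 :: real^'n^'n) = (\<lambda>v. - v)" by (rule ext) (rule minus_mat_one_mult)
    moreover have "orthogonal_transformation (\<lambda>v :: real^'n. - v)"
      by (rule orthogonal_transformation_neg[THEN iffD2]) (rule orthogonal_transformation_id)
    ultimately have "orthogonal_transformation ((*v) (- mat 1 :: real^'n^'n))" by simp
    then have neg: "orthogonal_matrix (- mat 1 :: real^'n^'n)"
      unfolding orthogonal_transformation_matrix by simp
    obtain w where w: "w \<in> carrier pin_group" "pin_cover w = (- mat 1 :: real^'n^'n)"
      by (rule pin_cover_surj[OF neg])
    have "det (- mat 1 :: real^'n^'n) = (-1) ^ CARD('n)"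
      by (subst det_diagonal) (simp_all add: mat_def)
    then have dw: "det (pin_cover w) = -1" using w(2) True by simp
    have wz: "w * \<phi> z = \<phi> z * w" by (rule pin_cover_minus_one_commute(2)[OF w lift_pin[OF z] dw])
    have "\<phi> z * (?v * w) = - ?v * (\<phi> z * w)" unfolding vz[symmetric] mult.assoc[symmetric] by simp
    then have "\<phi> z * (?v * w) = - (?v * w * \<phi> z)" unfolding wz[symmetric] by (simp add: mult.assoc)
    moreover have "det (pin_cover (?v * w)) = 1"
      using w dw pv by (simp add: pin_cover_mult det_mul pin_cover_vec[OF v(1)] det_reflection[OF v(1)])
    ultimately show ?thesis using pin_mult_closed[OF pv w(1)] by blast
  qed
qed

text \<open>On even permutations the lifts agree and \<open>1\<close> conjugates; odd ones are
  handled by \<open>conjugator\<close>. The determinant clause places the same conjugators in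
  \<open>Spin(n)\<close> when \<open>n\<close> is odd.\<close>

lemma elementwise:
  assumes ev: "\<And>z. z permutes {1..m} \<Longrightarrow> \<not> evenperm z \<Longrightarrow> \<exists>v. norm v = 1 \<and> \<rho> z *v v = - v"
    and z: "z permutes {1..m}"
  shows "\<exists>x\<in>carrier pin_group. \<phi> z * x = x * \<psi> z \<and> (odd CARD('n) \<longrightarrow> det (pin_cover x) = 1)"
proof (cases "evenperm z")
  case True
  then show ?thesis by (intro bexI[of _ 1]) (simp_all add: \<psi>_def pin_one_closed pin_cover_one)
next
  case False
  then obtain v where "norm v = 1" "\<rho> z *v v = - v" using ev[OF z] by blast
  from conjugator[OF z this] show ?thesis using False by (simp add: \<psi>_def)
qed

lemma cover_images:
  "pin_cover ` \<phi> ` carrier (sym_group m) = \<rho> ` carrier (sym_group m)"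
  "pin_cover ` \<psi> ` carrier (sym_group m) = \<rho> ` carrier (sym_group m)"
  unfolding image_image
  by (rule image_cong[OF refl], simp add: sym_group_carrier lift_cover)
     (rule image_cong[OF refl], simp add: sym_group_carrier twist_cover)

text \<open>Treats \<open>Pin(n)\<close> and \<open>Spin(n)\<close> together: inverses agree with
  those of \<open>Pin(n)\<close>, and images not conjugate in the larger group are not conjugate in
  the smaller one.\<close>

lemma admissible_subgroup:
  assumes H: "group H" "carrier H \<subseteq> carrier pin_group"
    and mult: "\<And>x y. x \<otimes>\<^bsub>H\<^esub> y = x * y" and one: "\<one>\<^bsub>H\<^esub> = 1"
    and lift: "\<And>p. p permutes {1..m} \<Longrightarrow> \<phi> p \<in> carrier H \<and> \<psi> p \<in> carrier H"
    and elem: "\<And>z. z permutes {1..m} \<Longrightarrow> \<exists>x\<in>carrier H. \<phi> z * x = x * \<psi> z"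
  shows "admissible H \<phi> \<psi> (sym_group m)"
proof -
  have inv: "x * inv\<^bsub>H\<^esub> x = 1" "inv\<^bsub>H\<^esub> x = inv\<^bsub>pin_group\<^esub> x" if x: "x \<in> carrier H" for x
  proof -
    have xp: "x \<in> carrier pin_group" using H x by blast
    show 1: "x * inv\<^bsub>H\<^esub> x = 1" using group.r_inv[OF H(1) x] by (simp add: mult one)
    have "inv\<^bsub>H\<^esub> x = (inv\<^bsub>pin_group\<^esub> x * x) * inv\<^bsub>H\<^esub> x" using pin_inv(2)[OF xp] by simp
    also have "\<dots> = inv\<^bsub>pin_group\<^esub> x" unfolding mult.assoc 1 by simp
    finally show "inv\<^bsub>H\<^esub> x = inv\<^bsub>pin_group\<^esub> x" .
  qed
  have "\<phi> z = x * \<psi> z * inv\<^bsub>H\<^esub> x" if "x \<in> carrier H" "\<phi> z * x = x * \<psi> z" for x z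
    using that(2)[symmetric] inv(1)[OF that(1)] by (simp add: mult.assoc)
  then have "elementwise_conjugate H (sym_group m) \<phi> \<psi>"
    unfolding elementwise_conjugate_def using elem by (metis mult sym_group_carrier)
  moreover have "\<phi> \<in> hom (sym_group m) H" "\<psi> \<in> hom (sym_group m) H"
    using lift by (auto simp: hom_def sym_group_def mult lift_mult twist_mult)
  moreover have "\<not> (\<exists>x\<in>carrier H. \<phi> ` carrier (sym_group m)
      = (\<lambda>y. x \<otimes>\<^bsub>H\<^esub> y \<otimes>\<^bsub>H\<^esub> inv\<^bsub>H\<^esub> x) ` \<psi> ` carrier (sym_group m))"
  proof
    assume "\<exists>x\<in>carrier H. \<phi> ` carrier (sym_group m)
      = (\<lambda>y. x \<otimes>\<^bsub>H\<^esub> y \<otimes>\<^bsub>H\<^esub> inv\<^bsub>H\<^esub> x) ` \<psi> ` carrier (sym_group m)"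
    then obtain x where x: "x \<in> carrier H" "\<phi> ` carrier (sym_group m)
      = (\<lambda>y. x * y * inv\<^bsub>pin_group\<^esub> x) ` \<psi> ` carrier (sym_group m)"
      using inv(2) by (auto simp: mult)
    then show False using images_not_conjugate[of x] H by (auto simp: sym_group_def)
  qed
  moreover have "finite (carrier (sym_group m))"
    unfolding sym_group_def by (simp add: finite_permutations)
  ultimately show ?thesis unfolding admissible_def using H(1) sym_group_is_group by blast
qed

end

theorem theorem2p10:
  fixes m :: nat and \<rho> :: "(nat \<Rightarrow> nat) \<Rightarrow> real^'n::finite^'n"
  assumes "m \<ge> 4" and "m \<noteq> 6"
    and "orthogonal_rep (sym_group m) \<rho>"
    and "faithful_rep (sym_group m) \<rho>"
    and "irreducible_rep (sym_group m) \<rho>"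
    and "\<And>a b c d. {a, b, c, d} \<subseteq> {1..m} \<Longrightarrow> card {a, b, c, d} = 4 \<Longrightarrow>
           [character \<rho> (Transposition.transpose a b) = real CARD('n)] (rmod 8) \<and>
           [character \<rho> (Transposition.transpose a b \<otimes>\<^bsub>sym_group m\<^esub> Transposition.transpose c d)
              = real CARD('n)] (rmod 8)"
    and "\<And>z. z \<in> carrier (sym_group m) \<Longrightarrow> \<not> evenperm z \<Longrightarrow>
           1 / real (group.ord (sym_group m) z) *
             (\<Sum>k = 0..<group.ord (sym_group m) z. (-1) ^ k * character \<rho> (z [^]\<^bsub>sym_group m\<^esub> k)) > 0"
  shows "(odd CARD('n) \<longrightarrow>
            (\<exists>\<phi>\<^sub>1 \<phi>\<^sub>2. admissible (spin_group :: 'n clifford monoid) \<phi>\<^sub>1 \<phi>\<^sub>2 (sym_group m) \<and>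
               pin_cover ` \<phi>\<^sub>1 ` carrier (sym_group m) = \<rho> ` carrier (sym_group m) \<and>
               pin_cover ` \<phi>\<^sub>2 ` carrier (sym_group m) = \<rho> ` carrier (sym_group m)))
       \<and> (\<exists>\<phi>\<^sub>1 \<phi>\<^sub>2. admissible (pin_group :: 'n clifford monoid) \<phi>\<^sub>1 \<phi>\<^sub>2 (sym_group m) \<and>
               pin_cover ` \<phi>\<^sub>1 ` carrier (sym_group m) = \<rho> ` carrier (sym_group m) \<and>
               pin_cover ` \<phi>\<^sub>2 ` carrier (sym_group m) = \<rho> ` carrier (sym_group m))"
proof -
  interpret S: group "sym_group m" by (rule sym_group_is_group)
  obtain \<phi> where \<phi>: "\<phi> id = 1"
    "\<And>p q. p permutes {1..m} \<Longrightarrow> q permutes {1..m} \<Longrightarrow> \<phi> (p \<circ> q) = \<phi> p * \<phi> q"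
    "\<And>p. p permutes {1..m} \<Longrightarrow> \<phi> p \<in> carrier pin_group \<and> pin_cover (\<phi> p) = \<rho> p"
    "\<And>p. p permutes {1..m} \<Longrightarrow> det (\<rho> p) = 1"
    by (rule pin_lift_exists[OF assms(1,3) assms(6)[unfolded sym_group_mult]]) blast+
  interpret lifted_sym_rep m \<rho> \<phi>
    by unfold_locales (use assms(1-5) \<phi>(2-4) in auto)
  have ev: "\<exists>v. norm v = 1 \<and> \<rho> z *v v = - v" if z: "z permutes {1..m}" "\<not> evenperm z" for z
  proof -
    have zc: "z \<in> carrier (sym_group m)" using z(1) by (simp add: sym_group_carrier)
    \<comment> \<open>Powers of an odd permutation alternate in parity, so its order is even, as
      \<open>negative_eigenvector\<close> requires.\<close>
    have par: "evenperm (z [^]\<^bsub>sym_group m\<^esub> k) \<longleftrightarrow> even k" for k :: nat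
    proof (induction k)
      case 0
      then show ?case by (simp add: sym_group_one)
    next
      case (Suc k)
      have "permutation (z [^]\<^bsub>sym_group m\<^esub> k)"
        by (rule sym_group_carrier'[OF S.nat_pow_closed[OF zc]])
      from evenperm_comp[OF this sym_group_carrier'[OF zc]] Suc z(2)
      have "evenperm (z [^]\<^bsub>sym_group m\<^esub> k \<circ> z) \<longleftrightarrow> even (Suc k)" by simp
      then show ?case unfolding S.nat_pow_Suc sym_group_mult .
    qed
    let ?l = "S.ord z"
    have one: "z [^]\<^bsub>sym_group m\<^esub> ?l = \<one>\<^bsub>sym_group m\<^esub>" by (rule S.pow_ord_eq_1[OF zc])
    then have "even ?l" using par[of ?l] by (simp add: sym_group_one)
    moreover have "(\<Sum>k = 0..<?l. (-1) ^ k * character \<rho> (z [^]\<^bsub>sym_group m\<^esub> k)) \<noteq> 0"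
      using assms(7)[OF zc z(2)] by auto
    ultimately show ?thesis
      using negative_eigenvector[OF sym_group_is_group assms(3)[unfolded orthogonal_rep_def] zc _ one]
      by metis
  qed
  have "admissible pin_group \<phi> \<psi> (sym_group m)"
  proof (rule admissible_subgroup[OF group_pin order_refl])
    show "\<exists>x\<in>carrier pin_group. \<phi> z * x = x * \<psi> z" if "z permutes {1..m}" for z
      using elementwise[OF ev that] by blast
  qed (simp_all add: lift_pin twist_pin)
  moreover have "admissible spin_group \<phi> \<psi> (sym_group m)" if "odd CARD('n)"
  proof (rule admissible_subgroup[OF group_spin])
    \<comment> \<open>Orthogonality of the image is automatic, so membership in
      \<open>Spin(n)\<close> is a condition on the determinant alone.\<close>
    have carrier: "g \<in> carrier spin_group \<longleftrightarrow> g \<in> carrier pin_group \<and> det (pin_cover g) = 1" for g :: "'n clifford"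
      using pin_cover(3)[of g] by (auto simp: spin_group_def special_orthogonal_def)
    show "carrier spin_group \<subseteq> (carrier pin_group :: 'n clifford set)" using carrier by blast
    show "x \<otimes>\<^bsub>spin_group\<^esub> y = x * y" for x y :: "'n clifford" by (simp add: spin_group_def)
    show "\<one>\<^bsub>spin_group\<^esub> = (1 :: 'n clifford)" by (simp add: spin_group_def)
    show "\<phi> p \<in> carrier spin_group \<and> \<psi> p \<in> carrier spin_group" if "p permutes {1..m}" for p
      using that by (simp add: carrier lift_pin twist_pin lift_cover twist_cover det_one)
    show "\<exists>x\<in>carrier spin_group. \<phi> z * x = x * \<psi> z" if "z permutes {1..m}" for z
      using elementwise[OF ev that] \<open>odd CARD('n)\<close> carrier by blast
  qed
  ultimately show ?thesis using cover_images by blast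
qed

end
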